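(* Let $T:[0,1)\to[0,1)$ be either the $\beta$-transformation $T_\beta x=\beta x \pmod 1$ for some real $\beta>1$, or the Gauss map $G$. Let $f:[0,1]\to\mathbb{R}$ be a positive continuous function and let $\{h_n\}$ be a sequence of Lipschitz functions $h_n:[0,1]\to\mathbb{R}$ whose Lipschitz constants are uniformly bounded. Define \[W(T,f,\{h_n\})=\{x\in[0,1): |T^nx-h_n(x)|<e^{-S_nf(x)}\text{ for infinitely many } n\},\qquad S_nf(x)=\sum_{k=0}^{n-1}f(T^kx).\] Then $W(T,f,\{h_n\})\in\mathscr{G}^s([0,1])$, where $s$ is the unique solution of $P(-s(f+\log|T'|),T)=0$.
   Context: The Gauss map is $G(0)=0$, $G(x)=1/x \pmod 1$ for $x\in(0,1)$; for $T=T_\beta$, $\log|T'|\equiv\log\beta$. $\beta$-expansions: $\epsilon_n(x,\beta)=\lfloor\beta T_\beta^{n-1}x\rfloor$; a word $(\epsilon_1,\dots,\epsilon_n)$ is $\beta$-admissible if some $x\in[0,1)$ has $\beta$-expansion beginning with it; $\Sigma_\beta^n$ is the set of admissible words of length $n$, and $I_{n,\beta}(\epsilon_1,\dots,\epsilon_n)=\{x:\epsilon_k(x,\beta)=\epsilon_k,1\le k\le n\}$. For continuous $\phi$, the pressure is $P(\phi,T_\beta)=\lim_{n\to\infty}\frac1n\log\sum_{w\in\Sigma_\beta^n}e^{S_n\phi(y_w)}$ with $y_w\in I_{n,\beta}(w)$ arbitrary. Continued fractions: for irrational $x$, $a_1(x)=\lfloor 1/x\rfloor$, $a_n(x)=a_1(G^{n-1}x)$;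 $I_n(a_1,\dots,a_n)=\{x: a_k(x)=a_k,1\le k\le n\}$. The pressure for $G$ is $P(\phi,G)=\lim_{n\to\infty}\frac1n\log\sum_{(a_1,\dots,a_n)\in\mathbb{N}^n}e^{S_n\phi(y)}$ with $y\in I_n(a_1,\dots,a_n)$. Hausdorff content: $\mathcal{H}^t_\infty(A)=\inf\{\sum_i|B_i|^t: A\subset\bigcup_iB_i,\ B_i \text{ balls}\}$. For $0<s\le 1$, $\mathscr{G}^s([0,1])$ is the class of $G_\delta$ subsets $A\subset[0,1]$ for which there is $c>0$ such that for every $0<t<s$ and every ball $B\subset[0,1]$, $\mathcal{H}^t_\infty(A\cap B)>c\,\mathcal{H}^t_\infty(B)$.
   Formalization: The h_n are assumed to map [0,1] into [0,1] (for h_n = 5 the set W is empty), and membership in G^s is proved for W minus the countable set of points with T^n x = 0 for some n, since W itself need not be G_delta (e.g. beta = 2, f = 1, h_n = 0). *)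

theory Defs
  imports "HOL-Analysis.Analysis"
begin

section \<open>The two maps\<close>

datatype interval_map = Beta real | Gauss

fun admissible_map :: "interval_map \<Rightarrow> bool" where
  "admissible_map (Beta b) \<longleftrightarrow> b > 1"
| "admissible_map Gauss \<longleftrightarrow> True"

fun imap :: "interval_map \<Rightarrow> real \<Rightarrow> real" where
  "imap (Beta b) x = frac (b * x)"
| "imap Gauss x = (if x = 0 then 0 else frac (1 / x))"

text \<open>The function \<open>log |T'|\<close>. For the beta transformation it is the constant \<open>log \<beta>\<close>
  by convention, including at the discontinuities. For the Gauss map it is only ever evaluated
  at irrational points of the unit interval, where the derivative exists.\<close>

fun log_deriv :: "interval_map \<Rightarrow> real \<Rightarrow> real" where
  "log_deriv (Beta b) x = ln b"
| "log_deriv Gauss x = ln \<bar>deriv (imap Gauss) x\<bar>"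

definition birkhoff :: "interval_map \<Rightarrow> (real \<Rightarrow> real) \<Rightarrow> nat \<Rightarrow> real \<Rightarrow> real" where
  "birkhoff T \<phi> n x = (\<Sum>k<n. \<phi> ((imap T ^^ k) x))"

section \<open>Symbolic coding and pressure\<close>

text \<open>Points having an expansion: \<open>[0,1)\<close> for beta expansions, the irrationals
  of \<open>(0,1)\<close> for continued fractions.\<close>

fun coded_points :: "interval_map \<Rightarrow> real set" where
  "coded_points (Beta b) = {0..<1}"
| "coded_points Gauss = {0<..<1} - \<rat>"

fun digit :: "interval_map \<Rightarrow> real \<Rightarrow> int" where
  "digit (Beta b) x = \<lfloor>b * x\<rfloor>"
| "digit Gauss x = \<lfloor>1 / x\<rfloor>"

text \<open>Words are indexed from \<open>0\<close>: \<open>w ! k\<close> is the letter with index \<open>k + 1\<close> in the usual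
  notation.\<close>

definition cylinder :: "interval_map \<Rightarrow> int list \<Rightarrow> real set" where
  "cylinder T w =
     {x \<in> coded_points T. \<forall>k<length w. digit T ((imap T ^^ k) x) = w ! k}"

fun words :: "interval_map \<Rightarrow> nat \<Rightarrow> int list set" where
  "words (Beta b) n = {w. length w = n \<and> cylinder (Beta b) w \<noteq> {}}"
| "words Gauss n = {w. length w = n \<and> set w \<subseteq> {1..}}"

definition ext_ln :: "ennreal \<Rightarrow> ereal" where
  "ext_ln x = (if x = 0 then -\<infinity> else if x = \<infinity> then \<infinity> else ereal (ln (enn2real x)))"

text \<open>\<open>has_pressure T \<phi> p\<close> says \<open>P(\<phi>, T) = p\<close>: the defining limit exists and equals \<open>p\<close> for
  every choice \<open>y\<close> of sample points in the cylinders. The sums may be infinite for the Gauss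
  map, hence the extended values.\<close>

definition has_pressure :: "interval_map \<Rightarrow> (real \<Rightarrow> real) \<Rightarrow> ereal \<Rightarrow> bool" where
  "has_pressure T \<phi> p \<longleftrightarrow>
     (\<forall>y. (\<forall>n. \<forall>w\<in>words T n. y w \<in> cylinder T w) \<longrightarrow>
        (\<lambda>n. ext_ln (\<Sum>\<^sub>\<infinity>w\<in>words T n. ennreal (exp (birkhoff T \<phi> n (y w)))) / ereal (real n))
          \<longlonglongrightarrow> p)"

section \<open>Hausdorff content and the large intersection class\<close>

definition is_ball :: "real set \<Rightarrow> bool" where
  "is_ball B \<longleftrightarrow> (\<exists>c r. r > 0 \<and> (B = ball c r \<or> B = cball c r))"

text \<open>Allowing empty members in the covering sequences accounts for finite covers; an empty
  member contributes \<open>0\<close>, since \<open>diameter {} = 0\<close> and \<open>0 powr t = 0\<close>.\<close>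

definition hausdorff_content :: "real \<Rightarrow> real set \<Rightarrow> ennreal" where
  "hausdorff_content t A =
     (INF B \<in> {B :: nat \<Rightarrow> real set. (\<forall>i. B i = {} \<or> is_ball (B i)) \<and> A \<subseteq> (\<Union>i. B i)}.
        (\<Sum>i. ennreal (diameter (B i) powr t)))"

definition large_intersection_class :: "real \<Rightarrow> real set set" where
  "large_intersection_class s =
     {A. A \<subseteq> {0..1} \<and> gdelta A \<and>
        (\<exists>c>0. \<forall>t. 0 < t \<and> t < s \<longrightarrow>
           (\<forall>B. is_ball B \<and> B \<subseteq> {0..1} \<longrightarrow>
              hausdorff_content t (A \<inter> B) > ennreal c * hausdorff_content t B))}"

section \<open>The limsup set\<close>

definition W_set :: "interval_map \<Rightarrow> (real \<Rightarrow> real) \<Rightarrow> (nat \<Rightarrow> real \<Rightarrow> real) \<Rightarrow> real set" where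
  "W_set T f h =
     {x \<in> {0..<1}. infinite {n. \<bar>(imap T ^^ n) x - h n x\<bar> < exp (- birkhoff T f n x)}}"

text \<open>The points whose orbit hits \<open>0\<close>. Every point of \<open>[0,1)\<close> at which some iterate of the map
  is discontinuous belongs to this countable set. It has to be removed from \<open>W_set T f h\<close>
  before one can assert the G-delta property: for \<open>T = Beta 2\<close>, \<open>f = 1\<close>, \<open>h n = 0\<close>, the set of
  numbers in \<open>[0,1]\<close> having a binary expansion without two consecutive zeros is compact and
  perfect and meets \<open>W_set T f h\<close> in a countable dense subset (its dyadic rationals), so by
  Baire's theorem \<open>W_set T f h\<close> is not a G-delta set. The removal does not affect the content
  bounds, and it is immaterial whenever \<open>W_set T f h\<close> is a G-delta set, by the last lemma
  below.\<close>

definition zero_orbits :: "interval_map \<Rightarrow> real set" where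
  "zero_orbits T = {x. \<exists>n. (imap T ^^ n) x = 0}"

lemma countable_imap_vimage:
  assumes T: "admissible_map T" and S: "countable S"
  shows "countable {x. imap T x \<in> S}"
proof (cases T)
  case (Beta b)
  have "{x. imap T x \<in> S} \<subseteq> (\<lambda>(y, m). (y + of_int m) / b) ` (S \<times> (UNIV :: int set))"
  proof
    fix x assume "x \<in> {x. imap T x \<in> S}"
    then have "frac (b * x) \<in> S" using Beta by simp
    moreover have "x = (frac (b * x) + of_int \<lfloor>b * x\<rfloor>) / b"
      using T Beta by (simp add: frac_def)
    ultimately show "x \<in> (\<lambda>(y, m). (y + of_int m) / b) ` (S \<times> (UNIV :: int set))"
      by (intro image_eqI[where x = "(frac (b * x), \<lfloor>b * x\<rfloor>)"]) auto
  qed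
  then show ?thesis
    by (rule countable_subset) (use S in auto)
next
  case Gauss
  have "{x. imap T x \<in> S} \<subseteq> insert 0 ((\<lambda>(y, m). 1 / (y + of_int m)) ` (S \<times> (UNIV :: int set)))"
  proof
    fix x assume *: "x \<in> {x. imap T x \<in> S}"
    show "x \<in> insert 0 ((\<lambda>(y, m). 1 / (y + of_int m)) ` (S \<times> (UNIV :: int set)))"
    proof (cases "x = 0")
      case False
      then have "frac (1 / x) \<in> S" using * Gauss by simp
      moreover have "x = 1 / (frac (1 / x) + of_int \<lfloor>1 / x\<rfloor>)"
        by (simp add: frac_def)
      ultimately show ?thesis
        by (intro insertI2 image_eqI[where x = "(frac (1 / x), \<lfloor>1 / x\<rfloor>)"]) auto
    qed simp
  qed
  then show ?thesis
    by (rule countable_subset) (use S in auto)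
qed

lemma countable_zero_orbits:
  assumes "admissible_map T"
  shows "countable (zero_orbits T)"
proof -
  have "countable {x. (imap T ^^ n) x = 0}" for n
  proof (induction n)
    case (Suc n)
    show ?case
      using countable_imap_vimage[OF assms Suc] by (simp add: funpow_swap1)
  qed simp
  moreover have "zero_orbits T = (\<Union>n. {x. (imap T ^^ n) x = 0})"
    by (auto simp: zero_orbits_def)
  ultimately show ?thesis by simp
qed

lemma hausdorff_content_mono:
  assumes "A \<subseteq> A'"
  shows "hausdorff_content t A \<le> hausdorff_content t A'"
  unfolding hausdorff_content_def by (rule INF_superset_mono) (use assms in auto)

lemma large_intersection_class_undelete:
  assumes "A - Z \<in> large_intersection_class s" "A \<subseteq> {0..1}" "gdelta A"
  shows "A \<in> large_intersection_class s"
proof -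
  have "hausdorff_content t ((A - Z) \<inter> B) \<le> hausdorff_content t (A \<inter> B)" for t B
    by (rule hausdorff_content_mono) auto
  then show ?thesis
    using assms unfolding large_intersection_class_def by (blast intro: less_le_trans)
qed

end

theory Submission
  imports Defs
begin

text \<open>
  Write \<open>F = f + log |T'|\<close> and fix \<open>t < s\<close>. The pressure at \<open>t\<close> is positive, so for some order \<open>m\<close> there
  are finitely many full cylinders \<open>w\<close> of order \<open>m\<close> whose weights \<open>exp (- t S_m F)\<close> have a sum as large as
  desired: for the beta map, of two cylinders with the same parent the left one is full, so the
  sum over all words of length \<open>n\<close> is at most the sum over the full words of length at most \<open>n\<close>.
  Iterating the inverse branches of these cylinders inside an arbitrary full cylinder \<open>u\<close> gives a tree
  whose leaves contain intervals \<open>J\<close> on which \<open>|T^n x - h_n x| < exp (- S_n f x)\<close>, with length comparable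
  to \<open>exp (- S_n F)\<close>. The normalised weights define a mass distribution on the leaves that is
  \<open>t\<close>-Hoelder down to the scale of the leaves, and a leaf carries arbitrarily little mass compared with
  \<open>|J|^t\<close>. Hence, if the intervals of a cover that meet \<open>u\<close> have a small \<open>t\<close>-sum relative to \<open>|u|^t\<close>, then the
  same holds for some leaf interval \<open>J\<close>. Nesting such intervals produces a point of the limsup set
  which is not covered, so \<open>H^t\<close> of the limsup set inside an interval \<open>I\<close> is at least \<open>c(t) |I|^t\<close>.
  Removing a largest interval of a cover and treating the two remaining pieces of \<open>I\<close> separately
  improves the constant to \<open>1\<close> at every smaller exponent, which makes it uniform in \<open>t\<close>.

  For the equation defining \<open>s\<close>: the infimum of \<open>S_n F\<close> over cylinders is superadditive under concatenation, so the
  pressure is a limit by subadditivity; it is strictly decreasing because \<open>F\<close> is bounded below by a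
  positive number, and for the Gauss map it is infinite exactly for exponents \<open>\<le> 1/2\<close>.
\<close>

section \<open>Covers by intervals and Hausdorff content\<close>

text \<open>Two obstacles shape the constants. One is that a target interval inside a cylinder of
  order n is shorter than it by a factor like exp (- S_n f), with n unbounded, so no fixed constant
  survives the descent. The order of quantifiers resolves this: the threshold \<kappa>' for full
  cylinders depends on the finitely many chosen branches, whereas the threshold \<kappa> for target
  intervals may be prescribed afterwards, because each further level of the tree halves the bound
  for mass against |J|^t and in the end outweighs the cost of any given cylinder. The two thresholds
  can therefore alternate along a nested sequence. The other is that f is merely continuous, so its
  Birkhoff sums may vary on a cylinder of order n by an amount growing with n. Uniform continuity
  bounds it by \<epsilon> n + C; the exponential growth granted by positive pressure absorbs this,
  and in the pressure itself \<epsilon> tends to 0. The threshold 6 D for the weights leaves D for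
  distortion, 3 for the cylinders of one generation that a short interval can meet, and 2 for the
  decay per level.\<close>

definition touching_sum :: "(nat \<Rightarrow> real) \<Rightarrow> (nat \<Rightarrow> real) \<Rightarrow> real \<Rightarrow> real \<Rightarrow> real \<Rightarrow> ennreal" where
  "touching_sum l u t a b =
     (\<Sum>i. if l i < b \<and> a < u i then ennreal ((u i - l i) powr t) else 0)"

lemma touching_sum_ge:
  assumes "l i < b" "a < u i"
  shows "ennreal ((u i - l i) powr t) \<le> touching_sum l u t a b"
proof -
  have "ennreal ((u i - l i) powr t) = (\<Sum>j\<in>{i}. if l j < b \<and> a < u j then ennreal ((u j - l j) powr t) else 0)"
    using assms by simp
  also have "\<dots> \<le> touching_sum l u t a b"
    unfolding touching_sum_def by (intro sum_le_suminf) auto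
  finally show ?thesis .
qed

text \<open>The bound is local: a cover of \<open>A \<inter> {a..b}\<close> is charged only for the
  intervals that overlap the interior of \<open>{a..b}\<close>. The strict inequalities in
  \<open>touching_sum\<close> matter: a covering interval that is cut out is not charged to the
  pieces on either side of it.\<close>

definition content_bound :: "real \<Rightarrow> real \<Rightarrow> real set \<Rightarrow> bool" where
  "content_bound t \<kappa> A \<longleftrightarrow>
     (\<forall>a b l u. 0 \<le> a \<longrightarrow> a < b \<longrightarrow> b \<le> 1 \<longrightarrow> (\<forall>i. l i < u i) \<longrightarrow>
        A \<inter> {a..b} \<subseteq> (\<Union>i. {l i<..<u i}) \<longrightarrow>
        ennreal (\<kappa> * (b - a) powr t) \<le> touching_sum l u t a b)"

text \<open>Each summand z has a share z / (x + y) \<le> 1 of the total, and a number in [0,1] is at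
  most its power with exponent t \<le> 1.\<close>

lemma powr_subadditive:
  fixes x y t :: real
  assumes "0 \<le> x" "0 \<le> y" "0 < t" "t \<le> 1"
  shows "(x + y) powr t \<le> x powr t + y powr t"
proof (cases "x + y = 0")
  case True
  then show ?thesis using assms by simp
next
  case False
  then have s: "x + y > 0" using assms by linarith
  have *: "z powr t \<ge> z / (x + y) * (x + y) powr t" if "0 \<le> z" "z \<le> x + y" for z
  proof (cases "z = 0")
    case False
    then have z: "z > 0" using that by simp
    have "z / (x + y) = (z / (x + y)) powr 1" using z s by simp
    also have "\<dots> \<le> (z / (x + y)) powr t"
      by (rule powr_mono') (use that s assms in auto)
    also have "\<dots> = z powr t / (x + y) powr t" using z s by (simp add: powr_divide)
    finally show ?thesis using s by (simp add: field_simps)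
  qed simp
  have "(x + y) powr t = x / (x + y) * (x + y) powr t + y / (x + y) * (x + y) powr t"
    using s by (simp add: add_divide_distrib[symmetric] distrib_right[symmetric])
  also have "\<dots> \<le> x powr t + y powr t"
    using *[of x] *[of y] assms by simp
  finally show ?thesis .
qed

text \<open>Guarantees a longest interval in a cover of finite t-sum, once some interval exceeds a
  given length.\<close>

lemma finite_ennreal_suminf_ge:
  fixes g :: "nat \<Rightarrow> real"
  assumes fin: "(\<Sum>i. ennreal (g i)) < \<infinity>" and nn: "\<And>i. g i \<ge> 0" and "c > 0"
  shows "finite {i. c \<le> g i}"
proof -
  have "summable g"
    using fin nn by (intro summable_suminf_not_top) auto
  then have "g \<longlonglongrightarrow> 0" by (rule summable_LIMSEQ_zero)
  then have "eventually (\<lambda>i. g i < c) sequentially"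
    using \<open>c > 0\<close> by (rule order_tendstoD)
  then have "finite {i. \<not> g i < c}"
    by (simp add: eventually_cofinite[symmetric] cofinite_eq_sequentially)
  then show ?thesis by (simp add: not_less)
qed

text \<open>If no touching interval is longer than \<rho> (b - a), passing from exponent t to t'
  gains enough to replace \<kappa> by 1. Otherwise a longest one, of t'-weight y, is cut out; the
  constant c on the remaining pieces and subadditivity of the power give at least c (b - a)^t' + (1
  - c) y, and y is at least \<rho>^t' (b - a)^t'.\<close>

lemma content_bound_improve:
  assumes t: "0 < t'" "t' < t" "t \<le> 1" and weak: "content_bound t \<kappa> A"
    and \<rho>: "0 < \<rho>" "\<rho> < 1" "\<rho> powr (t - t') \<le> \<kappa>"
    and prev: "content_bound t' c A" and c: "0 \<le> c" "c \<le> 1"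
  shows "content_bound t' (c + (1 - c) * \<rho> powr t') A"
  unfolding content_bound_def
proof (intro allI impI)
  fix a b :: real and l u :: "nat \<Rightarrow> real"
  assume ab: "0 \<le> a" "a < b" "b \<le> 1" and lu: "\<forall>i. l i < u i"
    and cov: "A \<inter> {a..b} \<subseteq> (\<Union>i. {l i<..<u i})"
  let ?c' = "c + (1 - c) * \<rho> powr t'"
  let ?S = "touching_sum l u"
  have \<rho>1: "\<rho> powr t' \<le> 1" using \<rho> t by (simp add: powr_le1)
  then have "(1 - c) * \<rho> powr t' \<le> (1 - c) * 1" using c by (intro mult_left_mono) auto
  then have c'1: "?c' \<le> 1" by simp
  show "ennreal (?c' * (b - a) powr t') \<le> ?S t' a b"
  proof (cases "?S t' a b < \<infinity>")
    case False
    then have "?S t' a b = \<infinity>"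
      by (metis infinity_ennreal_def top.not_eq_extremum)
    then show ?thesis by simp
  next
    case fin: True
    define g where "g i = (if l i < b \<and> a < u i then (u i - l i) powr t' else 0)" for i
    have Sg: "?S t' a b = (\<Sum>i. ennreal (g i))"
      unfolding touching_sum_def g_def by (intro suminf_cong) auto
    define Big where "Big = {i. l i < b \<and> a < u i \<and> \<rho> * (b - a) < u i - l i}"
    show ?thesis
    proof (cases "Big = {}")
      case True
      define q where "q = (\<rho> * (b - a)) powr (t - t')"
      have q: "q > 0" using \<rho> ab by (simp add: q_def)
      have "ennreal (\<kappa> * (b - a) powr t) \<le> ?S t a b"
        using weak ab lu cov unfolding content_bound_def by blast
      also have "\<dots> \<le> (\<Sum>i. ennreal q * ennreal (g i))"
        unfolding touching_sum_def
      proof (rule suminf_le)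
        fix i
        show "(if l i < b \<and> a < u i then ennreal ((u i - l i) powr t) else 0)
              \<le> ennreal q * ennreal (g i)"
        proof (cases "l i < b \<and> a < u i")
          case touch: True
          then have "u i - l i \<le> \<rho> * (b - a)" using True by (auto simp: Big_def)
          then have "(u i - l i) powr (t - t') \<le> q"
            unfolding q_def using lu[rule_format, of i] t by (intro powr_mono2) auto
          then have "(u i - l i) powr (t - t') * (u i - l i) powr t' \<le> q * (u i - l i) powr t'"
            by (rule mult_right_mono) simp
          then have "(u i - l i) powr t \<le> q * (u i - l i) powr t'"
            by (simp add: powr_add[symmetric])
          then show ?thesis using touch q
            by (simp add: g_def ennreal_mult[symmetric] ennreal_leI)
        qed auto
      qed auto
      also have "\<dots> = ennreal q * ?S t' a b" unfolding Sg by (rule ennreal_suminf_cmult)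
      finally have *: "ennreal (\<kappa> * (b - a) powr t) \<le> ennreal q * ?S t' a b" .
      obtain s where s: "?S t' a b = ennreal s" "s \<ge> 0"
        using fin by (metis ennreal_cases infinity_ennreal_def less_irrefl)
      have "\<kappa> * (b - a) powr t \<le> q * s"
        using * s q by (simp add: ennreal_mult[symmetric] ennreal_le_iff)
      moreover have "q * (b - a) powr t' \<le> \<kappa> * (b - a) powr t"
      proof -
        have "q * (b - a) powr t' = \<rho> powr (t - t') * ((b - a) powr (t - t') * (b - a) powr t')"
          using \<rho> ab by (simp add: q_def powr_mult)
        also have "\<dots> = \<rho> powr (t - t') * (b - a) powr t"
          by (simp add: powr_add[symmetric])
        also have "\<dots> \<le> \<kappa> * (b - a) powr t" using \<rho> by (intro mult_right_mono) auto
        finally show ?thesis .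
      qed
      ultimately have "q * (b - a) powr t' \<le> q * s" by linarith
      then have "(b - a) powr t' \<le> s" using q by simp
      moreover have "?c' * (b - a) powr t' \<le> 1 * (b - a) powr t'"
        using c'1 by (rule mult_right_mono) simp
      ultimately have "?c' * (b - a) powr t' \<le> s" by linarith
      then show ?thesis unfolding s by (rule ennreal_leI)
    next
      case False
      have "finite {i. (\<rho> * (b - a)) powr t' \<le> g i}"
        using \<rho> ab fin unfolding Sg by (intro finite_ennreal_suminf_ge) (auto simp: g_def)
      moreover have "Big \<subseteq> {i. (\<rho> * (b - a)) powr t' \<le> g i}"
        using \<rho> ab t by (auto simp: Big_def g_def intro!: powr_mono2)
      ultimately have finB: "finite Big" by (rule finite_subset[rotated])
      define M where "M = Max ((\<lambda>i. u i - l i) ` Big)"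
      have "M \<in> (\<lambda>i. u i - l i) ` Big" unfolding M_def using finB False by (intro Max_in) auto
      then obtain k where k: "k \<in> Big" "u k - l k = M" by auto
      have kmax: "u j - l j \<le> u k - l k" if "l j < b" "a < u j" for j
      proof (cases "j \<in> Big")
        case True
        then show ?thesis unfolding k(2) M_def using finB by (intro Max_ge) auto
      next
        case False
        then show ?thesis using that k(1) by (auto simp: Big_def)
      qed
      have kt: "l k < b" "a < u k" "\<rho> * (b - a) < u k - l k" using k by (auto simp: Big_def)
      define S1 where "S1 = (if a < l k then ?S t' a (l k) else 0)"
      define S2 where "S2 = (if u k < b then ?S t' (u k) b else 0)"
      define x1 where "x1 = max 0 (l k - a)"
      define x2 where "x2 = max 0 (b - u k)"
      have "ennreal (c * (x1 powr t')) \<le> S1"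
      proof (cases "a < l k")
        case True
        have "A \<inter> {a..l k} \<subseteq> (\<Union>i. {l i<..<u i})" using cov kt by fastforce
        then have "ennreal (c * (l k - a) powr t') \<le> ?S t' a (l k)"
          using prev ab kt True lu unfolding content_bound_def by (meson less_imp_le less_le_trans)
        then show ?thesis using True by (simp add: S1_def x1_def)
      qed (simp add: x1_def S1_def)
      moreover have "ennreal (c * (x2 powr t')) \<le> S2"
      proof (cases "u k < b")
        case True
        have "A \<inter> {u k..b} \<subseteq> (\<Union>i. {l i<..<u i})" using cov kt by fastforce
        then have "ennreal (c * (b - u k) powr t') \<le> ?S t' (u k) b"
          using prev ab kt True lu unfolding content_bound_def by (meson less_imp_le le_less_trans)
        then show ?thesis using True by (simp add: S2_def x2_def)
      qed (simp add: x2_def S2_def)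
      ultimately have "ennreal ((u k - l k) powr t') + (ennreal (c * (x1 powr t')) + ennreal (c * (x2 powr t')))
          \<le> ennreal ((u k - l k) powr t') + (S1 + S2)"
        by (intro add_left_mono add_mono)
      also have "\<dots> \<le> ?S t' a b"
      proof -
        define g1 where "g1 i = (if a < l k \<and> l i < l k \<and> a < u i then ennreal ((u i - l i) powr t') else 0)" for i
        define g2 where "g2 i = (if u k < b \<and> l i < b \<and> u k < u i then ennreal ((u i - l i) powr t') else 0)" for i
        define g0 where "g0 i = (if i = k then ennreal ((u k - l k) powr t') else 0)" for i
        have "S1 = (\<Sum>i. g1 i)" by (auto simp: S1_def g1_def touching_sum_def intro!: suminf_cong)
        moreover have "S2 = (\<Sum>i. g2 i)" by (auto simp: S2_def g2_def touching_sum_def intro!: suminf_cong)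
        moreover have "ennreal ((u k - l k) powr t') = (\<Sum>i. g0 i)"
        proof -
          have "(\<Sum>i. g0 i) = sum g0 {k}" by (rule suminf_finite) (auto simp: g0_def)
          then show ?thesis by (simp add: g0_def)
        qed
        ultimately have "ennreal ((u k - l k) powr t') + (S1 + S2) = (\<Sum>i. g0 i + (g1 i + g2 i))"
          by (simp add: suminf_add)
        also have "\<dots> \<le> ?S t' a b" unfolding Sg
        proof (rule suminf_le)
          fix i
          consider "i = k" | "i \<noteq> k" "\<not> (a < l k \<and> l i < l k \<and> a < u i)"
            | "i \<noteq> k" "a < l k \<and> l i < l k \<and> a < u i" "\<not> (u k < b \<and> l i < b \<and> u k < u i)"
            | "(a < l k \<and> l i < l k \<and> a < u i)" "(u k < b \<and> l i < b \<and> u k < u i)" by blast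
          then show "g0 i + (g1 i + g2 i) \<le> ennreal (g i)"
          proof cases
            \<comment> \<open>An interval charged to both remaining pieces would strictly contain
              the longest one.\<close>
            case 4
            then show ?thesis using kmax[of i] by simp
          qed (use kt in \<open>auto simp: g0_def g1_def g2_def g_def\<close>)
        qed auto
        finally show ?thesis .
      qed
      finally have "ennreal ((u k - l k) powr t' + (c * x1 powr t' + c * x2 powr t')) \<le> ?S t' a b"
        using c by (simp add: ennreal_plus[symmetric] del: ennreal_plus)
      moreover have "?c' * (b - a) powr t' \<le> (u k - l k) powr t' + (c * x1 powr t' + c * x2 powr t')"
      proof -
        define y where "y = (u k - l k) powr t'"
        have "(b - a) powr t' \<le> ((u k - l k) + (x1 + x2)) powr t'"
          using ab t by (intro powr_mono2) (auto simp: x1_def x2_def)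
        also have "\<dots> \<le> y + (x1 + x2) powr t'" unfolding y_def
          using t lu[rule_format, of k] by (intro powr_subadditive) (auto simp: x1_def x2_def)
        also have "\<dots> \<le> y + (x1 powr t' + x2 powr t')"
          using t by (intro add_left_mono powr_subadditive) (auto simp: x1_def x2_def)
        finally have 1: "c * (b - a) powr t' \<le> c * (y + (x1 powr t' + x2 powr t'))"
          using c by (intro mult_left_mono) auto
        have "\<rho> powr t' * (b - a) powr t' = (\<rho> * (b - a)) powr t'"
          using \<rho> ab by (simp add: powr_mult)
        also have "\<dots> \<le> y" unfolding y_def using kt \<rho> ab t by (intro powr_mono2) auto
        finally have "(1 - c) * (\<rho> powr t' * (b - a) powr t') \<le> (1 - c) * y"
          using c by (intro mult_left_mono) auto
        with 1 show ?thesis unfolding y_def[symmetric] by (simp add: algebra_simps)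
      qed
      ultimately show ?thesis by (meson ennreal_leI order_trans)
    qed
  qed
qed

text \<open>Each improvement multiplies the deficit 1 - c by the same q < 1, so iterating from c = 0
  reaches 1 in the limit, however small the initial \<kappa>.\<close>

lemma content_bound_one:
  assumes t: "0 < t'" "t' < t" "t \<le> 1" and weak: "content_bound t \<kappa> A" and "\<kappa> > 0"
  shows "content_bound t' 1 A"
proof -
  \<comment> \<open>The minimum with 1/2 keeps \<rho> < 1 when \<kappa> is large.\<close>
  define \<rho> where "\<rho> = (min \<kappa> (1/2)) powr (1 / (t - t'))"
  have \<rho>0: "0 < \<rho>" using \<open>\<kappa> > 0\<close> by (simp add: \<rho>_def)
  have \<rho>1: "\<rho> < 1"
  proof -
    have "\<rho> < 1 powr (1 / (t - t'))" unfolding \<rho>_def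
      using t \<open>\<kappa> > 0\<close> by (intro powr_less_mono2) auto
    then show ?thesis by simp
  qed
  have "\<rho> powr (t - t') = min \<kappa> (1/2)"
    unfolding \<rho>_def using t \<open>\<kappa> > 0\<close> by (simp add: powr_powr)
  then have \<rho>2: "\<rho> powr (t - t') \<le> \<kappa>" by simp
  define q where "q = 1 - \<rho> powr t'"
  have q: "0 \<le> q" "q < 1" using \<rho>0 \<rho>1 t by (auto simp: q_def powr_le1)
  have step: "content_bound t' (1 - q ^ n) A" for n
  proof (induction n)
    case 0
    then show ?case by (simp add: content_bound_def)
  next
    case (Suc n)
    have "content_bound t' ((1 - q ^ n) + (1 - (1 - q ^ n)) * \<rho> powr t') A"
      using q by (intro content_bound_improve[OF t weak \<rho>0 \<rho>1 \<rho>2 Suc]) (auto simp: power_le_one)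
    then show ?case by (simp add: q_def algebra_simps)
  qed
  show ?thesis unfolding content_bound_def
  proof (intro allI impI)
    fix a b :: real and l u :: "nat \<Rightarrow> real"
    assume *: "0 \<le> a" "a < b" "b \<le> 1" "\<forall>i. l i < u i"
      "A \<inter> {a..b} \<subseteq> (\<Union>i. {l i<..<u i})"
    have "ennreal ((1 - q ^ n) * (b - a) powr t') \<le> touching_sum l u t' a b" for n
      using step[of n] * unfolding content_bound_def by blast
    moreover have "(\<lambda>n. ennreal ((1 - q ^ n) * (b - a) powr t')) \<longlonglongrightarrow> ennreal ((1 - 0) * (b - a) powr t')"
      using q by (intro tendsto_ennrealI tendsto_intros LIMSEQ_realpow_zero) auto
    ultimately show "ennreal (1 * (b - a) powr t') \<le> touching_sum l u t' a b"
      by (intro LIMSEQ_le_const2[where X="\<lambda>n. ennreal ((1 - q ^ n) * (b - a) powr t')"]) auto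
  qed
qed

text \<open>Members of a cover in \<open>hausdorff_content\<close> may be closed or empty. Adding a
  length d with d^t = e makes them nonempty open intervals, at an additive cost of at most e by
  subadditivity of the power.\<close>

lemma ball_enlarge:
  assumes B: "B = {} \<or> is_ball B" and t: "0 < t" "t \<le> 1" and e: "0 < e"
  shows "\<exists>l u. l < u \<and> B \<subseteq> {l<..<u} \<and> (u - l) powr t \<le> diameter B powr t + e"
proof -
  define d where "d = e powr (1 / t)"
  have d: "d > 0" "d powr t = e" using e t by (auto simp: d_def powr_powr)
  have *: "(x + d) powr t \<le> x powr t + e" if "x \<ge> 0" for x
    using powr_subadditive[of x d t] that d t by simp
  show ?thesis
  proof (cases "B = {}")
    case True
    then show ?thesis using d by (intro exI[of _ 0] exI[of _ d]) simp
  next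
    case False
    with B obtain c r where r: "r > 0" "B = ball c r \<or> B = cball c r" by (auto simp: is_ball_def)
    then have "diameter B = 2 * r" by auto
    moreover have "B \<subseteq> {c - r - d/2<..<c + r + d/2}"
      using r d by (auto simp: dist_real_def)
    ultimately show ?thesis using *[of "2 * r"] r d
      by (intro exI[of _ "c - r - d/2"] exI[of _ "c + r + d/2"]) (auto simp: algebra_simps)
  qed
qed

text \<open>The constant 1/2 serves all exponents at once: B has content at most its diameter to the
  power t, and an inner interval of 3/4 the length keeps at least 3/4 of that weight because t \<le>
  1.\<close>

lemma large_intersection_classI:
  assumes A: "A \<subseteq> {0..1}" "gdelta A" and "s \<le> 1"
    and cb: "\<And>t. 0 < t \<Longrightarrow> t < s \<Longrightarrow> content_bound t 1 A"
  shows "A \<in> large_intersection_class s"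
proof -
  have "hausdorff_content t (A \<inter> B) > ennreal (1/2) * hausdorff_content t B"
    if t: "0 < t" "t < s" and B: "is_ball B" "B \<subseteq> {0..1}" for t B
  proof -
    have t1: "t \<le> 1" using t \<open>s \<le> 1\<close> by simp
    obtain c r where r: "r > 0" "B = ball c r \<or> B = cball c r" using B by (auto simp: is_ball_def)
    have dB: "diameter B = 2 * r" using r by auto
    have bB: "ball c r \<subseteq> {0..1}" using B r ball_subset_cball[of c r] by auto
    \<comment> \<open>A closed interval inside the ball even when the ball is open; any ratio
      strictly between 1/2 and 1 gives the strict inequality.\<close>
    define \<rho> where "\<rho> = 3/4 * r"
    have sub: "{c - \<rho>..c + \<rho>} \<subseteq> ball c r" using r by (auto simp: \<rho>_def dist_real_def)
    have "{c - \<rho>..c + \<rho>} \<subseteq> {0..1}" using sub bB by (rule subset_trans)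
    then have ends: "0 \<le> c - \<rho>" "c - \<rho> < c + \<rho>" "c + \<rho> \<le> 1" using r
      by (simp_all add: \<rho>_def)
    have low: "ennreal ((2 * \<rho>) powr t) \<le> (\<Sum>i. ennreal (diameter (C i) powr t))"
      if C: "\<And>i. C i = {} \<or> is_ball (C i)" "A \<inter> B \<subseteq> (\<Union>i. C i)" for C :: "nat \<Rightarrow> real set"
    proof (rule ennreal_le_epsilon)
      fix e :: real assume e: "e > 0"
      have "\<exists>l u. l < u \<and> C i \<subseteq> {l<..<u} \<and> (u - l) powr t \<le> diameter (C i) powr t + e * (1/2)^(Suc i)" for i
        using e t t1 C by (intro ball_enlarge) auto
      then obtain l u where lu: "\<And>i. l i < u i" "\<And>i. C i \<subseteq> {l i<..<u i}"
        "\<And>i. (u i - l i) powr t \<le> diameter (C i) powr t + e * (1/2)^(Suc i)" by metis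
      have "A \<inter> {c - \<rho>..c + \<rho>} \<subseteq> A \<inter> B" using sub r ball_subset_cball[of c r] by auto
      also have "\<dots> \<subseteq> (\<Union>i. {l i<..<u i})" by (rule order_trans[OF C(2) UN_mono]) (use lu(2) in auto)
      finally have "ennreal (1 * (c + \<rho> - (c - \<rho>)) powr t) \<le> touching_sum l u t (c - \<rho>) (c + \<rho>)"
        using cb[OF t] ends lu(1) unfolding content_bound_def by blast
      also have "\<dots> \<le> (\<Sum>i. ennreal (diameter (C i) powr t) + ennreal (e * (1/2)^(Suc i)))"
        unfolding touching_sum_def using lu(3) e
        by (intro suminf_le) (auto simp: ennreal_plus[symmetric] simp del: ennreal_plus intro!: ennreal_leI)
      also have "\<dots> = (\<Sum>i. ennreal (diameter (C i) powr t)) + (\<Sum>i. ennreal (e * (1/2)^(Suc i)))"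
        by (rule suminf_add[symmetric]) auto
      also have "(\<Sum>i. ennreal (e * (1/2)^(Suc i))) = ennreal e"
      proof -
        have "(\<lambda>i. e * (1/2)^(Suc i)) sums (e * 1)" by (intro sums_mult power_half_series)
        then show ?thesis using e by (subst suminf_ennreal_eq[where x=e]) auto
      qed
      finally show "ennreal ((2 * \<rho>) powr t) \<le> (\<Sum>i. ennreal (diameter (C i) powr t)) + ennreal e"
        by simp
    qed
    have "ennreal (1/2) * hausdorff_content t B \<le> ennreal (1/2) * ennreal ((2 * r) powr t)"
    proof (rule mult_left_mono)
      let ?C = "\<lambda>i::nat. if i = 0 then B else {}"
      have "hausdorff_content t B \<le> (\<Sum>i. ennreal (diameter (?C i) powr t))"
        unfolding hausdorff_content_def using B by (intro INF_lower) (auto split: if_splits)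
      also have "\<dots> = (\<Sum>i\<in>{0}. ennreal (diameter (?C i) powr t))"
        by (rule suminf_finite) (auto simp: diameter_empty)
      finally show "hausdorff_content t B \<le> ennreal ((2 * r) powr t)" by (simp add: dB)
    qed simp
    also have "\<dots> < ennreal ((2 * \<rho>) powr t)"
    proof -
      have "3/4 = (3/4::real) powr 1" by simp
      also have "\<dots> \<le> (3/4) powr t" using t1 by (intro powr_mono') auto
      finally have "3/4 * (2 * r) powr t \<le> (3/4) powr t * (2 * r) powr t"
        by (rule mult_right_mono) simp
      also have "\<dots> = (3/4 * (2 * r)) powr t" by (rule powr_mult[symmetric])
      also have "3/4 * (2 * r) = 2 * \<rho>" by (simp add: \<rho>_def)
      finally have "3/4 * (2 * r) powr t \<le> (2 * \<rho>) powr t" .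
      moreover have "(2 * r) powr t > 0" using r by simp
      ultimately have "1/2 * (2 * r) powr t < (2 * \<rho>) powr t" by linarith
      then have "ennreal (1/2 * (2 * r) powr t) < ennreal ((2 * \<rho>) powr t)"
        by (intro ennreal_lessI) (use \<open>(2 * r) powr t > 0\<close> in linarith)+
      then show ?thesis by (subst ennreal_mult[symmetric]) auto
    qed
    also have "\<dots> \<le> hausdorff_content t (A \<inter> B)"
      unfolding hausdorff_content_def using low by (intro INF_greatest) auto
    finally show ?thesis .
  qed
  then show ?thesis using A unfolding large_intersection_class_def
    by (auto intro!: exI[of _ "1/2::real"])
qed

section \<open>Mass distributions on disjoint intervals\<close>

lemma sum_disjoint_intervals:
  fixes lo hi :: "'i \<Rightarrow> real"
  assumes "finite I" "\<And>i. i \<in> I \<Longrightarrow> lo i \<le> hi i"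
    and "disjoint_family_on (\<lambda>i. {lo i<..<hi i}) I"
    and "\<And>i. i \<in> I \<Longrightarrow> a \<le> lo i \<and> hi i \<le> b" and "a \<le> b"
  shows "(\<Sum>i\<in>I. hi i - lo i) \<le> b - a"
proof -
  have "(\<Sum>i\<in>I. hi i - lo i) = (\<Sum>i\<in>I. measure lborel {lo i<..<hi i})"
    using assms(2) by (intro sum.cong) auto
  also have "\<dots> = measure lborel (\<Union>i\<in>I. {lo i<..<hi i})"
    using assms by (intro measure_finite_Union[symmetric]) auto
  also have "\<dots> \<le> measure lborel {a<..<b}"
    using assms by (intro measure_mono_fmeasurable) (auto simp: fmeasurable_def dest: assms(4) intro: le_less_trans less_le_trans)
  also have "\<dots> = b - a" using assms by simp
  finally show ?thesis .
qed

text \<open>Clipping each interval to the window extended by y - x on both sides keeps at least the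
  counted minimum, and the extended window has length 3 (y - x). In particular at most three
  disjoint intervals longer than the window meet it, the source of the factor 3 in the covering
  estimates.\<close>

lemma sum_touching_min:
  fixes lo hi :: "'i \<Rightarrow> real"
  assumes "finite I" and lh: "\<And>i. i \<in> I \<Longrightarrow> lo i < hi i"
    and dis: "disjoint_family_on (\<lambda>i. {lo i<..<hi i}) I" and xy: "x < y"
  shows "(\<Sum>i\<in>{i \<in> I. x < hi i \<and> lo i < y}. min (hi i - lo i) (y - x)) \<le> 3 * (y - x)"
proof -
  let ?I = "{i \<in> I. x < hi i \<and> lo i < y}"
  define lo' where "lo' i = max (lo i) (x - (y - x))" for i
  define hi' where "hi' i = min (hi i) (y + (y - x))" for i
  have "min (hi i - lo i) (y - x) \<le> hi' i - lo' i" if "i \<in> ?I" for i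
    using that lh[of i] xy by (auto simp: lo'_def hi'_def)
  then have "(\<Sum>i\<in>?I. min (hi i - lo i) (y - x)) \<le> (\<Sum>i\<in>?I. hi' i - lo' i)"
    by (rule sum_mono)
  also have "\<dots> \<le> (y + (y - x)) - (x - (y - x))"
  proof (rule sum_disjoint_intervals)
    show "disjoint_family_on (\<lambda>i. {lo' i<..<hi' i}) ?I"
      using dis by (fastforce simp: disjoint_family_on_def lo'_def hi'_def)
    show "lo' i \<le> hi' i" if "i \<in> ?I" for i
      using that lh[of i] xy by (auto simp: lo'_def hi'_def)
  qed (use assms in \<open>auto simp: lo'_def hi'_def\<close>)
  finally show ?thesis by simp
qed

text \<open>Pairs of a covering interval and a member v are sorted by which of the two is longer. If
  some covering interval at least as long as v touches it, the mass of v is charged there, which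
  \<open>ball\<close> limits. Otherwise \<open>small\<close> and \<open>big\<close> charge it to the
  shorter intervals touching v, and each of those is charged by at most three members. Used in
  contrapositive form: a family of total mass too large for the cover has a member on which the
  touching sum is small.\<close>

lemma sum_le_touching_sum:
  fixes lo hi p :: "'i \<Rightarrow> real" and l u :: "nat \<Rightarrow> real"
  assumes fin: "finite V" and lh: "\<And>v. v \<in> V \<Longrightarrow> lo v < hi v"
    and dis: "disjoint_family_on (\<lambda>v. {lo v<..<hi v}) V"
    and sub: "\<And>v. v \<in> V \<Longrightarrow> a \<le> lo v \<and> hi v \<le> b"
    and lu: "\<And>i. l i < u i" and p0: "\<And>v. v \<in> V \<Longrightarrow> 0 \<le> p v"
    and k: "0 < k" and e: "0 \<le> e" and C: "0 \<le> C"
    and big: "\<And>v. v \<in> V \<Longrightarrow> ennreal (k * (hi v - lo v) powr t) \<le> touching_sum l u t (lo v) (hi v)"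
    and small: "\<And>v. v \<in> V \<Longrightarrow> p v \<le> e * (hi v - lo v) powr t"
    and ball: "\<And>i. l i < b \<Longrightarrow> a < u i \<Longrightarrow>
      (\<Sum>v\<in>{v \<in> V. l i < hi v \<and> lo v < u i \<and> hi v - lo v \<le> u i - l i}. p v)
        \<le> C * (u i - l i) powr t"
  shows "ennreal (\<Sum>v\<in>V. p v) \<le> ennreal (C + 3 * e / k) * touching_sum l u t a b"
proof -
  define g where "g i = (u i - l i) powr t" for i
  define T1 where "T1 i v \<longleftrightarrow> l i < hi v \<and> lo v < u i \<and> hi v - lo v \<le> u i - l i" for i v
  define T2 where "T2 i v \<longleftrightarrow> l i < hi v \<and> lo v < u i \<and> u i - l i < hi v - lo v" for i v
  define F1 where "F1 i v = (if T1 i v then ennreal (p v) else 0)" for i v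
  define F2 where "F2 i v = (if T2 i v then ennreal (e / k * g i) else 0)" for i v
  have g0: "g i \<ge> 0" for i by (simp add: g_def)
  have "ennreal (p v) \<le> (\<Sum>i. F1 i v) + (\<Sum>i. F2 i v)" if v: "v \<in> V" for v
  proof (cases "\<exists>i. T1 i v")
    case True
    then obtain i where "T1 i v" by blast
    then have "ennreal (p v) = sum (\<lambda>i. F1 i v) {i}" by (simp add: F1_def)
    also have "\<dots> \<le> (\<Sum>i. F1 i v)" by (intro sum_le_suminf) auto
    finally show ?thesis by (simp add: add_increasing2)
  next
    case False
    \<comment> \<open>Only covering intervals shorter than v touch it here, so the lower bound
      \<open>big\<close> consists of \<open>T2\<close> pairs alone.\<close>
    have "ennreal (p v) \<le> ennreal (e / k * (k * (hi v - lo v) powr t))"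
      using small[OF v] k by (intro ennreal_leI) simp
    also have "\<dots> = ennreal (e / k) * ennreal (k * (hi v - lo v) powr t)"
      using e k by (intro ennreal_mult) auto
    also have "\<dots> \<le> ennreal (e / k) * touching_sum l u t (lo v) (hi v)"
      by (intro mult_left_mono big v) auto
    also have "\<dots> = (\<Sum>i. F2 i v)"
      unfolding touching_sum_def ennreal_suminf_cmult[symmetric]
      using False e k g0 by (intro suminf_cong) (auto simp: F2_def T1_def T2_def g_def ennreal_mult[symmetric] not_le)
    finally show ?thesis by (simp add: add_increasing)
  qed
  then have "(\<Sum>v\<in>V. ennreal (p v)) \<le> (\<Sum>v\<in>V. (\<Sum>i. F1 i v) + (\<Sum>i. F2 i v))"
    by (rule sum_mono)
  also have "\<dots> = (\<Sum>i. \<Sum>v\<in>V. F1 i v + F2 i v)"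
    by (subst suminf_sum) (auto simp: suminf_add)
  also have "\<dots> \<le> (\<Sum>i. ennreal (C + 3 * e / k) * (if l i < b \<and> a < u i then ennreal (g i) else 0))"
  proof (rule suminf_le)
    fix i
    show "(\<Sum>v\<in>V. F1 i v + F2 i v) \<le> ennreal (C + 3 * e / k) * (if l i < b \<and> a < u i then ennreal (g i) else 0)"
    proof (cases "l i < b \<and> a < u i")
      case False
      have "F1 i v + F2 i v = 0" if "v \<in> V" for v
        using that sub[OF that] False by (auto simp: F1_def F2_def T1_def T2_def)
      then show ?thesis by (simp add: False)
    next
      case True
      have "(\<Sum>v\<in>V. F1 i v) = (\<Sum>v\<in>{v \<in> V. T1 i v}. ennreal (p v))"
        unfolding F1_def using fin by (simp add: sum.inter_filter)
      also have "\<dots> = ennreal (\<Sum>v\<in>{v \<in> V. T1 i v}. p v)"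
        using p0 by (intro sum_ennreal) auto
      also have "\<dots> \<le> ennreal (C * g i)"
        using ball True by (intro ennreal_leI) (auto simp: T1_def g_def)
      finally have 1: "(\<Sum>v\<in>V. F1 i v) \<le> ennreal (C * g i)" .
      let ?W = "{v \<in> V. T2 i v}"
      have "real (card ?W) * (u i - l i) = (\<Sum>v\<in>?W. min (hi v - lo v) (u i - l i))"
        by (simp add: T2_def)
      also have "\<dots> \<le> (\<Sum>v\<in>{v \<in> V. l i < hi v \<and> lo v < u i}. min (hi v - lo v) (u i - l i))"
        using fin lh lu[of i] by (intro sum_mono2) (auto simp: T2_def less_imp_le)
      also have "\<dots> \<le> 3 * (u i - l i)"
        by (rule sum_touching_min[OF fin lh dis lu])
      finally have card: "real (card ?W) \<le> 3"
        by (rule mult_right_le_imp_le) (use lu[of i] in simp)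
      have "(\<Sum>v\<in>V. F2 i v) = (\<Sum>v\<in>?W. ennreal (e / k * g i))"
        unfolding F2_def by (simp only: sum.inter_filter[OF fin])
      also have "\<dots> = ennreal (real (card ?W) * (e / k * g i))"
        using e k g0[of i] by (subst sum_ennreal) auto
      also have "\<dots> \<le> ennreal (3 * (e / k * g i))"
        using card e k g0[of i] by (intro ennreal_leI mult_right_mono) auto
      finally have "(\<Sum>v\<in>V. F1 i v + F2 i v) \<le> ennreal (C * g i) + ennreal (3 * (e / k * g i))"
        unfolding sum.distrib by (intro add_mono 1)
      also have "\<dots> = ennreal ((C + 3 * e / k) * g i)"
        using e k g0[of i] C by (subst ennreal_plus[symmetric]) (auto simp: algebra_simps)
      also have "\<dots> = ennreal (C + 3 * e / k) * ennreal (g i)"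
        using e k g0[of i] C by (intro ennreal_mult) auto
      finally show ?thesis using True by simp
    qed
  qed auto
  also have "\<dots> = ennreal (C + 3 * e / k) * touching_sum l u t a b"
    unfolding touching_sum_def g_def by (simp add: ennreal_suminf_cmult)
  finally show ?thesis using p0 by (simp add: sum_ennreal)
qed

section \<open>Full inverse branches\<close>

text \<open>Points with an iterate up to n equal to 0 are left out, which makes the set open for the
  two maps in question. The map is an arbitrary function so that one locale can treat both.\<close>

definition target_set ::
  "(real \<Rightarrow> real) \<Rightarrow> (real \<Rightarrow> real) \<Rightarrow> (nat \<Rightarrow> real \<Rightarrow> real) \<Rightarrow> nat \<Rightarrow> real set" where
  "target_set \<tau> f h n = {x \<in> {0<..<1}. (\<forall>k\<le>n. (\<tau> ^^ k) x \<noteq> 0) \<and>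
     \<bar>(\<tau> ^^ n) x - h n x\<bar> < exp (- (\<Sum>k<n. f ((\<tau> ^^ k) x)))}"

text \<open>An inverse branch is a function on the closed unit interval whose image is an interval;
  \<open>blo\<close> and \<open>bhi\<close> are its end points. Branches of the Gauss map can
  reverse orientation, hence the absolute value, \<open>min\<close> and \<open>max\<close>.\<close>

definition blen :: "(real \<Rightarrow> real) \<Rightarrow> real" where "blen \<psi> = \<bar>\<psi> 1 - \<psi> 0\<bar>"
definition blo :: "(real \<Rightarrow> real) \<Rightarrow> real" where "blo \<psi> = min (\<psi> 0) (\<psi> 1)"
definition bhi :: "(real \<Rightarrow> real) \<Rightarrow> real" where "bhi \<psi> = max (\<psi> 0) (\<psi> 1)"

lemma bhi_minus_blo: "bhi \<psi> - blo \<psi> = blen \<psi>"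
  by (auto simp: blen_def blo_def bhi_def)

lemma image_open_unit_interval:
  assumes cont: "continuous_on {0..1} \<psi>" and inj: "inj_on \<psi> {0..1}"
  shows "\<psi> ` {0<..<1} = {blo \<psi><..<bhi \<psi>}"
proof
  show "\<psi> ` {0<..<1} \<subseteq> {blo \<psi><..<bhi \<psi>}"
  proof
    fix z assume "z \<in> \<psi> ` {0<..<1}"
    then obtain x where x: "x \<in> {0<..<1}" "z = \<psi> x" by auto
    then show "z \<in> {blo \<psi><..<bhi \<psi>}"
      using continuous_inj_imp_mono[of 0 x 1 \<psi>, OF _ _ cont inj]
      by (auto simp: blo_def bhi_def)
  qed
  show "{blo \<psi><..<bhi \<psi>} \<subseteq> \<psi> ` {0<..<1}"
  proof
    fix z assume z: "z \<in> {blo \<psi><..<bhi \<psi>}"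
    have "\<exists>x\<ge>0. x \<le> 1 \<and> \<psi> x = z"
    proof (cases "\<psi> 0 \<le> \<psi> 1")
      case True
      then show ?thesis using z cont by (intro IVT') (auto simp: blo_def bhi_def)
    next
      case False
      then show ?thesis using z cont by (intro IVT2') (auto simp: blo_def bhi_def)
    qed
    then obtain x where x: "0 \<le> x" "x \<le> 1" "\<psi> x = z" by auto
    moreover have "x \<noteq> 0" "x \<noteq> 1" using x z by (auto simp: blo_def bhi_def)
    ultimately show "z \<in> \<psi> ` {0<..<1}" by (intro image_eqI[of _ _ x]) auto
  qed
qed

lemma interval_mono:
  fixes a b c d :: real
  assumes "{a<..<b} \<subseteq> {c<..<d}" "a < b"
  shows "c \<le> a" "b \<le> d"
  using assms by (auto simp: greaterThanLessThan_subseteq_greaterThanLessThan)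

text \<open>The common interface of the two maps. \<open>Br n\<close> consists of inverse branches
  of the n-th iterate that are defined on the whole unit interval; D bounds their distortion, and
  \<alpha> is the proportion of any interval that disjoint, arbitrarily short branches can fill.
  Orders may be mixed in \<open>br_cover\<close> because for the beta map a branch is fitted into a
  cylinder by appending a number of zeros that depends on the cylinder. Orbits are prescribed on the
  open interval since the end points of a branch may be discontinuities.\<close>

locale full_branches =
  fixes \<tau> f :: "real \<Rightarrow> real" and h :: "nat \<Rightarrow> real \<Rightarrow> real" and L D \<alpha> M :: real
    and Br :: "nat \<Rightarrow> (real \<Rightarrow> real) set"
  assumes D: "1 \<le> D" and \<alpha>: "0 < \<alpha>"
    and f_pos: "x \<in> {0<..<1} \<Longrightarrow> 0 < f x" and f_le: "x \<in> {0<..<1} \<Longrightarrow> f x \<le> M"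
    and h_lip: "L-lipschitz_on {0..1} (h n)" and h_range: "h n ` {0..1} \<subseteq> {0..1}"
    and \<tau>_zero: "\<tau> 0 = 0" and \<tau>_range: "x \<in> {0..<1} \<Longrightarrow> \<tau> x \<in> {0..<1}"
    and br_nontriv: "\<psi> \<in> Br n \<Longrightarrow> \<psi> 0 \<noteq> \<psi> 1"
    and br_lower: "\<psi> \<in> Br n \<Longrightarrow> x \<in> {0..1} \<Longrightarrow> y \<in> {0..1} \<Longrightarrow>
        blen \<psi> * \<bar>x - y\<bar> \<le> D * \<bar>\<psi> x - \<psi> y\<bar>"
    and br_upper: "\<psi> \<in> Br n \<Longrightarrow> x \<in> {0..1} \<Longrightarrow> y \<in> {0..1} \<Longrightarrow>
        \<bar>\<psi> x - \<psi> y\<bar> \<le> D * blen \<psi> * \<bar>x - y\<bar>"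
    and br_range01: "\<psi> \<in> Br n \<Longrightarrow> y \<in> {0..1} \<Longrightarrow> \<psi> y \<in> {0..1}"
    and br_range: "\<psi> \<in> Br n \<Longrightarrow> y \<in> {0<..<1} \<Longrightarrow> \<psi> y \<in> {0<..<1}"
    and br_orbit: "\<psi> \<in> Br n \<Longrightarrow> y \<in> {0<..<1} \<Longrightarrow> (\<tau> ^^ n) (\<psi> y) = y"
    and br_comp: "\<psi> \<in> Br n \<Longrightarrow> \<phi> \<in> Br m \<Longrightarrow> \<psi> \<circ> \<phi> \<in> Br (n + m)"
    and br_cover: "0 \<le> a \<Longrightarrow> a < b \<Longrightarrow> b \<le> 1 \<Longrightarrow> 0 < \<epsilon> \<Longrightarrow>
        \<exists>U. finite U \<and> U \<subseteq> (\<Union>n. Br n) \<and> disjoint_family_on (\<lambda>\<psi>. {blo \<psi><..<bhi \<psi>}) U \<and>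
          (\<forall>\<psi>\<in>U. a \<le> blo \<psi> \<and> bhi \<psi> \<le> b \<and> blen \<psi> < \<epsilon>) \<and> \<alpha> * (b - a) \<le> (\<Sum>\<psi>\<in>U. blen \<psi>)"
begin

definition birk :: "nat \<Rightarrow> real \<Rightarrow> real" where "birk n x = (\<Sum>k<n. f ((\<tau> ^^ k) x))"

abbreviation "E \<equiv> target_set \<tau> f h"

lemma blen_pos: "\<psi> \<in> Br n \<Longrightarrow> 0 < blen \<psi>"
  using br_nontriv[of \<psi> n] by (auto simp: blen_def)

lemma L_nonneg: "0 \<le> L"
  using h_lip[of 0] by (rule lipschitz_on_nonneg)

lemma br_continuous: "\<psi> \<in> Br n \<Longrightarrow> continuous_on {0..1} \<psi>"
proof -
  assume "\<psi> \<in> Br n"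
  then have "(D * blen \<psi>)-lipschitz_on {0..1} \<psi>"
    using br_upper blen_pos[of \<psi> n] D by (intro lipschitz_onI) (auto simp: dist_real_def)
  then show ?thesis by (rule lipschitz_on_continuous_on)
qed

lemma br_inj: assumes "\<psi> \<in> Br n" shows "inj_on \<psi> {0..1}"
proof (rule inj_onI, rule ccontr)
  fix x y assume *: "x \<in> {0..1}" "y \<in> {0..1}" "\<psi> x = \<psi> y" "x \<noteq> y"
  then have "blen \<psi> * \<bar>x - y\<bar> > 0" using blen_pos[OF assms] by simp
  then show False using br_lower[OF assms *(1,2)] * by simp
qed

lemma br_image: "\<psi> \<in> Br n \<Longrightarrow> \<psi> ` {0<..<1} = {blo \<psi><..<bhi \<psi>}"
  by (intro image_open_unit_interval br_continuous br_inj)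

lemma br_comp_image:
  assumes "\<psi> \<in> Br n" "\<phi> \<in> Br m"
  shows "(\<psi> \<circ> \<phi>) ` {0<..<1} \<subseteq> \<psi> ` {0<..<1}"
  using br_range[OF assms(2)] by auto

lemma blen_comp_upper:
  assumes "\<psi> \<in> Br n" "\<phi> \<in> Br m"
  shows "blen (\<psi> \<circ> \<phi>) \<le> blen \<psi>"
proof -
  have "{blo (\<psi> \<circ> \<phi>)<..<bhi (\<psi> \<circ> \<phi>)} \<subseteq> {blo \<psi><..<bhi \<psi>}"
    using br_comp_image[OF assms] unfolding br_image[OF br_comp[OF assms]] br_image[OF assms(1)] .
  moreover have "blo (\<psi> \<circ> \<phi>) < bhi (\<psi> \<circ> \<phi>)"
    using blen_pos[OF br_comp[OF assms]] by (simp flip: bhi_minus_blo)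
  ultimately have "blo \<psi> \<le> blo (\<psi> \<circ> \<phi>)" "bhi (\<psi> \<circ> \<phi>) \<le> bhi \<psi>"
    by (rule interval_mono)+
  then show ?thesis by (simp flip: bhi_minus_blo)
qed

lemma blen_comp_lower:
  assumes "\<psi> \<in> Br n" "\<phi> \<in> Br m"
  shows "blen \<psi> * blen \<phi> \<le> D * blen (\<psi> \<circ> \<phi>)"
  using br_lower[OF assms(1), of "\<phi> 1" "\<phi> 0"] br_range01[OF assms(2)] by (simp add: blen_def)

text \<open>0 is fixed by \<tau>, so an orbit that had met 0 by time n could not be at y > 0 at time
  n.\<close>

lemma orbit_in:
  assumes "\<psi> \<in> Br n" "y \<in> {0<..<1}" "k \<le> n"
  shows "(\<tau> ^^ k) (\<psi> y) \<in> {0<..<1}"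
proof -
  have "(\<tau> ^^ k) (\<psi> y) \<in> {0..<1}" for k
  proof (induction k)
    case 0
    then show ?case using br_range[OF assms(1,2)] by simp
  next
    case (Suc k)
    then show ?case using \<tau>_range by simp
  qed
  moreover have "(\<tau> ^^ k) (\<psi> y) \<noteq> 0"
  proof
    assume *: "(\<tau> ^^ k) (\<psi> y) = 0"
    have z: "(\<tau> ^^ j) 0 = 0" for j by (induction j) (simp_all add: \<tau>_zero)
    have "(\<tau> ^^ n) (\<psi> y) = (\<tau> ^^ (n - k)) ((\<tau> ^^ k) (\<psi> y))"
      using assms(3) by (simp flip: funpow_add[THEN fun_cong, unfolded comp_def])
    then show False using * z br_orbit[OF assms(1,2)] assms(2) by simp
  qed
  ultimately show ?thesis by (metis atLeastLessThan_iff greaterThanLessThan_iff less_eq_real_def)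
qed

lemma birk_nonneg:
  assumes "\<psi> \<in> Br n" "y \<in> {0<..<1}"
  shows "0 \<le> birk n (\<psi> y)"
  unfolding birk_def using orbit_in[OF assms] f_pos by (intro sum_nonneg) (auto intro!: less_imp_le)

lemma birk_le:
  assumes "\<psi> \<in> Br n" "y \<in> {0<..<1}"
  shows "birk n (\<psi> y) \<le> real n * M"
proof -
  have "birk n (\<psi> y) \<le> (\<Sum>k<n. M)"
    unfolding birk_def using orbit_in[OF assms] f_le by (intro sum_mono) auto
  then show ?thesis by simp
qed

lemma birk_add: "birk (n + m) x = birk n x + birk m ((\<tau> ^^ n) x)"
proof -
  have "birk (n + m) x = birk n x + (\<Sum>k<m. f ((\<tau> ^^ (n + k)) x))"
    unfolding birk_def by (induction m) (auto simp: add_ac)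
  also have "(\<Sum>k<m. f ((\<tau> ^^ (n + k)) x)) = birk m ((\<tau> ^^ n) x)"
    unfolding birk_def by (simp add: add.commute[of n] funpow_add)
  finally show ?thesis .
qed

text \<open>The target \<open>h\<close> pulled back by the branch has a fixed point by the intermediate value theorem;
  the interval is found next to it.\<close>

lemma branch_meets_target:
  assumes v: "v \<in> Br n" and small: "L * D * blen v \<le> 1/2" and t: "0 < t" "t \<le> 1"
    and A: "\<And>y. y \<in> {0<..<1} \<Longrightarrow> exp (t * birk n (v y)) \<le> A"
  shows "\<exists>c d. c < d \<and> {c..d} \<subseteq> E n \<inter> v ` {0<..<1} \<and>
    blen v powr t \<le> (4 * D) powr t * A * (d - c) powr t"
proof -
  have vc: "continuous_on {0..1} v" by (rule br_continuous[OF v])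
  have "continuous_on {0..1} (\<lambda>y. h n (v y))"
    by (rule continuous_on_compose2[OF lipschitz_on_continuous_on[OF h_lip] vc])
      (use br_range01[OF v] in auto)
  then have cont: "continuous_on {0..1} (\<lambda>y. y - h n (v y))" by (intro continuous_intros)
  have hv: "h n (v y) \<in> {0..1}" if "y \<in> {0..1}" for y
    using h_range[of n] br_range01[OF v that] by blast
  \<comment> \<open>The values of \<open>h n\<close> lie in the unit interval, so the difference is
    nonpositive at 0 and nonnegative at 1.\<close>
  have "\<exists>y\<ge>0. y \<le> 1 \<and> y - h n (v y) = 0"
    using hv[of 0] hv[of 1] cont by (intro IVT') auto
  then obtain z where z: "0 \<le> z" "z \<le> 1" "h n (v z) = z" by force
  have A1: "A \<ge> 1"
  proof -
    have "1 \<le> exp (t * birk n (v (1/2)))" using birk_nonneg[OF v, of "1/2"] t by simp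
    also have "\<dots> \<le> A" by (rule A) simp
    finally show ?thesis .
  qed
  \<comment> \<open>A bounds \<open>exp (t * birk n (v y))\<close> on the branch, so \<rho> is a
    lower bound for the permitted error \<open>exp (- birk n (v y))\<close> there.\<close>
  define \<rho> where "\<rho> = A powr (- 1 / t)"
  have \<rho>: "0 < \<rho>" "\<rho> \<le> 1"
    using A1 t powr_mono[of "- 1 / t" 0 A] by (auto simp: \<rho>_def)
  have \<rho>A: "\<rho> powr t = 1 / A"
  proof -
    have "- 1 / t * t = - 1" using t by simp
    then show ?thesis using A1 unfolding \<rho>_def powr_powr by (simp add: powr_minus_divide)
  qed
  have \<rho>_le: "\<rho> \<le> exp (- birk n (v y))" if "y \<in> {0<..<1}" for y
  proof -
    have "exp (t * birk n (v y)) powr (1/t) \<le> A powr (1/t)"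
      using A[OF that] t by (intro powr_mono2) auto
    then have "exp (birk n (v y)) \<le> A powr (1/t)" using t by (simp add: exp_powr_real)
    then show ?thesis using A1 by (simp add: \<rho>_def exp_minus powr_minus le_imp_inverse_le)
  qed
  \<comment> \<open>The window lies on the side of z that has room within (0,1). As y \<mapsto> h n
    (v y) has Lipschitz constant at most 1/2, the error on it is at most 3/2 of the distance to z,
    that is 9/16 \<rho>.\<close>
  have "\<exists>y1 y2. 0 < y1 \<and> y2 < 1 \<and> y2 - y1 = \<rho>/4 \<and> (\<forall>y\<in>{y1..y2}. \<bar>y - z\<bar> \<le> 3/8 * \<rho>)"
  proof (cases "z \<le> 1/2")
    case True
    then show ?thesis using z \<rho> by (intro exI[of _ "z + \<rho>/8"] exI[of _ "z + 3/8 * \<rho>"]) auto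
  next
    case False
    then show ?thesis using z \<rho> by (intro exI[of _ "z - 3/8 * \<rho>"] exI[of _ "z - \<rho>/8"]) auto
  qed
  then obtain y1 y2 where y: "0 < y1" "y2 < 1" "y2 - y1 = \<rho>/4"
    "\<And>y. y \<in> {y1..y2} \<Longrightarrow> \<bar>y - z\<bar> \<le> 3/8 * \<rho>" by blast
  have y12: "y1 < y2" using y(3) \<rho> by linarith
  have "continuous_on {y1..y2} v" using vc by (rule continuous_on_subset) (use y in auto)
  then obtain c d where cd: "v ` {y1..y2} = {c..d}" "c \<le> d"
    using continuous_image_closed_interval[of y1 y2 v] y12 by (meson less_imp_le)
  have "v y1 \<in> {c..d}" "v y2 \<in> {c..d}" using cd(1) y12 by auto
  then have "\<bar>v y1 - v y2\<bar> \<le> d - c" by auto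
  then have "D * \<bar>v y1 - v y2\<bar> \<le> D * (d - c)" using D by (intro mult_left_mono) auto
  moreover have "blen v * \<bar>y1 - y2\<bar> \<le> D * \<bar>v y1 - v y2\<bar>"
    by (rule br_lower[OF v]) (use y(1,2) y12 in auto)
  moreover have "\<bar>y1 - y2\<bar> = \<rho>/4" using y(3) y12 by simp
  ultimately have "blen v * (\<rho>/4) \<le> D * (d - c)" by simp
  then have len: "blen v * \<rho> \<le> 4 * D * (d - c)" by simp
  have "blen v * \<rho> > 0" using blen_pos[OF v] \<rho> by simp
  then have "0 < 4 * D * (d - c)" using len by linarith
  then have "c < d" using D by (simp add: zero_less_mult_iff)
  moreover have "{c..d} \<subseteq> E n \<inter> v ` {0<..<1}"
  proof
    fix x assume "x \<in> {c..d}"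
    then obtain y' where y': "y' \<in> {y1..y2}" "x = v y'" using cd by blast
    then have y01: "y' \<in> {0<..<1}" using y by auto
    have "\<bar>h n (v z) - h n (v y')\<bar> \<le> L * \<bar>v z - v y'\<bar>"
      using lipschitz_onD[OF h_lip, of "v z" "v y'" n] br_range01[OF v] z y01 by (auto simp: dist_real_def)
    also have "\<dots> \<le> L * (D * blen v * \<bar>z - y'\<bar>)"
      using br_upper[OF v, of z y'] z y01 L_nonneg by (intro mult_left_mono) auto
    also have "\<dots> = (L * D * blen v) * \<bar>z - y'\<bar>" by simp
    also have "\<dots> \<le> 1/2 * \<bar>z - y'\<bar>" using small by (intro mult_right_mono) auto
    finally have "\<bar>z - h n (v y')\<bar> \<le> 1/2 * \<bar>z - y'\<bar>" unfolding z(3) .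
    then have "\<bar>y' - h n (v y')\<bar> \<le> 3/2 * \<bar>y' - z\<bar>"
      using abs_triangle_ineq[of "y' - z" "z - h n (v y')"] abs_minus_commute[of z y'] by simp
    also have "\<dots> \<le> 3/2 * (3/8 * \<rho>)" using y(4)[OF y'(1)] by (intro mult_left_mono) auto
    also have "\<dots> < \<rho>" using \<rho> by simp
    also have "\<dots> \<le> exp (- birk n (v y'))" by (rule \<rho>_le[OF y01])
    finally have "\<bar>y' - h n (v y')\<bar> < exp (- birk n (v y'))" .
    then show "x \<in> E n \<inter> v ` {0<..<1}"
      using y' y01 br_range[OF v y01] orbit_in[OF v y01] br_orbit[OF v y01]
      by (fastforce simp: target_set_def birk_def)
  qed
  moreover have "blen v powr t \<le> (4 * D) powr t * A * (d - c) powr t"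
  proof -
    have "(blen v * \<rho>) powr t \<le> (4 * D * (d - c)) powr t"
      using len blen_pos[OF v] \<rho> t by (intro powr_mono2) auto
    then have "blen v powr t / A \<le> (4 * D) powr t * (d - c) powr t"
      using blen_pos[OF v] \<rho> D cd \<rho>A by (simp add: powr_mult)
    then show ?thesis using A1 by (simp add: field_simps)
  qed
  ultimately show ?thesis by blast
qed

end

section \<open>Mass distributed over a tree of full branches\<close>

context full_branches
begin

lemma br_comp_disjoint:
  assumes v: "v \<in> Br n" and F: "F \<subseteq> Br m"
    and dis: "disjoint_family_on (\<lambda>w. {blo w<..<bhi w}) F"
  shows "disjoint_family_on (\<lambda>w. (v \<circ> w) ` {0<..<1}) F"
    and "disjoint_family_on (\<lambda>w. {blo (v \<circ> w)<..<bhi (v \<circ> w)}) F"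
proof -
  show *: "disjoint_family_on (\<lambda>w. (v \<circ> w) ` {0<..<1}) F"
    unfolding disjoint_family_on_def
  proof (intro ballI impI)
    fix w w' assume w: "w \<in> F" "w' \<in> F" "w \<noteq> w'"
    have b: "w \<in> Br m" "w' \<in> Br m" using w F by auto
    have "w ` {0<..<1} \<inter> w' ` {0<..<1} = {}"
      using dis w unfolding br_image[OF b(1)] br_image[OF b(2)] disjoint_family_on_def by blast
    moreover have "w ` {0<..<1} \<subseteq> {0..1}" "w' ` {0<..<1} \<subseteq> {0..1}"
      using br_range01[OF b(1)] br_range01[OF b(2)] by fastforce+
    ultimately have "v ` (w ` {0<..<1}) \<inter> v ` (w' ` {0<..<1}) = {}"
      using inj_on_image_Int[OF br_inj[OF v], of "w ` {0<..<1}" "w' ` {0<..<1}"] by simp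
    then show "(v \<circ> w) ` {0<..<1} \<inter> (v \<circ> w') ` {0<..<1} = {}"
      by (simp add: image_comp)
  qed
  have "(v \<circ> w) ` {0<..<1} = {blo (v \<circ> w)<..<bhi (v \<circ> w)}" if "w \<in> F" for w
    using br_image[OF br_comp[OF v]] that F by blast
  then show "disjoint_family_on (\<lambda>w. {blo (v \<circ> w)<..<bhi (v \<circ> w)}) F"
    using * unfolding disjoint_family_on_def by auto
qed

text \<open>Induction on the depth j for all parents v at once: the leaves below v are those below
  its children \<open>v \<circ> w\<close>, with masses scaled by the normalised weights
  \<open>blen w powr t * \<theta> w\<close>. Passing to a child replaces A by
  \<open>A / \<theta> w\<close>; the factor \<open>\<theta> w\<close> in its weight cancels this,
  and the halving is left over. An interval J is a pair of end points. The last clause counts only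
  leaves no longer than the window, since the mass of a leaf is a single lump that is not
  distributed within it.\<close>

lemma mass_distribution:
  assumes t: "0 < t" "t \<le> 1" and F: "finite F" "F \<subseteq> Br m"
    and dis: "disjoint_family_on (\<lambda>w. {blo w<..<bhi w}) F"
    and \<theta>: "\<And>w. w \<in> F \<Longrightarrow> 0 < \<theta> w"
      "\<And>w y. w \<in> F \<Longrightarrow> y \<in> {0<..<1} \<Longrightarrow> \<theta> w \<le> exp (- t * birk m (w y))"
    and sum: "6 * D \<le> (\<Sum>w\<in>F. blen w powr t * \<theta> w)"
    and l: "0 < l" "\<And>w. w \<in> F \<Longrightarrow> D * l \<le> blen w"
    and v: "v \<in> Br n" "L * D * blen v \<le> 1/2"
    and A: "\<And>y. y \<in> {0<..<1} \<Longrightarrow> exp (t * birk n (v y)) \<le> A"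
  shows "\<exists>V p. finite V \<and>
    (\<forall>J\<in>V. fst J < snd J \<and> {fst J..snd J} \<subseteq> E (n + m * j) \<inter> v ` {0<..<1}) \<and>
    disjoint_family_on (\<lambda>J. {fst J<..<snd J}) V \<and>
    (\<forall>J. 0 \<le> p J) \<and> (\<forall>J. J \<notin> V \<longrightarrow> p J = 0) \<and> sum p V = 1 \<and>
    (\<forall>J\<in>V. p J * blen v powr t \<le> (4 * D) powr t * A / 2 ^ j * (snd J - fst J) powr t) \<and>
    (\<forall>x y. x < y \<longrightarrow>
      (\<Sum>J\<in>{J \<in> V. x < snd J \<and> fst J < y \<and> snd J - fst J \<le> y - x}. p J) * blen v powr t
        \<le> max (l powr - t) ((4 * D) powr t * A / 2 ^ j) * (y - x) powr t)"
  using v A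
proof (induction j arbitrary: v n A)
  \<comment> \<open>At depth 0 the whole mass sits on one interval inside v and the target of order
    n.\<close>
  case 0
  obtain c d where cd: "c < d" "{c..d} \<subseteq> E n \<inter> v ` {0<..<1}"
    "blen v powr t \<le> (4 * D) powr t * A * (d - c) powr t"
    using branch_meets_target[OF 0(1,2) t 0(3)] by blast
  have A0: "0 \<le> A" using less_le_trans[OF exp_gt_zero 0(3)[of "1/2"]] by simp
  define p :: "real \<times> real \<Rightarrow> real" where "p J = (if J = (c, d) then 1 else 0)" for J
  have "(\<Sum>J\<in>{J \<in> {(c, d)}. x < snd J \<and> fst J < y \<and> snd J - fst J \<le> y - x}. p J) * blen v powr t
        \<le> max (l powr - t) ((4 * D) powr t * A) * (y - x) powr t" if "x < y" for x y
  proof (cases "x < d \<and> c < y \<and> d - c \<le> y - x")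
    case True
    then have "{J \<in> {(c, d)}. x < snd J \<and> fst J < y \<and> snd J - fst J \<le> y - x} = {(c, d)}" by auto
    moreover have "blen v powr t \<le> max (l powr - t) ((4 * D) powr t * A) * (y - x) powr t"
    proof -
      have "blen v powr t \<le> (4 * D) powr t * A * (d - c) powr t" by (rule cd(3))
      also have "\<dots> \<le> max (l powr - t) ((4 * D) powr t * A) * (y - x) powr t"
        using True cd(1) t A0 by (intro mult_mono powr_mono2) (auto simp: le_max_iff_disj)
      finally show ?thesis .
    qed
    ultimately show ?thesis by (simp add: p_def)
  next
    case False
    then have *: "(\<Sum>J\<in>{J \<in> {(c, d)}. x < snd J \<and> fst J < y \<and> snd J - fst J \<le> y - x}. p J) = 0"
      by (intro sum.neutral) auto
    show ?thesis unfolding * using A0 by (auto intro!: mult_nonneg_nonneg simp: le_max_iff_disj)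
  qed
  then show ?case using cd
    by (intro exI[of _ "{(c, d)}"] exI[of _ p]) (auto simp: disjoint_family_on_def p_def)
next
  case (Suc j)
  define R where "R = (4 * D) powr t"
  have R: "R > 0" using D by (simp add: R_def)
  define B where "B = A / 2 ^ j"
  note v = Suc.prems(1) and vs = Suc.prems(2) and A = Suc.prems(3)
  have A0: "0 < A" using less_le_trans[OF exp_gt_zero A[of "1/2"]] by simp
  have B0: "B > 0" using A0 by (simp add: B_def)
  have Fb: "w \<in> Br m" if "w \<in> F" for w using F that by auto
  have lv: "0 < blen v" by (rule blen_pos[OF v])
  define X where "X w V p \<longleftrightarrow> finite V \<and>
    (\<forall>J\<in>V. fst J < snd J \<and> {fst J..snd J} \<subseteq> E (n + m * Suc j) \<inter> (v \<circ> w) ` {0<..<1}) \<and>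
    disjoint_family_on (\<lambda>J. {fst J<..<snd J}) V \<and>
    (\<forall>J. 0 \<le> p J) \<and> (\<forall>J. J \<notin> V \<longrightarrow> p J = 0) \<and> sum p V = 1 \<and>
    (\<forall>J\<in>V. p J * blen (v \<circ> w) powr t \<le> R * B / \<theta> w * (snd J - fst J) powr t) \<and>
    (\<forall>x y. x < y \<longrightarrow>
      (\<Sum>J\<in>{J \<in> V. x < snd J \<and> fst J < y \<and> snd J - fst J \<le> y - x}. p J) * blen (v \<circ> w) powr t
        \<le> max (l powr - t) (R * B / \<theta> w) * (y - x) powr t)"
    for w and V :: "(real \<times> real) set" and p :: "real \<times> real \<Rightarrow> real"
  have "\<forall>w\<in>F. \<exists>Vp. X w (fst Vp) (snd Vp)"
  proof
    fix w assume w: "w \<in> F"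
    have vw: "v \<circ> w \<in> Br (n + m)" by (rule br_comp[OF v Fb[OF w]])
    have "L * D * blen (v \<circ> w) \<le> L * D * blen v"
      using blen_comp_upper[OF v Fb[OF w]] L_nonneg D by (intro mult_left_mono) auto
    then have vws: "L * D * blen (v \<circ> w) \<le> 1/2" using vs by linarith
    have "exp (t * birk (n + m) ((v \<circ> w) y)) \<le> A / \<theta> w" if y: "y \<in> {0<..<1}" for y
    proof -
      have wy: "w y \<in> {0<..<1}" by (rule br_range[OF Fb[OF w] y])
      have "birk (n + m) ((v \<circ> w) y) = birk n (v (w y)) + birk m (w y)"
        using br_orbit[OF v wy] by (simp add: birk_add)
      then have "exp (t * birk (n + m) ((v \<circ> w) y)) = exp (t * birk n (v (w y))) * exp (t * birk m (w y))"
        by (simp add: distrib_left exp_add)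
      also have "\<dots> \<le> A * (1 / \<theta> w)"
      proof (rule mult_mono)
        have "inverse (exp (- t * birk m (w y))) \<le> inverse (\<theta> w)"
          using \<theta>(2)[OF w y] \<theta>(1)[OF w] by (rule le_imp_inverse_le)
        then show "exp (t * birk m (w y)) \<le> 1 / \<theta> w" by (simp add: exp_minus inverse_eq_divide)
      qed (use A[OF wy] A0 in auto)
      finally show ?thesis by simp
    qed
    note IH = Suc.IH[OF vw vws this]
    have e: "n + m + m * j = n + m * Suc j" "(4 * D) powr t * (A / \<theta> w) / 2 ^ j = R * B / \<theta> w"
      by (simp_all add: R_def B_def)
    have "\<exists>V p. X w V p" using IH unfolding X_def e .
    then show "\<exists>Vp. X w (fst Vp) (snd Vp)" by simp
  qed
  from bchoice[OF this] obtain Vp where Vp: "\<forall>w\<in>F. X w (fst (Vp w)) (snd (Vp w))" by blast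
  define V where "V w = fst (Vp w)" for w
  define P where "P w = snd (Vp w)" for w
  have X: "X w (V w) (P w)" if "w \<in> F" for w using Vp that by (simp add: V_def P_def)
  have finV: "finite (V w)" and Pnn: "0 \<le> P w J" and Pout: "J \<notin> V w \<Longrightarrow> P w J = 0" and Psum: "sum (P w) (V w) = 1"
    and Vin: "J \<in> V w \<Longrightarrow> fst J < snd J \<and> {fst J..snd J} \<subseteq> E (n + m * Suc j) \<inter> (v \<circ> w) ` {0<..<1}"
    and Psm: "J \<in> V w \<Longrightarrow> P w J * blen (v \<circ> w) powr t \<le> R * B / \<theta> w * (snd J - fst J) powr t"
    and Pb: "x < y \<Longrightarrow> (\<Sum>J\<in>{J \<in> V w. x < snd J \<and> fst J < y \<and> snd J - fst J \<le> y - x}. P w J) * blen (v \<circ> w) powr t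
        \<le> max (l powr - t) (R * B / \<theta> w) * (y - x) powr t"
    and Vdis: "disjoint_family_on (\<lambda>J. {fst J<..<snd J}) (V w)"
    if "w \<in> F" for w J x y
    using X[OF that] unfolding X_def by blast+
  define S where "S = (\<Sum>w\<in>F. blen w powr t * \<theta> w)"
  have S: "6 * D \<le> S" "0 < S" using sum D by (auto simp: S_def)
  define q where "q w = blen w powr t * \<theta> w / S" for w
  have q0: "0 \<le> q w" if "w \<in> F" for w using S \<theta>(1)[OF that] by (simp add: q_def)
  have qsum: "sum q F = 1" using S by (simp add: q_def sum_divide_distrib[symmetric] S_def[symmetric])
  \<comment> \<open>Normalising by S \<ge> 6 D pays for the distortion of the composition, D^t being
    at most D, and leaves 1/6 for the estimates below.\<close>
  have coef: "q w * blen v powr t \<le> \<theta> w / 6 * blen (v \<circ> w) powr t" if w: "w \<in> F" for w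
  proof -
    have "(blen v * blen w) powr t \<le> (D * blen (v \<circ> w)) powr t"
      using blen_comp_lower[OF v Fb[OF w]] lv blen_pos[OF Fb[OF w]] t by (intro powr_mono2) auto
    also have "\<dots> = D powr t * blen (v \<circ> w) powr t" by (rule powr_mult)
    also have "\<dots> \<le> D * blen (v \<circ> w) powr t"
      using powr_mono[of t 1 D] D t by (intro mult_right_mono) auto
    finally have 1: "blen v powr t * blen w powr t \<le> D * blen (v \<circ> w) powr t" by (simp add: powr_mult)
    have "q w * blen v powr t = \<theta> w / S * (blen v powr t * blen w powr t)" by (simp add: q_def)
    also have "\<dots> \<le> \<theta> w / S * (D * blen (v \<circ> w) powr t)"
      using 1 \<theta>(1)[OF w] S by (intro mult_left_mono) auto
    also have "\<dots> = (\<theta> w * blen (v \<circ> w) powr t) * (D / S)" by simp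
    also have "\<dots> \<le> (\<theta> w * blen (v \<circ> w) powr t) * (1 / 6)"
      using S \<theta>(1)[OF w] by (intro mult_left_mono) (auto simp: field_simps)
    finally show ?thesis by simp
  qed
  have \<theta>1: "\<theta> w \<le> 1" if w: "w \<in> F" for w
  proof -
    have "\<theta> w \<le> exp (- t * birk m (w (1/2)))" by (rule \<theta>(2)[OF w]) simp
    also have "\<dots> \<le> 1" using birk_nonneg[OF Fb[OF w], of "1/2"] t by simp
    finally show ?thesis .
  qed
  define W where "W = (\<Union>w\<in>F. V w)"
  define p where "p J = (\<Sum>w\<in>F. q w * P w J)" for J
  have finW: "finite W" unfolding W_def using F finV by blast
  \<comment> \<open>\<open>P w\<close> vanishes off its own leaves, so the mass of any selection of
    leaves splits over the children.\<close>
  have sum_p: "(\<Sum>J\<in>{J \<in> W. Q J}. p J) = (\<Sum>w\<in>F. q w * (\<Sum>J\<in>{J \<in> V w. Q J}. P w J))" for Q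
  proof -
    have "(\<Sum>J\<in>{J \<in> W. Q J}. p J) = (\<Sum>w\<in>F. q w * (\<Sum>J\<in>{J \<in> W. Q J}. P w J))"
      unfolding p_def by (subst sum.swap) (simp add: sum_distrib_left)
    also have "\<dots> = (\<Sum>w\<in>F. q w * (\<Sum>J\<in>{J \<in> V w. Q J}. P w J))"
    proof (rule sum.cong[OF refl])
      fix w assume w: "w \<in> F"
      have "(\<Sum>J\<in>{J \<in> W. Q J}. P w J) = (\<Sum>J\<in>{J \<in> V w. Q J}. P w J)"
      proof (rule sum.mono_neutral_right)
        show "{J \<in> V w. Q J} \<subseteq> {J \<in> W. Q J}" using w by (auto simp: W_def)
      qed (use finW Pout[OF w] in auto)
      then show "q w * (\<Sum>J\<in>{J \<in> W. Q J}. P w J) = q w * (\<Sum>J\<in>{J \<in> V w. Q J}. P w J)" by simp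
    qed
    finally show ?thesis .
  qed
  have sum1: "sum p W = 1" using sum_p[of "\<lambda>_. True"] Psum qsum by (simp cong: sum.cong)
  have pnn: "0 \<le> p J" for J unfolding p_def using q0 Pnn by (intro sum_nonneg mult_nonneg_nonneg) auto
  have pout: "p J = 0" if "J \<notin> W" for J
    using that Pout unfolding p_def W_def by (intro sum.neutral) auto
  note comp_dis = br_comp_disjoint[OF v F(2) dis]
  have Jin: "{fst J<..<snd J} \<subseteq> (v \<circ> w) ` {0<..<1}" "{fst J<..<snd J} \<noteq> {}" if "w \<in> F" "J \<in> V w" for w J
    using Vin[OF that] greaterThanLessThan_subseteq_atLeastAtMost_iff[of "fst J" "snd J" "fst J" "snd J"] by auto
  have disj: "V w \<inter> V w' = {}" if "w \<in> F" "w' \<in> F" "w \<noteq> w'" for w w'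
  proof (rule ccontr)
    assume "V w \<inter> V w' \<noteq> {}"
    then obtain J where "J \<in> V w" "J \<in> V w'" by auto
    then have "{fst J<..<snd J} \<subseteq> (v \<circ> w) ` {0<..<1} \<inter> (v \<circ> w') ` {0<..<1}" using Jin that by blast
    also have "\<dots> = {}" using comp_dis(1) that by (simp add: disjoint_family_on_def)
    finally show False using Jin(2)[OF that(1) \<open>J \<in> V w\<close>] by simp
  qed
  have Wdis: "disjoint_family_on (\<lambda>J. {fst J<..<snd J}) W"
    unfolding disjoint_family_on_def
  proof (intro ballI impI)
    fix J J' assume J: "J \<in> W" "J' \<in> W" "J \<noteq> J'"
    then obtain w w' where w: "w \<in> F" "J \<in> V w" "w' \<in> F" "J' \<in> V w'" by (auto simp: W_def)
    show "{fst J<..<snd J} \<inter> {fst J'<..<snd J'} = {}"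
    proof (cases "w = w'")
      case True
      then show ?thesis using Vdis[OF w(1)] w J unfolding disjoint_family_on_def by blast
    next
      case False
      then have "(v \<circ> w) ` {0<..<1} \<inter> (v \<circ> w') ` {0<..<1} = {}"
        using comp_dis(1) w by (simp add: disjoint_family_on_def)
      then show ?thesis using Jin(1)[OF w(1,2)] Jin(1)[OF w(3,4)] by blast
    qed
  qed
  have Win: "fst J < snd J \<and> {fst J..snd J} \<subseteq> E (n + m * Suc j) \<inter> v ` {0<..<1}" if J: "J \<in> W" for J
  proof -
    obtain w where w: "w \<in> F" "J \<in> V w" using J by (auto simp: W_def)
    show ?thesis using Vin[OF w] br_comp_image[OF v Fb[OF w(1)]] by blast
  qed
  have half: "R * A / 2 ^ Suc j = R * B / 2" by (simp add: B_def)
  have psm: "p J * blen v powr t \<le> R * A / 2 ^ Suc j * (snd J - fst J) powr t" if J: "J \<in> W" for J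
  proof -
    obtain w where w: "w \<in> F" "J \<in> V w" using J by (auto simp: W_def)
    have "p J = (\<Sum>w'\<in>{w}. q w' * P w' J)"
      unfolding p_def
    proof (rule sum.mono_neutral_right)
      show "\<forall>w'\<in>F - {w}. q w' * P w' J = 0"
      proof
        fix w' assume w': "w' \<in> F - {w}"
        then have "J \<notin> V w'" using disj[of w w'] w by auto
        then show "q w' * P w' J = 0" using Pout w' by simp
      qed
    qed (use F w in auto)
    then have "p J * blen v powr t = P w J * (q w * blen v powr t)" by simp
    also have "\<dots> \<le> P w J * (\<theta> w / 6 * blen (v \<circ> w) powr t)"
      using coef[OF w(1)] Pnn[OF w(1)] by (intro mult_left_mono) auto
    also have "\<dots> = \<theta> w / 6 * (P w J * blen (v \<circ> w) powr t)" by simp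
    also have "\<dots> \<le> \<theta> w / 6 * (R * B / \<theta> w * (snd J - fst J) powr t)"
      using Psm[OF w] \<theta>(1)[OF w(1)] by (intro mult_left_mono) auto
    also have "\<dots> = R * B / 6 * (snd J - fst J) powr t" using \<theta>(1)[OF w(1)] by simp
    also have "\<dots> \<le> R * A / 2 ^ Suc j * (snd J - fst J) powr t"
      unfolding half using R B0 by (intro mult_right_mono) auto
    finally show ?thesis .
  qed
  \<comment> \<open>A window of length at least l times \<open>blen v\<close> is handled by the
    total mass 1. A shorter window is shorter than every child, by the choice of l, and hence meets
    at most three of them.\<close>
  have pball: "(\<Sum>J\<in>{J \<in> W. x < snd J \<and> fst J < y \<and> snd J - fst J \<le> y - x}. p J) * blen v powr t
        \<le> max (l powr - t) (R * A / 2 ^ Suc j) * (y - x) powr t" (is "?s * _ \<le> _") if xy: "x < y" for x y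
  proof (cases "l * blen v \<le> y - x")
    case True
    have "?s \<le> sum p W" using finW pnn by (intro sum_mono2) auto
    then have "?s * blen v powr t \<le> 1 * blen v powr t" unfolding sum1 by (intro mult_right_mono) auto
    also have "blen v powr t \<le> ((y - x) / l) powr t"
      using True l lv t by (intro powr_mono2) (auto simp: field_simps)
    also have "((y - x) / l) powr t = l powr - t * (y - x) powr t"
      using xy l by (simp add: powr_divide powr_minus_divide)
    also have "\<dots> \<le> max (l powr - t) (R * A / 2 ^ Suc j) * (y - x) powr t"
      by (intro mult_right_mono) auto
    finally show ?thesis by simp
  next
    case False
    define K where "K = max (l powr - t) (R * B) * (y - x) powr t"
    have K0: "K \<ge> 0" using R B0 by (auto simp: K_def le_max_iff_disj)
    define s where "s w = (\<Sum>J\<in>{J \<in> V w. x < snd J \<and> fst J < y \<and> snd J - fst J \<le> y - x}. P w J)" for w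
    let ?F = "{w \<in> F. x < bhi (v \<circ> w) \<and> blo (v \<circ> w) < y}"
    have big: "y - x < blen (v \<circ> w)" if w: "w \<in> F" for w
    proof -
      have "D * (l * blen v) \<le> blen w * blen v" using l(2)[OF w] lv by (simp add: mult.assoc[symmetric])
      also have "\<dots> \<le> D * blen (v \<circ> w)" using blen_comp_lower[OF v Fb[OF w]] by (simp add: mult.commute)
      finally have "l * blen v \<le> blen (v \<circ> w)" using D by simp
      then show ?thesis using False by linarith
    qed
    have s_le: "q w * s w * blen v powr t \<le> K / 6" if w: "w \<in> F" for w
    proof -
      have s0: "0 \<le> s w" unfolding s_def using Pnn[OF w] by (intro sum_nonneg) auto
      have "q w * s w * blen v powr t = s w * (q w * blen v powr t)" by simp
      also have "\<dots> \<le> s w * (\<theta> w / 6 * blen (v \<circ> w) powr t)"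
        using coef[OF w] s0 by (intro mult_left_mono) auto
      also have "\<dots> = \<theta> w / 6 * (s w * blen (v \<circ> w) powr t)" by simp
      also have "\<dots> \<le> \<theta> w / 6 * (max (l powr - t) (R * B / \<theta> w) * (y - x) powr t)"
        using Pb[OF w xy] \<theta>(1)[OF w] unfolding s_def by (intro mult_left_mono) auto
      also have "\<dots> = (\<theta> w * max (l powr - t) (R * B / \<theta> w)) * (y - x) powr t / 6" by simp
      also have "\<dots> \<le> K / 6"
      proof -
        have "\<theta> w * max (l powr - t) (R * B / \<theta> w) \<le> max (l powr - t) (R * B)"
          using \<theta>(1)[OF w] \<theta>1[OF w] mult_right_mono[of "\<theta> w" 1 "l powr - t"]
          by (cases "l powr - t \<le> R * B / \<theta> w") (auto simp: max_def)
        then show ?thesis unfolding K_def by (intro divide_right_mono mult_right_mono) auto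
      qed
      finally show ?thesis .
    qed
    have s_zero: "s w = 0" if w: "w \<in> F" "w \<notin> ?F" for w
    proof -
      have "\<not> (x < snd J \<and> fst J < y)" if J: "J \<in> V w" for J
      proof -
        have "{fst J<..<snd J} \<subseteq> {blo (v \<circ> w)<..<bhi (v \<circ> w)}"
          using Jin(1)[OF w(1) J] br_image[OF br_comp[OF v Fb[OF w(1)]]] by simp
        then have "blo (v \<circ> w) \<le> fst J" "snd J \<le> bhi (v \<circ> w)"
          using Vin[OF w(1) J] by (auto dest: interval_mono)
        then show ?thesis using w by auto
      qed
      then show ?thesis unfolding s_def by (intro sum.neutral) auto
    qed
    have "(\<Sum>w\<in>?F. min (bhi (v \<circ> w) - blo (v \<circ> w)) (y - x)) = (\<Sum>w\<in>?F. y - x)"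
    proof (rule sum.cong[OF refl])
      fix w assume "w \<in> ?F"
      then show "min (bhi (v \<circ> w) - blo (v \<circ> w)) (y - x) = y - x"
        using big[of w] by (simp add: bhi_minus_blo)
    qed
    then have "real (card ?F) * (y - x) = (\<Sum>w\<in>?F. min (bhi (v \<circ> w) - blo (v \<circ> w)) (y - x))" by simp
    also have "\<dots> \<le> 3 * (y - x)"
      using F comp_dis(2) xy blen_pos[OF br_comp[OF v Fb]]
      by (intro sum_touching_min) (auto simp: bhi_minus_blo[symmetric])
    finally have card: "real (card ?F) \<le> 3"
      by (rule mult_right_le_imp_le) (use xy in simp)
    have "?s * blen v powr t = (\<Sum>w\<in>F. q w * s w * blen v powr t)"
      unfolding sum_p s_def by (simp add: sum_distrib_right)
    also have "\<dots> = (\<Sum>w\<in>?F. q w * s w * blen v powr t)"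
      using F s_zero by (intro sum.mono_neutral_right) auto
    also have "\<dots> \<le> (\<Sum>w\<in>?F. K / 6)" using s_le by (intro sum_mono) auto
    also have "\<dots> = real (card ?F) * (K / 6)" by simp
    also have "\<dots> \<le> 3 * (K / 6)" using card K0 by (intro mult_right_mono) auto
    also have "\<dots> = (max (l powr - t) (R * B) / 2) * (y - x) powr t" by (simp add: K_def)
    also have "\<dots> \<le> max (l powr - t) (R * A / 2 ^ Suc j) * (y - x) powr t"
      unfolding half
    proof (rule mult_right_mono)
      \<comment> \<open>The entry \<open>l powr - t\<close> does not build up over the levels, while
        the other entry keeps halving.\<close>
      have "max z y / 2 \<le> max z (y / 2)" if "0 \<le> z" for z y :: real
        using that by (auto simp: max_def)
      then show "max (l powr - t) (R * B) / 2 \<le> max (l powr - t) (R * B / 2)" by simp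
    qed simp
    finally show ?thesis .
  qed
  show ?case
    using finW Win Wdis pnn pout sum1 psm pball unfolding R_def by (intro exI[of _ W] exI[of _ p]) blast
qed

end

section \<open>Passing small touching sums from branches to intervals and back\<close>

context full_branches
begin

text \<open>\<open>\<theta> w\<close> is a uniform lower bound for exp (- t S_m f) on the branch w,
  so the last sum is, up to distortion, a partition sum of full cylinders at exponent t. Positive
  pressure at t will supply it.\<close>

definition expanding :: "real \<Rightarrow> bool" where
  "expanding t \<longleftrightarrow> (\<exists>m F \<theta>. 0 < m \<and> finite F \<and> F \<subseteq> Br m \<and>
     disjoint_family_on (\<lambda>w. {blo w<..<bhi w}) F \<and>
     (\<forall>w\<in>F. 0 < \<theta> w \<and> (\<forall>y\<in>{0<..<1}. \<theta> w \<le> exp (- t * birk m (w y)))) \<and>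
     6 * D \<le> (\<Sum>w\<in>F. blen w powr t * \<theta> w))"

text \<open>\<kappa>' is settled by the shortest branch of the expanding family, before \<kappa>, N
  and u are given. If all leaf intervals J in a deep tree had touching sum at least \<kappa> |J|^t,
  \<open>sum_le_touching_sum\<close> with the mass distribution would push the touching sum of u up
  to \<kappa>' |u|^t.\<close>

lemma branch_to_interval:
  assumes t: "0 < t" "t \<le> 1" and "expanding t"
  shows "\<exists>\<kappa>'>0. \<forall>\<kappa>>0. \<forall>n u l r N. u \<in> Br n \<longrightarrow> L * D * blen u \<le> 1/2 \<longrightarrow> (\<forall>i. l i < r i) \<longrightarrow>
    touching_sum l r t (blo u) (bhi u) < ennreal (\<kappa>' * blen u powr t) \<longrightarrow>
    (\<exists>c d k. N \<le> k \<and> c < d \<and> blo u \<le> c \<and> d \<le> bhi u \<and> {c..d} \<subseteq> E k \<and>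
      touching_sum l r t c d < ennreal (\<kappa> * (d - c) powr t))"
proof -
  obtain m F \<theta> where m: "0 < m" and F: "finite F" "F \<subseteq> Br m"
    "disjoint_family_on (\<lambda>w. {blo w<..<bhi w}) F"
    and \<theta>: "\<And>w. w \<in> F \<Longrightarrow> 0 < \<theta> w"
      "\<And>w y. w \<in> F \<Longrightarrow> y \<in> {0<..<1} \<Longrightarrow> \<theta> w \<le> exp (- t * birk m (w y))"
    and sum: "6 * D \<le> (\<Sum>w\<in>F. blen w powr t * \<theta> w)"
    using \<open>expanding t\<close> unfolding expanding_def by blast
  have "F \<noteq> {}" using sum D by auto
  define l0 where "l0 = Min (blen ` F) / D"
  have "Min (blen ` F) \<in> blen ` F" using F \<open>F \<noteq> {}\<close> by (intro Min_in) auto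
  then have l0: "0 < l0" using blen_pos F D by (auto simp: l0_def)
  have l0': "D * l0 \<le> blen w" if "w \<in> F" for w
    using D F that by (simp add: l0_def)
  define K where "K = l0 powr - t"
  have K: "K > 0" using l0 by (simp add: K_def)
  have "\<exists>c d k. N \<le> k \<and> c < d \<and> blo u \<le> c \<and> d \<le> bhi u \<and> {c..d} \<subseteq> E k \<and>
      touching_sum l r t c d < ennreal (\<kappa> * (d - c) powr t)"
    if \<kappa>: "\<kappa> > 0" and u: "u \<in> Br n" and us: "L * D * blen u \<le> 1/2" and lr: "\<And>i. l i < r i"
      and lt: "touching_sum l r t (blo u) (bhi u) < ennreal (1 / (2 * K) * blen u powr t)"
    for \<kappa> u n l r N
  proof -
    \<comment> \<open>A crude bound that grows with the order n of u; the depth j is chosen after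
      it.\<close>
    define A where "A = exp (t * (real n * M))"
    define R where "R = (4 * D) powr t"
    define b where "b = blen u powr t"
    have b: "b > 0" using blen_pos[OF u] by (simp add: b_def)
    have RA: "R * A \<ge> 0" by (simp add: R_def A_def)
    have A: "exp (t * birk n (u y)) \<le> A" if "y \<in> {0<..<1}" for y
      using birk_le[OF u that] t by (simp add: A_def)
    have "(\<lambda>j. R * A * (1/2)^j) \<longlonglongrightarrow> R * A * 0" by (intro tendsto_intros LIMSEQ_realpow_zero) auto
    \<comment> \<open>The bound K makes the constant of the ball estimate equal to K; the bound
      \<kappa> K / 3 makes the other term 3 e / \<kappa> at most K.\<close>
    then have "eventually (\<lambda>j. R * A * (1/2)^j < min K (\<kappa> * K / 3)) sequentially"
      using K \<kappa> by (intro order_tendstoD) auto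
    then have "eventually (\<lambda>j. R * A * (1/2)^j < min K (\<kappa> * K / 3) \<and> N \<le> j) sequentially"
      using eventually_ge_at_top by (rule eventually_conj)
    then obtain j where "R * A * (1/2)^j < min K (\<kappa> * K / 3)" and j: "N \<le> j"
      using eventually_happens trivial_limit_sequentially by blast
    then have e: "R * A / 2 ^ j \<le> K" "R * A / 2 ^ j \<le> \<kappa> * K / 3" by (auto simp: power_divide)
    define e where "e = R * A / 2 ^ j"
    have e0: "0 \<le> e" using RA by (simp add: e_def)
    define X where "X V p \<longleftrightarrow> finite V \<and>
      (\<forall>J\<in>V. fst J < snd J \<and> {fst J..snd J} \<subseteq> E (n + m * j) \<inter> u ` {0<..<1}) \<and>
      disjoint_family_on (\<lambda>J. {fst J<..<snd J}) V \<and>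
      (\<forall>J. 0 \<le> p J) \<and> (\<forall>J. J \<notin> V \<longrightarrow> p J = 0) \<and> sum p V = 1 \<and>
      (\<forall>J\<in>V. p J * b \<le> e * (snd J - fst J) powr t) \<and>
      (\<forall>x y. x < y \<longrightarrow>
        (\<Sum>J\<in>{J \<in> V. x < snd J \<and> fst J < y \<and> snd J - fst J \<le> y - x}. p J) * b
          \<le> max K e * (y - x) powr t)"
      for V and p :: "real \<times> real \<Rightarrow> real"
    have "\<exists>V p. X V p"
      unfolding X_def K_def e_def R_def b_def
      by (rule mass_distribution[OF t F \<theta> sum l0 l0' u us A])
    then obtain V p where X: "X V p" by blast
    have V: "finite V"
      "J \<in> V \<Longrightarrow> fst J < snd J \<and> {fst J..snd J} \<subseteq> E (n + m * j) \<inter> u ` {0<..<1}"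
      "disjoint_family_on (\<lambda>J. {fst J<..<snd J}) V"
      "0 \<le> p J" "sum p V = 1"
      "J \<in> V \<Longrightarrow> p J * b \<le> e * (snd J - fst J) powr t"
      "x < y \<Longrightarrow>
        (\<Sum>J\<in>{J \<in> V. x < snd J \<and> fst J < y \<and> snd J - fst J \<le> y - x}. p J) * b \<le> max K e * (y - x) powr t" for J x y
      using X unfolding X_def by blast+
    have Vin: "blo u \<le> fst J \<and> snd J \<le> bhi u" if J: "J \<in> V" for J
    proof -
      have "fst J \<in> {blo u<..<bhi u}" "snd J \<in> {blo u<..<bhi u}"
        using V(2)[OF J] unfolding br_image[OF u] by (auto simp del: greaterThanLessThan_iff)
      then show ?thesis by auto
    qed
    have "N \<le> n + m * j" using j m by (cases m) auto
    show ?thesis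
    proof (rule ccontr)
      assume neg: "\<not> ?thesis"
      have big: "ennreal (\<kappa> * (snd J - fst J) powr t) \<le> touching_sum l r t (fst J) (snd J)" if J: "J \<in> V" for J
        using neg \<open>N \<le> n + m * j\<close> V(2)[OF J] Vin[OF J] by (meson le_inf_iff not_le)
      have "ennreal (\<Sum>J\<in>V. p J) \<le> ennreal (K / b + 3 * (e / b) / \<kappa>) * touching_sum l r t (blo u) (bhi u)"
      proof (rule sum_le_touching_sum[OF V(1)])
        show "p J \<le> e / b * (snd J - fst J) powr t" if "J \<in> V" for J
          using V(6)[OF that] b by (simp add: field_simps)
        show "(\<Sum>J\<in>{J \<in> V. l i < snd J \<and> fst J < r i \<and> snd J - fst J \<le> r i - l i}. p J) \<le> K / b * (r i - l i) powr t" for i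
          using V(7)[OF lr[of i]] e(1) b unfolding e_def[symmetric] by (simp add: field_simps max_def split: if_splits)
      qed (use V Vin lr \<kappa> K b e0 big in auto)
      also have "\<dots> \<le> ennreal (2 * K / b) * touching_sum l r t (blo u) (bhi u)"
      proof (rule mult_right_mono[OF ennreal_leI])
        have "3 * (e / b) / \<kappa> \<le> 3 * (\<kappa> * K / 3 / b) / \<kappa>"
          using e(2) b \<kappa> unfolding e_def[symmetric] by (intro divide_right_mono mult_left_mono) auto
        also have "\<dots> = K / b" using \<kappa> by simp
        finally show "K / b + 3 * (e / b) / \<kappa> \<le> 2 * K / b" by simp
      qed simp
      finally have 1: "1 \<le> ennreal (2 * K / b) * touching_sum l r t (blo u) (bhi u)" using V(5) by simp
      obtain x where x: "touching_sum l r t (blo u) (bhi u) = ennreal x" "0 \<le> x"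
        using lt by (metis ennreal_cases not_less_iff_gr_or_eq top.not_eq_extremum ennreal_less_top)
      have "x < 1 / (2 * K) * b" using lt x by (simp add: b_def ennreal_less_iff)
      moreover have "1 \<le> 2 * K / b * x"
        using 1 x K b by (simp add: ennreal_mult[symmetric] flip: ennreal_1)
      ultimately show False using K b by (simp add: field_simps)
    qed
  qed
  then show ?thesis using K by (intro exI[of _ "1 / (2 * K)"]) auto
qed

text \<open>The mass is now Lebesgue measure on disjoint branches filling a proportion \<alpha> of
  the interval, and x \<le> (b - a)^(1 - t) x^t for x \<le> b - a turns lengths into t-weights. If
  all branches had large touching sums, \<open>sum_le_touching_sum\<close> would make the touching
  sum of the whole interval too large.\<close>

lemma interval_to_branch:
  assumes t: "0 < t" "t \<le> 1" and \<kappa>': "0 < \<kappa>'"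
  shows "\<exists>\<kappa>>0. \<kappa> \<le> 1 \<and> (\<forall>a b l r \<epsilon>. 0 \<le> a \<longrightarrow> a < b \<longrightarrow> b \<le> 1 \<longrightarrow> 0 < \<epsilon> \<longrightarrow> (\<forall>i. l i < r i) \<longrightarrow>
    touching_sum l r t a b < ennreal (\<kappa> * (b - a) powr t) \<longrightarrow>
    (\<exists>n. \<exists>u\<in>Br n. a \<le> blo u \<and> bhi u \<le> b \<and> blen u < \<epsilon> \<and>
      touching_sum l r t (blo u) (bhi u) < ennreal (\<kappa>' * blen u powr t)))"
proof -
  \<comment> \<open>The two contributions in \<open>sum_le_touching_sum\<close>: 3 from branches no
    longer than a covering interval, 3 / \<kappa>' from longer ones.\<close>
  define c where "c = 3 + 3 / \<kappa>'"
  have c: "c > 0" using \<kappa>' by (simp add: c_def add_pos_pos)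
  define \<kappa> where "\<kappa> = min 1 (\<alpha> / c)"
  have \<kappa>: "0 < \<kappa>" "\<kappa> \<le> 1" "c * \<kappa> \<le> \<alpha>"
    using c \<alpha> by (auto simp: \<kappa>_def min_def field_simps)
  have "\<exists>n. \<exists>u\<in>Br n. a \<le> blo u \<and> bhi u \<le> b \<and> blen u < \<epsilon> \<and>
      touching_sum l r t (blo u) (bhi u) < ennreal (\<kappa>' * blen u powr t)"
    if ab: "0 \<le> a" "a < b" "b \<le> 1" and \<epsilon>: "0 < \<epsilon>" and lr: "\<And>i. l i < r i"
      and lt: "touching_sum l r t a b < ennreal (\<kappa> * (b - a) powr t)" for a b l r \<epsilon>
  proof (rule ccontr)
    assume neg: "\<not> ?thesis"
    obtain U where U: "finite U" "U \<subseteq> (\<Union>n. Br n)" "disjoint_family_on (\<lambda>\<psi>. {blo \<psi><..<bhi \<psi>}) U"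
      "\<And>\<psi>. \<psi> \<in> U \<Longrightarrow> a \<le> blo \<psi> \<and> bhi \<psi> \<le> b \<and> blen \<psi> < \<epsilon>" "\<alpha> * (b - a) \<le> (\<Sum>\<psi>\<in>U. blen \<psi>)"
      using br_cover[OF ab \<epsilon>] by blast
    have Upos: "0 < blen u" if "u \<in> U" for u using U(2) that blen_pos by blast
    define w where "w = (b - a) powr (1 - t)"
    have w: "w > 0" using ab by (simp add: w_def)
    have split: "x \<le> w * x powr t" if "0 < x" "x \<le> b - a" for x
    proof -
      have "x = x powr (1 - t) * x powr t" using that by (simp add: powr_add[symmetric])
      also have "\<dots> \<le> w * x powr t"
        unfolding w_def using that t by (intro mult_right_mono powr_mono2) auto
      finally show ?thesis .
    qed
    obtain x where x: "touching_sum l r t a b = ennreal x" "0 \<le> x"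
      using lt by (metis ennreal_cases not_less_iff_gr_or_eq top.not_eq_extremum ennreal_less_top)
    have xlt: "x < \<kappa> * (b - a) powr t" using lt x by (simp add: ennreal_less_iff)
    \<comment> \<open>As \<kappa> \<le> 1, one longer covering interval would already reach the
      assumed bound.\<close>
    have short: "r i - l i \<le> b - a" if "l i < b" "a < r i" for i
    proof (rule ccontr)
      assume "\<not> ?thesis"
      then have "(b - a) powr t \<le> (r i - l i) powr t" using ab t by (intro powr_mono2) auto
      moreover have "ennreal ((r i - l i) powr t) \<le> touching_sum l r t a b"
        using that by (rule touching_sum_ge)
      then have "(r i - l i) powr t \<le> x" using x by simp
      moreover have "\<kappa> * (b - a) powr t \<le> 1 * (b - a) powr t" using \<kappa> by (intro mult_right_mono) auto
      ultimately show False using xlt by linarith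
    qed
    have "ennreal (\<Sum>u\<in>U. blen u) \<le> ennreal (3 * w + 3 * w / \<kappa>') * touching_sum l r t a b"
    proof (rule sum_le_touching_sum[OF U(1)])
      show "blo u < bhi u" if "u \<in> U" for u using Upos[OF that] by (simp flip: bhi_minus_blo)
      show "ennreal (\<kappa>' * (bhi u - blo u) powr t) \<le> touching_sum l r t (blo u) (bhi u)" if "u \<in> U" for u
        using neg U(2) U(4)[OF that] that unfolding bhi_minus_blo by (meson UN_E not_le subsetD)
      show "blen u \<le> w * (bhi u - blo u) powr t" if "u \<in> U" for u
        unfolding bhi_minus_blo using U(4)[OF that] Upos[OF that]
        by (intro split) (auto simp flip: bhi_minus_blo)
      fix i assume i: "l i < b" "a < r i"
      let ?T = "{u \<in> U. l i < bhi u \<and> blo u < r i \<and> bhi u - blo u \<le> r i - l i}"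
      have "(\<Sum>u\<in>?T. blen u) = (\<Sum>u\<in>?T. min (bhi u - blo u) (r i - l i))"
        by (intro sum.cong) (auto simp: bhi_minus_blo)
      also have "\<dots> \<le> (\<Sum>u\<in>{u \<in> U. l i < bhi u \<and> blo u < r i}. min (bhi u - blo u) (r i - l i))"
        using U(1) Upos lr[of i] by (intro sum_mono2) (auto simp: bhi_minus_blo less_imp_le)
      also have "\<dots> \<le> 3 * (r i - l i)"
        using U(1,3) lr Upos by (intro sum_touching_min) (auto simp flip: bhi_minus_blo)
      also have "\<dots> \<le> 3 * (w * (r i - l i) powr t)"
        using lr[of i] short[OF i] by (intro mult_left_mono split) auto
      finally show "(\<Sum>u\<in>?T. blen u) \<le> 3 * w * (r i - l i) powr t" by simp
    qed (use U Upos lr \<kappa>' w in \<open>auto intro: less_imp_le\<close>)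
    also have "3 * w + 3 * w / \<kappa>' = c * w" by (simp add: c_def algebra_simps)
    finally have "(\<Sum>u\<in>U. blen u) \<le> c * w * x"
      using x c w by (simp add: ennreal_mult[symmetric])
    also have "\<dots> < c * w * (\<kappa> * (b - a) powr t)" using xlt c w by simp
    also have "\<dots> = c * \<kappa> * (w * (b - a) powr t)" by simp
    also have "w * (b - a) powr t = b - a" using ab by (simp add: w_def powr_add[symmetric])
    also have "c * \<kappa> * (b - a) \<le> \<alpha> * (b - a)" using \<kappa> ab by (intro mult_right_mono) auto
    finally show False using U(5) by simp
  qed
  then show ?thesis using \<kappa> by (intro exI[of _ \<kappa>]) auto
qed

text \<open>A cover whose touching sum is too small on one interval stays too small along a nested sequence
  of intervals inside the targets; the common point is then not covered, because a covering interval
  would eventually contain an interval of the sequence.\<close>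

lemma limsup_content_bound:
  assumes t: "0 < t" "t \<le> 1" and ex: "expanding t"
    and A: "\<And>x. (\<forall>N. \<exists>n\<ge>N. x \<in> E n) \<Longrightarrow> x \<in> A"
  shows "\<exists>\<kappa>>0. content_bound t \<kappa> A"
proof -
  obtain \<kappa>' where \<kappa>': "\<kappa>' > 0" and B: "\<And>\<kappa> n u l r N. \<kappa> > 0 \<Longrightarrow> u \<in> Br n \<Longrightarrow> L * D * blen u \<le> 1/2 \<Longrightarrow>
    (\<forall>i. l i < r i) \<Longrightarrow> touching_sum l r t (blo u) (bhi u) < ennreal (\<kappa>' * blen u powr t) \<Longrightarrow>
    (\<exists>c d k. N \<le> k \<and> c < d \<and> blo u \<le> c \<and> d \<le> bhi u \<and> {c..d} \<subseteq> E k \<and>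
      touching_sum l r t c d < ennreal (\<kappa> * (d - c) powr t))"
    using branch_to_interval[OF t ex] by metis
  obtain \<kappa> where \<kappa>: "\<kappa> > 0" "\<kappa> \<le> 1" and S: "\<And>a b l r \<epsilon>. 0 \<le> a \<Longrightarrow> a < b \<Longrightarrow> b \<le> 1 \<Longrightarrow> 0 < \<epsilon> \<Longrightarrow>
    (\<forall>i. l i < r i) \<Longrightarrow> touching_sum l r t a b < ennreal (\<kappa> * (b - a) powr t) \<Longrightarrow>
    (\<exists>n. \<exists>u\<in>Br n. a \<le> blo u \<and> bhi u \<le> b \<and> blen u < \<epsilon> \<and>
      touching_sum l r t (blo u) (bhi u) < ennreal (\<kappa>' * blen u powr t))"
    using interval_to_branch[OF t \<kappa>'] by metis
  have "content_bound t \<kappa> A"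
    unfolding content_bound_def
  proof (intro allI impI, rule ccontr)
    fix a b :: real and l r :: "nat \<Rightarrow> real"
    assume ab: "0 \<le> a" "a < b" "b \<le> 1" and lr: "\<forall>i. l i < r i"
      and cov: "A \<inter> {a..b} \<subseteq> (\<Union>i. {l i<..<r i})"
      and neg: "\<not> ennreal (\<kappa> * (b - a) powr t) \<le> touching_sum l r t a b"
    define P where "P x \<longleftrightarrow> 0 \<le> fst x \<and> fst x < snd x \<and> snd x \<le> 1 \<and>
      touching_sum l r t (fst x) (snd x) < ennreal (\<kappa> * (snd x - fst x) powr t)" for x
    define Q where "Q k x y \<longleftrightarrow> fst x \<le> fst y \<and> snd y \<le> snd x \<and> snd y - fst y < 1 / real (Suc k) \<and>
      (\<exists>n\<ge>k. {fst y..snd y} \<subseteq> E n)" for k and x y :: "real \<times> real"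
    have step: "\<exists>y. P y \<and> Q k x y" if x: "P x" for x k
    proof -
      \<comment> \<open>One entry makes the nested intervals shrink to a point, the other yields the
        condition \<open>L * D * blen u \<le> 1/2\<close> under which a branch meets its
        target.\<close>
      define \<epsilon> where "\<epsilon> = min (1 / real (Suc k)) (1 / (2 * (L * D + 1)))"
      have LD: "L * D \<ge> 0" using L_nonneg D by simp
      then have \<epsilon>: "\<epsilon> > 0" by (simp add: \<epsilon>_def)
      obtain n u where u: "u \<in> Br n" "fst x \<le> blo u" "bhi u \<le> snd x" "blen u < \<epsilon>"
        "touching_sum l r t (blo u) (bhi u) < ennreal (\<kappa>' * blen u powr t)"
        using S[of "fst x" "snd x" \<epsilon> l r] x lr \<epsilon> unfolding P_def by blast
      have "L * D * blen u \<le> L * D * (1 / (2 * (L * D + 1)))"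
        using u(4) LD by (intro mult_left_mono) (auto simp: \<epsilon>_def)
      also have "\<dots> \<le> 1/2" using LD by (simp add: field_simps)
      finally have us: "L * D * blen u \<le> 1/2" .
      obtain c d j where c: "k \<le> j" "c < d" "blo u \<le> c" "d \<le> bhi u" "{c..d} \<subseteq> E j"
        "touching_sum l r t c d < ennreal (\<kappa> * (d - c) powr t)"
        using B[OF \<kappa>(1) u(1) us lr u(5), of k] by blast
      have "d - c < 1 / real (Suc k)" using c u bhi_minus_blo[of u] by (simp add: \<epsilon>_def)
      then have "P (c, d)" "Q k x (c, d)" using x c u by (auto simp: P_def Q_def)
      then show ?thesis by blast
    qed
    have "\<exists>I. \<forall>k. (P (I k) \<and> (k = 0 \<longrightarrow> I k = (a, b))) \<and> Q k (I k) (I (Suc k))"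
    proof (rule dependent_nat_choice)
      show "\<exists>x. P x \<and> (0 = 0 \<longrightarrow> x = (a, b))"
        using ab neg by (intro exI[of _ "(a, b)"]) (auto simp: P_def)
      show "\<exists>y. (P y \<and> (Suc n = 0 \<longrightarrow> y = (a, b))) \<and> Q n x y" if "P x \<and> (n = 0 \<longrightarrow> x = (a, b))" for x n
        using step[of x n] that by auto
    qed
    then obtain I where I: "\<And>k. P (I k)" "I 0 = (a, b)" "\<And>k. Q k (I k) (I (Suc k))" by metis
    have d0: "(\<lambda>k. fst (I k) - snd (I k)) \<longlonglongrightarrow> 0"
    proof (rule LIMSEQ_imp_Suc, rule tendsto_sandwich)
      show "\<forall>\<^sub>F k in sequentially. - (1 / real (Suc k)) \<le> fst (I (Suc k)) - snd (I (Suc k))"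
      proof (intro always_eventually allI)
        show "- (1 / real (Suc k)) \<le> fst (I (Suc k)) - snd (I (Suc k))" for k
          using I(3)[of k] by (simp add: Q_def)
      qed
      show "\<forall>\<^sub>F k in sequentially. fst (I (Suc k)) - snd (I (Suc k)) \<le> 0"
      proof (intro always_eventually allI)
        show "fst (I (Suc k)) - snd (I (Suc k)) \<le> 0" for k
          using I(1)[of "Suc k"] by (simp add: P_def)
      qed
      show "(\<lambda>k. - (1 / real (Suc k))) \<longlonglongrightarrow> 0"
        using tendsto_minus[OF LIMSEQ_inverse_real_of_nat] by (simp add: inverse_eq_divide)
    qed simp
    have "\<exists>x. ((\<forall>n. fst (I n) \<le> x) \<and> (\<lambda>n. fst (I n)) \<longlonglongrightarrow> x) \<and> ((\<forall>n. x \<le> snd (I n)) \<and> (\<lambda>n. snd (I n)) \<longlonglongrightarrow> x)"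
      using I d0 by (intro nested_sequence_unique) (auto simp: P_def Q_def less_imp_le)
    then obtain x where x: "\<And>n. fst (I n) \<le> x" "\<And>n. x \<le> snd (I n)"
      "(\<lambda>n. fst (I n)) \<longlonglongrightarrow> x" "(\<lambda>n. snd (I n)) \<longlonglongrightarrow> x" by blast
    have "x \<in> A"
    proof (rule A, rule allI)
      fix N
      show "\<exists>n\<ge>N. x \<in> E n" using I(3)[of N] x(1,2)[of "Suc N"] by (auto simp: Q_def)
    qed
    moreover have "x \<in> {a..b}" using x(1,2)[of 0] I(2) by simp
    ultimately obtain i where i: "l i < x" "x < r i" using cov by fastforce
    have "\<forall>\<^sub>F n in sequentially. l i < fst (I n) \<and> snd (I n) < r i"
      using x(3,4) i by (intro eventually_conj order_tendstoD)
    then obtain n where n: "l i < fst (I n)" "snd (I n) < r i"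
      using eventually_happens trivial_limit_sequentially by blast
    have Pn: "fst (I n) < snd (I n)"
      "touching_sum l r t (fst (I n)) (snd (I n)) < ennreal (\<kappa> * (snd (I n) - fst (I n)) powr t)"
      using I(1)[of n] by (auto simp: P_def)
    have "\<kappa> * (snd (I n) - fst (I n)) powr t \<le> 1 * (r i - l i) powr t"
      using \<kappa> n Pn t by (intro mult_mono powr_mono2) auto
    then have "ennreal (\<kappa> * (snd (I n) - fst (I n)) powr t) \<le> ennreal ((r i - l i) powr t)"
      by (intro ennreal_leI) simp
    also have "\<dots> \<le> touching_sum l r t (fst (I n)) (snd (I n))"
      using n Pn by (intro touching_sum_ge) auto
    finally show False using Pn(2) by simp
  qed
  then show ?thesis using \<kappa> by blast
qed

end

section \<open>Full cylinders of the beta map\<close>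

text \<open>By countable subadditivity of Lebesgue measure, finite partial sums all below (b - a) /
  2 would make b - a at most its half. Z allows for countably many uncovered points, such as the
  rationals in the Gauss coding.\<close>

lemma countable_cover_finite_sum:
  fixes c e :: "'i \<Rightarrow> real" and X :: "'i \<Rightarrow> real set"
  assumes ab: "a < b" and S: "countable S" and Z: "countable Z"
    and cov: "{a..b} - Z \<subseteq> (\<Union>s\<in>S. X s)"
    and X: "\<And>s. s \<in> S \<Longrightarrow> X s \<subseteq> {c s..c s + e s}" and e: "\<And>s. s \<in> S \<Longrightarrow> 0 \<le> e s"
  shows "\<exists>F. finite F \<and> F \<subseteq> S \<and> (b - a) / 2 \<le> (\<Sum>s\<in>F. e s)"
proof (rule ccontr)
  assume neg: "\<not> ?thesis"
  define N where "N = to_nat_on S"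
  have inj: "inj_on N S" unfolding N_def using S by (rule inj_on_to_nat_on)
  define g where "g i = (\<Union>s\<in>{s \<in> S. N s = i}. {c s..c s + e s})" for i
  define G where "G i = (\<Sum>s\<in>{s \<in> S. N s = i}. e s)" for i
  have one: "\<exists>s. {s \<in> S. N s = i} \<subseteq> {s}" for i
    using inj by (cases "\<exists>s\<in>S. N s = i") (auto simp: inj_on_def)
  have fin: "finite {s \<in> S. N s = i}" for i
    using one[of i] finite_subset by blast
  have g: "g i \<in> sets lborel" "emeasure lborel (g i) = ennreal (G i)" for i
  proof -
    have "g i \<in> sets lborel \<and> emeasure lborel (g i) = ennreal (G i)"
    proof (cases "{s \<in> S. N s = i} = {}")
      case True
      then show ?thesis unfolding g_def G_def True by simp
    next
      case False
      then obtain s where s: "{s \<in> S. N s = i} = {s}" using one[of i] by (meson subset_singletonD)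
      then have "0 \<le> e s" using e by blast
      then show ?thesis unfolding g_def G_def s by simp
    qed
    then show "g i \<in> sets lborel" "emeasure lborel (g i) = ennreal (G i)" by auto
  qed
  have Zs: "Z \<in> sets lborel" using countable_imp_null_set_lborel[OF Z] by (rule null_setsD2)
  have "ennreal (b - a) = emeasure lborel {a..b}" using ab by simp
  also have "\<dots> \<le> emeasure lborel (Z \<union> (\<Union>i. g i))"
  proof (rule emeasure_mono)
    show "{a..b} \<subseteq> Z \<union> (\<Union>i. g i)"
    proof
      fix x assume "x \<in> {a..b}"
      then show "x \<in> Z \<union> (\<Union>i. g i)" using cov X by (cases "x \<in> Z") (fastforce simp: g_def)+
    qed
    show "Z \<union> (\<Union>i. g i) \<in> sets lborel" using g Zs by (intro sets.Un sets.countable_UN) auto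
  qed
  also have "\<dots> \<le> emeasure lborel Z + emeasure lborel (\<Union>i. g i)"
    using Zs g by (intro emeasure_subadditive sets.countable_UN) auto
  also have "emeasure lborel Z = 0" using Z by (rule emeasure_lborel_countable)
  also have "emeasure lborel (\<Union>i. g i) \<le> (\<Sum>i. ennreal (G i))"
    using emeasure_subadditive_countably[of g lborel] g by auto
  also have "\<dots> \<le> ennreal ((b - a) / 2)"
  proof (rule suminf_le_const)
    fix n
    let ?F = "{s \<in> S. N s < n}"
    have F: "finite ?F" using inj_on_subset[OF inj, of ?F] by (rule finite_imageD[rotated]) (auto intro: finite_subset[of _ "{..<n}"])
    have "(\<Sum>i<n. ennreal (G i)) = ennreal (\<Sum>i<n. G i)"
      using e by (intro sum_ennreal) (auto simp: G_def intro!: sum_nonneg)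
    also have "(\<Sum>i<n. G i) = (\<Sum>s\<in>?F. e s)"
    proof -
      have "(\<Sum>i<n. G i) = (\<Sum>i<n. \<Sum>s\<in>{s \<in> ?F. N s = i}. e s)"
        unfolding G_def by (intro sum.cong) auto
      also have "\<dots> = (\<Sum>s\<in>?F. e s)" using F by (intro sum.group) auto
      finally show ?thesis .
    qed
    also have "\<dots> \<le> (b - a) / 2" using neg F by (metis (no_types, lifting) less_eq_real_def mem_Collect_eq not_le subsetI)
    finally show "(\<Sum>i<n. ennreal (G i)) \<le> ennreal ((b - a) / 2)" by (simp add: ennreal_leI)
  qed auto
  finally have "ennreal (b - a) \<le> ennreal ((b - a) / 2)" by simp
  then show False using ab by (simp add: ennreal_le_iff)
qed

lemma cylinder_snoc:
  "x \<in> cylinder T (w @ [j]) \<longleftrightarrow> x \<in> cylinder T w \<and> digit T ((imap T ^^ length w) x) = j"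
  by (auto simp: cylinder_def nth_append less_Suc_eq)

lemma cylinder_disjoint:
  assumes "length w = length w'" "x \<in> cylinder T w" "x \<in> cylinder T w'"
  shows "w = w'"
  using assms by (intro nth_equalityI) (auto simp: cylinder_def)

fun full_words :: "interval_map \<Rightarrow> nat \<Rightarrow> int list set" where
  "full_words (Beta b) n = {w \<in> words (Beta b) n. \<exists>x0. \<forall>y\<in>{0..<1}. x0 + y / b ^ n \<in> cylinder (Beta b) w \<and>
     (imap (Beta b) ^^ n) (x0 + y / b ^ n) = y}"
| "full_words Gauss n = words Gauss n"

text \<open>No word is attached to a branch, so compositions need no discussion of admissible
  concatenations, and a branch may fill just the left part of a cylinder. The orbit identity is
  imposed on \<open>{0..<1}\<close> because iterates never take the value 1.\<close>

definition beta_branches :: "real \<Rightarrow> nat \<Rightarrow> (real \<Rightarrow> real) set" where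
  "beta_branches b n = {\<psi>. \<exists>x0\<ge>0. x0 + 1 / b ^ n \<le> 1 \<and> \<psi> = (\<lambda>y. x0 + y / b ^ n) \<and>
     (\<forall>y\<in>{0..<1}. (imap (Beta b) ^^ n) (\<psi> y) = y)}"

text \<open>The value of the finite expansion w; for an admissible word it is the left end point of
  the cylinder, by \<open>beta_cylinder_below\<close> with z = 0.\<close>

definition beta_base :: "real \<Rightarrow> int list \<Rightarrow> real" where
  "beta_base b w = (\<Sum>k<length w. of_int (w ! k) / b ^ Suc k)"

declare imap.simps [simp del] digit.simps [simp del]

context
  fixes b :: real
  assumes b: "b > 1"
begin

lemma imap_Beta: "imap (Beta b) x = frac (b * x)"
  by (simp add: imap.simps)

lemma digit_Beta: "digit (Beta b) x = \<lfloor>b * x\<rfloor>"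
  by (simp add: digit.simps)

lemma imap_Beta_power:
  assumes "0 \<le> y" "y < 1"
  shows "(imap (Beta b) ^^ j) (y / b ^ j) = y"
proof (induction j)
  case (Suc j)
  have "b * (y / b ^ Suc j) = y / b ^ j" using b by simp
  moreover have "y / b ^ j < 1"
    using less_le_trans[OF assms(2) one_le_power[of b j]] b by (simp add: divide_less_eq)
  then have "frac (y / b ^ j) = y / b ^ j" using assms b by (simp add: frac_eq)
  ultimately show ?case using Suc imap_Beta[of "y / b ^ Suc j"]
    by (simp add: funpow_Suc_right del: funpow.simps power_Suc)
qed (use assms in simp)

lemma beta_base_snoc: "beta_base b (w @ [j]) = beta_base b w + of_int j / b ^ Suc (length w)"
  unfolding beta_base_def by (auto simp: nth_append intro!: sum.cong)

lemma beta_orbit: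
  "x \<in> cylinder (Beta b) w \<Longrightarrow> (imap (Beta b) ^^ length w) x = b ^ length w * (x - beta_base b w)"
proof (induction w rule: rev_induct)
  case Nil
  then show ?case by (simp add: beta_base_def)
next
  case (snoc j w)
  define z where "z = (imap (Beta b) ^^ length w) x"
  have z: "z = b ^ length w * (x - beta_base b w)" "\<lfloor>b * z\<rfloor> = j"
    using snoc by (auto simp: cylinder_snoc z_def digit_Beta)
  have "(imap (Beta b) ^^ length (w @ [j])) x = b * z - of_int j"
    using z(2) imap_Beta[of z] by (simp add: z_def[symmetric] frac_def)
  also have "\<dots> = b ^ length (w @ [j]) * (x - beta_base b (w @ [j]))"
    unfolding z(1) beta_base_snoc using b by (simp add: field_simps)
  finally show ?case .
qed

lemma beta_orbit_range:
  assumes "x \<in> {0..<1}" shows "(imap (Beta b) ^^ n) x \<in> {0..<1}"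
  using assms by (cases n) (auto simp: frac_lt_1 imap_Beta)

text \<open>The image of a cylinder under its iterate is closed downwards in [0,1), so the cylinder
  is an interval containing its left end point. In the induction, a value z after the last digit j
  comes from (j + z) / b, which is nonnegative because digits are, and not above the orbit point of
  x.\<close>

lemma beta_cylinder_below:
  "x \<in> cylinder (Beta b) w \<Longrightarrow> 0 \<le> z \<Longrightarrow> z \<le> (imap (Beta b) ^^ length w) x \<Longrightarrow>
    beta_base b w + z / b ^ length w \<in> cylinder (Beta b) w \<and>
    (imap (Beta b) ^^ length w) (beta_base b w + z / b ^ length w) = z"
proof (induction w arbitrary: z rule: rev_induct)
  case Nil
  then show ?case by (auto simp: cylinder_def beta_base_def)
next
  case (snoc j w)
  let ?n = "length w"
  define t where "t = (imap (Beta b) ^^ ?n) x"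
  have x: "x \<in> cylinder (Beta b) w" "\<lfloor>b * t\<rfloor> = j" using snoc.prems(1) by (auto simp: cylinder_snoc t_def digit_Beta)
  have z: "0 \<le> z" "z \<le> b * t - of_int j"
    using snoc.prems x(2) imap_Beta[of t] by (auto simp: t_def[symmetric] frac_def)
  have z1: "z < 1" using z x(2) by linarith
  have "t \<in> {0..<1}" unfolding t_def using x(1) by (intro beta_orbit_range) (auto simp: cylinder_def)
  then have "b * t \<ge> 0" using b by simp
  then have j0: "0 \<le> j" using x(2) by linarith
  define z' where "z' = (of_int j + z) / b"
  have z': "0 \<le> z'" "z' \<le> t" using z j0 b by (auto simp: z'_def field_simps)
  have IH: "beta_base b w + z' / b ^ ?n \<in> cylinder (Beta b) w"
    "(imap (Beta b) ^^ ?n) (beta_base b w + z' / b ^ ?n) = z'"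
    using snoc.IH[OF x(1) z'(1)] z'(2) by (auto simp: t_def)
  have eq: "beta_base b (w @ [j]) + z / b ^ length (w @ [j]) = beta_base b w + z' / b ^ ?n"
    using b by (simp add: beta_base_snoc z'_def add_divide_distrib)
  have bz: "b * z' = of_int j + z" using b by (simp add: z'_def)
  have fl: "\<lfloor>b * z'\<rfloor> = j" unfolding bz using z(1) z1 by linarith
  show ?case unfolding eq using IH fl bz imap_Beta[of z'] digit_Beta[of z'] by (simp add: cylinder_snoc frac_def)
qed

lemma beta_branch_comp:
  assumes "\<psi> \<in> beta_branches b n" "\<phi> \<in> beta_branches b m"
  shows "\<psi> \<circ> \<phi> \<in> beta_branches b (n + m)"
proof -
  obtain x0 where x0: "x0 \<ge> 0" "x0 + 1 / b ^ n \<le> 1" "\<psi> = (\<lambda>y. x0 + y / b ^ n)"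
    "\<And>y. y \<in> {0..<1} \<Longrightarrow> (imap (Beta b) ^^ n) (\<psi> y) = y"
    using assms(1) by (auto simp: beta_branches_def)
  obtain x1 where x1: "x1 \<ge> 0" "x1 + 1 / b ^ m \<le> 1" "\<phi> = (\<lambda>y. x1 + y / b ^ m)"
    "\<And>y. y \<in> {0..<1} \<Longrightarrow> (imap (Beta b) ^^ m) (\<phi> y) = y"
    using assms(2) by (auto simp: beta_branches_def)
  have eq: "\<psi> \<circ> \<phi> = (\<lambda>y. (x0 + x1 / b ^ n) + y / b ^ (n + m))"
    using b by (auto simp: x0(3) x1(3) power_add add_divide_distrib)
  have "x0 + x1 / b ^ n + 1 / b ^ (n + m) = x0 + (x1 + 1 / b ^ m) / b ^ n"
    using b by (simp add: power_add add_divide_distrib)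
  also have "\<dots> \<le> x0 + 1 / b ^ n" using b x1 by (intro add_left_mono divide_right_mono) auto
  also have "\<dots> \<le> 1" by (rule x0(2))
  finally have 1: "x0 + x1 / b ^ n + 1 / b ^ (n + m) \<le> 1" .
  have "(imap (Beta b) ^^ (n + m)) ((\<psi> \<circ> \<phi>) y) = y" if y: "y \<in> {0..<1}" for y
  proof -
    have "y / b ^ m < 1 / b ^ m" using y b by (intro divide_strict_right_mono) auto
    then have "\<phi> y \<in> {0..<1}" using x1(1,2) y b by (auto simp: x1(3))
    then show ?thesis using x0(4)[of "\<phi> y"] x1(4)[OF y]
      by (simp add: add.commute[of n] funpow_add)
  qed
  then show ?thesis unfolding beta_branches_def
    using x0(1) x1(1) b 1 eq by (intro CollectI exI[of _ "x0 + x1 / b ^ n"]) auto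
qed

lemma beta_branch_blen:
  assumes "\<psi> \<in> beta_branches b n"
  shows "blen \<psi> = 1 / b ^ n" "blo \<psi> = \<psi> 0" "bhi \<psi> = \<psi> 0 + 1 / b ^ n"
  using assms b by (auto simp: beta_branches_def blen_def blo_def bhi_def)

text \<open>Appending j zeros to w selects the left part of the cylinder, whose image under the
  iterate is an interval of length b^-j at 0. The least j with b^-j \<le> z, where z is the orbit
  point of x, makes that part full and loses at most a factor b against the part to the left of
  x.\<close>

lemma beta_branch_of_cylinder:
  assumes x: "x \<in> cylinder (Beta b) w" and z: "0 < (imap (Beta b) ^^ length w) x"
  shows "\<exists>n. \<exists>\<psi>\<in>beta_branches b n. \<psi> 0 = beta_base b w \<and> {blo \<psi><..<bhi \<psi>} \<subseteq> cylinder (Beta b) w \<and>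
    blen \<psi> \<le> 1 / b ^ length w \<and>
    (imap (Beta b) ^^ length w) x / b ^ length w / b \<le> blen \<psi>"
proof -
  let ?k = "length w"
  define z where "z = (imap (Beta b) ^^ ?k) x"
  have z01: "0 < z" "z < 1"
    using z x beta_orbit_range[of x ?k] by (auto simp: z_def cylinder_def)
  have "\<exists>j. (1 / b) ^ j < z" using z01 b by (intro real_arch_pow_inv) auto
  then have ex: "\<exists>j. 1 / b ^ j \<le> z" by (auto simp: power_divide intro: less_imp_le)
  define j where "j = (LEAST j. 1 / b ^ j \<le> z)"
  have j: "1 / b ^ j \<le> z" unfolding j_def using ex by (rule LeastI_ex)
  then have "j \<noteq> 0" using z01 by (intro notI) simp
  then obtain i where i: "j = Suc i" by (cases j) auto
  have "\<not> 1 / b ^ i \<le> z" using not_less_Least[of i "\<lambda>j. 1 / b ^ j \<le> z"] i by (simp add: j_def)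
  then have "z / b \<le> 1 / b ^ i / b" using b by (intro divide_right_mono) auto
  then have jz: "z / b \<le> 1 / b ^ j" using i by (simp add: mult.commute)
  let ?x0 = "beta_base b w"
  define \<psi> where "\<psi> = (\<lambda>y. ?x0 + y / b ^ (?k + j))"
  have y: "?x0 + y / b ^ (?k + j) \<in> cylinder (Beta b) w \<and>
      (imap (Beta b) ^^ ?k) (?x0 + y / b ^ (?k + j)) = y / b ^ j" if "y \<in> {0..1}" for y
  proof -
    have "y / b ^ j \<le> 1 / b ^ j" using that b by (intro divide_right_mono) auto
    then have "y / b ^ j \<le> z" using j by simp
    then show ?thesis using beta_cylinder_below[OF x, of "y / b ^ j"] that b
      by (simp add: z_def power_add mult.commute)
  qed
  have "\<psi> \<in> beta_branches b (?k + j)"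
    unfolding beta_branches_def
  proof (intro CollectI exI[of _ ?x0] conjI ballI)
    show "0 \<le> ?x0" using y[of 0] by (simp add: cylinder_def)
    show "?x0 + 1 / b ^ (?k + j) \<le> 1" using y[of 1] by (simp add: cylinder_def)
    fix u :: real assume u: "u \<in> {0..<1}"
    then show "(imap (Beta b) ^^ (?k + j)) (\<psi> u) = u"
      using y[of u] imap_Beta_power[of u j] by (simp add: \<psi>_def add.commute[of ?k] funpow_add)
  qed (rule \<psi>_def)
  note \<psi> = this
  note len = beta_branch_blen[OF \<psi>]
  have "{blo \<psi><..<bhi \<psi>} \<subseteq> cylinder (Beta b) w"
  proof
    fix u assume u: "u \<in> {blo \<psi><..<bhi \<psi>}"
    define v where "v = (u - ?x0) * b ^ (?k + j)"
    have "u = ?x0 + v / b ^ (?k + j)" using b by (simp add: v_def)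
    moreover have "v \<in> {0..1}" using u b unfolding len by (auto simp: v_def \<psi>_def field_simps)
    ultimately show "u \<in> cylinder (Beta b) w" using y by simp
  qed
  moreover have "blen \<psi> \<le> 1 / b ^ ?k" unfolding len
    using b by (intro divide_left_mono power_increasing) auto
  moreover have "z / b ^ ?k / b \<le> blen \<psi>"
    using divide_right_mono[OF jz, of "b ^ ?k"] b unfolding len by (simp add: power_add mult.commute)
  ultimately show ?thesis using \<psi> unfolding z_def by (intro exI[of _ "?k + j"] bexI[of _ \<psi>]) (auto simp: \<psi>_def)
qed

text \<open>Origin of 1 / (8 b): a factor 2 for the margins d on both sides, which keep the branches
  inside \<open>{a..c}\<close>, 2 for passing to a finite family, 2 for replacing the supremum
  \<tau> w by an attained value, and b from \<open>beta_branch_of_cylinder\<close>.\<close>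

lemma beta_branch_cover:
  assumes ab: "0 \<le> a" "a < c" "c \<le> 1" and \<epsilon>: "0 < \<epsilon>"
  shows "\<exists>U. finite U \<and> U \<subseteq> (\<Union>n. beta_branches b n) \<and> disjoint_family_on (\<lambda>\<psi>. {blo \<psi><..<bhi \<psi>}) U \<and>
          (\<forall>\<psi>\<in>U. a \<le> blo \<psi> \<and> bhi \<psi> \<le> c \<and> blen \<psi> < \<epsilon>) \<and> 1 / (8 * b) * (c - a) \<le> (\<Sum>\<psi>\<in>U. blen \<psi>)"
proof -
  define d where "d = (c - a) / 4"
  have d: "d > 0" using ab by (simp add: d_def)
  have "\<exists>k. (1 / b) ^ k < min \<epsilon> d" using \<epsilon> d b by (intro real_arch_pow_inv) auto
  then obtain k where k: "1 / b ^ k < \<epsilon>" "1 / b ^ k < d" by (auto simp: power_divide)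
  let ?C = "cylinder (Beta b)"
  let ?T = "imap (Beta b)"
  define S where "S = {w. length w = k \<and> (\<exists>x\<in>{a + d..c - d}. x \<in> ?C w)}"
  define \<tau> where "\<tau> w = Sup ((?T ^^ k) ` ?C w)" for w
  have rng: "(?T ^^ k) ` ?C w \<subseteq> {0..<1}" for w
    using beta_orbit_range by (auto simp: cylinder_def simp del: atLeastLessThan_iff)
  have bdd: "bdd_above ((?T ^^ k) ` ?C w)" for w
    using rng by (intro bdd_aboveI[of _ 1]) (force simp: subset_iff)
  have le\<tau>: "(?T ^^ k) x \<le> \<tau> w" if "x \<in> ?C w" for x w
    unfolding \<tau>_def using that bdd by (intro cSup_upper) auto
  have \<tau>0: "0 \<le> \<tau> w" if w: "w \<in> S" for w
  proof -
    obtain x where "x \<in> ?C w" using w by (auto simp: S_def)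
    then show ?thesis using le\<tau>[of x w] rng[of w] by force
  qed
  have eqx: "x = beta_base b w + (?T ^^ k) x / b ^ k" if "x \<in> ?C w" "length w = k" for x w
    using beta_orbit[OF that(1)] that(2) b by simp
  have "\<exists>F. finite F \<and> F \<subseteq> S \<and> (c - d - (a + d)) / 2 \<le> (\<Sum>w\<in>F. \<tau> w / b ^ k)"
  proof (rule countable_cover_finite_sum[where Z="{}" and X="?C" and c="beta_base b"])
    show "{a + d..c - d} - {} \<subseteq> (\<Union>w\<in>S. ?C w)"
    proof
      fix x assume x: "x \<in> {a + d..c - d} - {}"
      define w where "w = map (\<lambda>i. digit (Beta b) ((?T ^^ i) x)) [0..<k]"
      have "x \<in> ?C w" using x ab d by (auto simp: cylinder_def w_def)
      moreover have "length w = k" by (simp add: w_def)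
      ultimately show "x \<in> (\<Union>w\<in>S. ?C w)" using x unfolding S_def by blast
    qed
    show "?C w \<subseteq> {beta_base b w..beta_base b w + \<tau> w / b ^ k}" if w: "w \<in> S" for w
    proof
      fix x assume x: "x \<in> ?C w"
      have "0 \<le> (?T ^^ k) x" "(?T ^^ k) x \<le> \<tau> w" using x rng le\<tau> by force+
      then have "0 \<le> (?T ^^ k) x / b ^ k" "(?T ^^ k) x / b ^ k \<le> \<tau> w / b ^ k"
        using b by (auto intro: divide_right_mono)
      then show "x \<in> {beta_base b w..beta_base b w + \<tau> w / b ^ k}" using eqx[OF x] w by (auto simp: S_def)
    qed
  qed (use ab \<tau>0 b in \<open>auto simp: d_def field_simps intro: countable_subset[of S UNIV]\<close>)
  then obtain F where F: "finite F" "F \<subseteq> S" "d \<le> (\<Sum>w\<in>F. \<tau> w / b ^ k)"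
    by (auto simp: d_def field_simps)
  \<comment> \<open>A cylinder with \<tau> w = 0 is a single point and has no room for a
    branch.\<close>
  define F' where "F' = {w \<in> F. 0 < \<tau> w}"
  have "\<forall>w\<in>F'. \<exists>\<psi>. \<psi> \<in> (\<Union>n. beta_branches b n) \<and> \<psi> 0 = beta_base b w \<and> {blo \<psi><..<bhi \<psi>} \<subseteq> ?C w \<and>
    blen \<psi> \<le> 1 / b ^ k \<and> \<tau> w / b ^ k / (2 * b) \<le> blen \<psi>"
  proof
    fix w assume w: "w \<in> F'"
    then have wS: "w \<in> S" "0 < \<tau> w" using F by (auto simp: F'_def)
    then have "(?T ^^ k) ` ?C w \<noteq> {}" by (auto simp: S_def)
    moreover have "\<tau> w / 2 < \<tau> w" using wS by simp
    ultimately obtain x where x: "x \<in> ?C w" "\<tau> w / 2 < (?T ^^ k) x"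
      using less_cSupE[of "\<tau> w / 2" "(?T ^^ k) ` ?C w"] unfolding \<tau>_def by blast
    have len: "length w = k" using wS by (simp add: S_def)
    obtain n \<psi> where \<psi>: "\<psi> \<in> beta_branches b n" "\<psi> 0 = beta_base b w" "{blo \<psi><..<bhi \<psi>} \<subseteq> ?C w"
      "blen \<psi> \<le> 1 / b ^ k" "(?T ^^ k) x / b ^ k / b \<le> blen \<psi>"
      using beta_branch_of_cylinder[OF x(1)] x(2) wS(2) unfolding len by auto
    have "\<tau> w / 2 / b ^ k / b \<le> (?T ^^ k) x / b ^ k / b"
      using x(2) b by (intro divide_right_mono) auto
    then have "\<tau> w / b ^ k / (2 * b) \<le> blen \<psi>" using \<psi>(5) by simp
    then show "\<exists>\<psi>. \<psi> \<in> (\<Union>n. beta_branches b n) \<and> \<psi> 0 = beta_base b w \<and> {blo \<psi><..<bhi \<psi>} \<subseteq> ?C w \<and>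
      blen \<psi> \<le> 1 / b ^ k \<and> \<tau> w / b ^ k / (2 * b) \<le> blen \<psi>" using \<psi> by blast
  qed
  from bchoice[OF this] obtain \<Psi> where \<Psi>: "\<And>w. w \<in> F' \<Longrightarrow> \<Psi> w \<in> (\<Union>n. beta_branches b n)"
    "\<And>w. w \<in> F' \<Longrightarrow> \<Psi> w 0 = beta_base b w" "\<And>w. w \<in> F' \<Longrightarrow> {blo (\<Psi> w)<..<bhi (\<Psi> w)} \<subseteq> ?C w"
    "\<And>w. w \<in> F' \<Longrightarrow> blen (\<Psi> w) \<le> 1 / b ^ k" "\<And>w. w \<in> F' \<Longrightarrow> \<tau> w / b ^ k / (2 * b) \<le> blen (\<Psi> w)" by blast
  have F'S: "w \<in> S" if "w \<in> F'" for w using that F by (auto simp: F'_def)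
  have lenk: "length w = k" if "w \<in> F'" for w using F'S[OF that] by (simp add: S_def)
  have pos: "blo (\<Psi> w) < bhi (\<Psi> w)" if "w \<in> F'" for w
    using \<Psi>(1)[OF that] beta_branch_blen b by fastforce
  have dis: "{blo (\<Psi> w)<..<bhi (\<Psi> w)} \<inter> {blo (\<Psi> w')<..<bhi (\<Psi> w')} = {}" if "w \<in> F'" "w' \<in> F'" "w \<noteq> w'" for w w'
  proof -
    have "?C w \<inter> ?C w' = {}" using cylinder_disjoint[of w w'] that lenk by auto
    then show ?thesis using \<Psi>(3)[OF that(1)] \<Psi>(3)[OF that(2)] by blast
  qed
  have inj: "inj_on \<Psi> F'"
  proof (rule inj_onI, rule ccontr)
    fix w w' assume *: "w \<in> F'" "w' \<in> F'" "\<Psi> w = \<Psi> w'" "w \<noteq> w'"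
    then show False using dis[of w w'] pos[of w] by simp
  qed
  have inside: "a \<le> blo (\<Psi> w) \<and> bhi (\<Psi> w) \<le> c" if w: "w \<in> F'" for w
  proof -
    obtain x where x: "x \<in> {a + d..c - d}" "x \<in> ?C w" using F'S[OF w] by (auto simp: S_def)
    have "0 \<le> (?T ^^ k) x" "(?T ^^ k) x \<le> 1" using x rng by force+
    then have "0 \<le> (?T ^^ k) x / b ^ k" "(?T ^^ k) x / b ^ k \<le> 1 / b ^ k"
      using b by (auto intro: divide_right_mono)
    then have "x - d \<le> beta_base b w" "beta_base b w \<le> x" using eqx[OF x(2) lenk[OF w]] k by auto
    moreover have "blo (\<Psi> w) = beta_base b w" using \<Psi>(1,2)[OF w] beta_branch_blen by fastforce
    moreover have "bhi (\<Psi> w) \<le> beta_base b w + d"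
      using \<Psi>(4)[OF w] k calculation(3) bhi_minus_blo[of "\<Psi> w"] by linarith
    ultimately show ?thesis using x by auto
  qed
  have "1 / (8 * b) * (c - a) = d / (2 * b)" using b by (simp add: d_def field_simps)
  also have "\<dots> \<le> (\<Sum>w\<in>F. \<tau> w / b ^ k) / (2 * b)" using F b by (intro divide_right_mono) auto
  also have "(\<Sum>w\<in>F. \<tau> w / b ^ k) = (\<Sum>w\<in>F'. \<tau> w / b ^ k)"
  proof (rule sum.mono_neutral_right)
    show "\<forall>w\<in>F - F'. \<tau> w / b ^ k = 0"
    proof
      fix w assume "w \<in> F - F'"
      then have "\<tau> w = 0" using \<tau>0[of w] F by (force simp: F'_def)
      then show "\<tau> w / b ^ k = 0" by simp
    qed
  qed (use F in \<open>auto simp: F'_def\<close>)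
  also have "\<dots> / (2 * b) \<le> (\<Sum>w\<in>F'. blen (\<Psi> w))"
    unfolding sum_divide_distrib using \<Psi>(5) by (rule sum_mono)
  also have "\<dots> = (\<Sum>\<psi>\<in>\<Psi> ` F'. blen \<psi>)" using inj by (simp add: sum.reindex)
  finally have sum: "1 / (8 * b) * (c - a) \<le> (\<Sum>\<psi>\<in>\<Psi> ` F'. blen \<psi>)" .
  show ?thesis
  proof (intro exI[of _ "\<Psi> ` F'"] conjI)
    show "finite (\<Psi> ` F')" using F by (simp add: F'_def)
    show "\<Psi> ` F' \<subseteq> (\<Union>n. beta_branches b n)" using \<Psi>(1) by blast
    show "disjoint_family_on (\<lambda>\<psi>. {blo \<psi><..<bhi \<psi>}) (\<Psi> ` F')"
      unfolding disjoint_family_on_def using dis by fastforce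
    show "\<forall>\<psi>\<in>\<Psi> ` F'. a \<le> blo \<psi> \<and> bhi \<psi> \<le> c \<and> blen \<psi> < \<epsilon>"
      using inside \<Psi>(4) k by (auto intro: le_less_trans)
    show "1 / (8 * b) * (c - a) \<le> (\<Sum>\<psi>\<in>\<Psi> ` F'. blen \<psi>)" by (rule sum)
  qed
qed

text \<open>The branches are affine; D = 2 is the distortion bound of the Gauss branches, taken here
  as well so that both maps share one constant.\<close>

lemma beta_full_branches:
  assumes "\<And>x. x \<in> {0<..<1} \<Longrightarrow> 0 < f x \<and> f x \<le> M"
    and "\<And>n. L-lipschitz_on {0..1} (h n)" "\<And>n. h n ` {0..1} \<subseteq> {0..1}"
  shows "full_branches (imap (Beta b)) f h L 2 (1 / (8 * b)) M (beta_branches b)"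
proof
  fix \<psi> n assume \<psi>: "\<psi> \<in> beta_branches b n"
  note len = beta_branch_blen[OF \<psi>]
  from \<psi> obtain x0 where x0: "x0 \<ge> 0" "x0 + 1 / b ^ n \<le> 1" "\<psi> = (\<lambda>y. x0 + y / b ^ n)"
    "\<And>y. y \<in> {0..<1} \<Longrightarrow> (imap (Beta b) ^^ n) (\<psi> y) = y" by (auto simp: beta_branches_def)
  show "\<psi> 0 \<noteq> \<psi> 1" using b by (simp add: x0(3))
  have diff: "\<bar>\<psi> x - \<psi> y\<bar> = \<bar>x - y\<bar> / b ^ n" for x y
    using b by (simp add: x0(3) diff_divide_distrib[symmetric])
  show "blen \<psi> * \<bar>x - y\<bar> \<le> 2 * \<bar>\<psi> x - \<psi> y\<bar>" "\<bar>\<psi> x - \<psi> y\<bar> \<le> 2 * blen \<psi> * \<bar>x - y\<bar>" for x y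
    unfolding diff len using b by (auto simp: divide_simps)
  have frac: "y / b ^ n < 1 / b ^ n" if "y < 1" for y :: real
    using that b by (intro divide_strict_right_mono) auto
  show "\<psi> y \<in> {0<..<1}" if "y \<in> {0<..<1}" for y
    using that frac[of y] x0 b by (auto simp: x0(3) add_nonneg_pos)
  show "\<psi> y \<in> {0..1}" if "y \<in> {0..1}" for y
    using that frac[of y] x0 b by (cases "y = 1") (auto simp: x0(3))
  show "(imap (Beta b) ^^ n) (\<psi> y) = y" if "y \<in> {0<..<1}" for y
    using x0(4) that by simp
  show "\<psi> \<circ> \<phi> \<in> beta_branches b (n + m)" if "\<phi> \<in> beta_branches b m" for \<phi> m
    by (rule beta_branch_comp[OF \<psi> that])
qed (use assms b beta_branch_cover in \<open>auto simp: frac_lt_1 imap_Beta\<close>)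

end

section \<open>Cylinders of the Gauss map\<close>

text \<open>The finite continued fraction [0; a_1, ..., a_n + y]. Stated for all y, it gives the
  continuous extension of the inverse branch to the end points 0 and 1.\<close>

fun gauss_branch :: "int list \<Rightarrow> real \<Rightarrow> real" where
  "gauss_branch [] y = y"
| "gauss_branch (a # w) y = 1 / (of_int a + gauss_branch w y)"

abbreviation "gauss_branches n \<equiv> gauss_branch ` words Gauss n"

lemma gauss_branch_append: "gauss_branch (u @ w) y = gauss_branch u (gauss_branch w y)"
  by (induction u) auto

lemma gauss_branch_range:
  assumes "set w \<subseteq> {1..}"
  shows "y \<in> {0..1} \<Longrightarrow> gauss_branch w y \<in> {0..1}"
    and "y \<in> {0<..<1} \<Longrightarrow> gauss_branch w y \<in> {0<..<1}"
    and "y \<notin> \<rat> \<Longrightarrow> gauss_branch w y \<notin> \<rat>"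
  using assms
proof (induction w)
  case (Cons a w)
  {
    case 1
    then have a: "1 \<le> real_of_int a" by simp
    from 1 have "gauss_branch w y \<in> {0..1}" using Cons by simp
    then show ?case using a by (auto simp: field_simps)
  next
    case 2
    then have a: "1 \<le> real_of_int a" by simp
    from 2 have "gauss_branch w y \<in> {0<..<1}" using Cons by simp
    then show ?case using a by (auto simp: field_simps)
  next
    case 3
    then have irr: "gauss_branch w y \<notin> \<rat>" using Cons by simp
    show ?case
    proof
      assume "gauss_branch (a # w) y \<in> \<rat>"
      then have "1 / gauss_branch (a # w) y - of_int a \<in> \<rat>" by (intro Rats_diff Rats_divide) auto
      then show False using irr by simp
    qed
  }
qed auto

lemma imap_Gauss_inverse:
  assumes "1 \<le> a" "0 < z" "z < 1"
  shows "imap Gauss (1 / (of_int a + z)) = z" "digit Gauss (1 / (of_int a + z)) = a"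
proof -
  have "\<lfloor>of_int a + z\<rfloor> = a" using assms by linarith
  then show "imap Gauss (1 / (of_int a + z)) = z" "digit Gauss (1 / (of_int a + z)) = a"
    using assms by (auto simp: frac_def imap.simps digit.simps)
qed

lemma gauss_branch_orbit:
  assumes "set w \<subseteq> {1..}" "y \<in> {0<..<1}" "k \<le> length w"
  shows "(imap Gauss ^^ k) (gauss_branch w y) = gauss_branch (drop k w) y"
  using assms
proof (induction w arbitrary: k)
  case (Cons a w)
  show ?case
  proof (cases k)
    case (Suc i)
    have "gauss_branch w y \<in> {0<..<1}" using Cons.prems by (intro gauss_branch_range) auto
    then have "imap Gauss (gauss_branch (a # w) y) = gauss_branch w y"
      using imap_Gauss_inverse[of a "gauss_branch w y"] Cons.prems by simp
    then have "(imap Gauss ^^ k) (gauss_branch (a # w) y) = (imap Gauss ^^ i) (gauss_branch w y)"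
      by (simp only: Suc funpow_Suc_right comp_def)
    then show ?thesis using Cons Suc by simp
  qed simp
qed simp

lemma gauss_branch_digit:
  assumes "set w \<subseteq> {1..}" "y \<in> {0<..<1}" "k < length w"
  shows "digit Gauss ((imap Gauss ^^ k) (gauss_branch w y)) = w ! k"
proof -
  have "drop k w = w ! k # drop (Suc k) w" using assms(3) by (simp add: Cons_nth_drop_Suc)
  moreover have "gauss_branch (drop (Suc k) w) y \<in> {0<..<1}"
    using assms set_drop_subset[of "Suc k" w] by (intro gauss_branch_range) auto
  moreover have "1 \<le> w ! k" using subsetD[OF assms(1) nth_mem[OF assms(3)]] by simp
  ultimately show ?thesis
    using gauss_branch_orbit[of w y k] assms imap_Gauss_inverse(2)[of "w ! k" "gauss_branch (drop (Suc k) w) y"]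
    by simp
qed

lemma gauss_branch_unique:
  assumes "set w \<subseteq> {1..}" "set w' \<subseteq> {1..}" "length w = length w'" "y \<in> {0<..<1}" "y' \<in> {0<..<1}"
    and "gauss_branch w y = gauss_branch w' y'"
  shows "w = w'"
  using assms gauss_branch_digit[of w y] gauss_branch_digit[of w' y'] by (intro nth_equalityI) auto

text \<open>Irrationality is inherited by \<open>frac (1 / x)\<close>, so the expansion of a coded
  point never stops.\<close>

lemma gauss_branch_surj:
  "x \<in> coded_points Gauss \<Longrightarrow> \<exists>w\<in>words Gauss k. x \<in> gauss_branch w ` coded_points Gauss"
proof (induction k arbitrary: x)
  case (Suc k)
  define a where "a = \<lfloor>1 / x\<rfloor>"
  define z where "z = frac (1 / x)"
  have x: "0 < x" "x < 1" "x \<notin> \<rat>" using Suc.prems by auto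
  have "1 < 1 / x" using x by simp
  then have a: "1 \<le> a" unfolding a_def by linarith
  have az: "1 / x = of_int a + z" by (simp add: a_def z_def frac_def)
  have "z \<notin> \<rat>"
  proof
    assume "z \<in> \<rat>"
    then have "1 / (of_int a + z) \<in> \<rat>" by (intro Rats_divide Rats_add) auto
    then show False using az[symmetric] x by simp
  qed
  moreover from this have "0 < z" using frac_ge_0[of "1 / x"]
    by (metis Rats_0 order_le_less z_def)
  ultimately have "z \<in> coded_points Gauss" by (simp add: z_def frac_lt_1)
  then obtain w y where w: "w \<in> words Gauss k" "y \<in> coded_points Gauss" "z = gauss_branch w y"
    using Suc.IH by blast
  have "x = 1 / (1 / x)" by simp
  also have "\<dots> = gauss_branch (a # w) y" unfolding az by (simp add: w(3))
  finally have "x = gauss_branch (a # w) y" .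
  then show ?case using w a by (intro bexI[of _ "a # w"]) auto
qed auto

lemma cylinder_Gauss:
  assumes w: "set w \<subseteq> {1..}"
  shows "cylinder Gauss w = gauss_branch w ` coded_points Gauss"
proof
  show "cylinder Gauss w \<subseteq> gauss_branch w ` coded_points Gauss"
  proof
    fix x assume x: "x \<in> cylinder Gauss w"
    then have "x \<in> coded_points Gauss" by (simp add: cylinder_def)
    then obtain w' y where w': "w' \<in> words Gauss (length w)" "y \<in> coded_points Gauss" "x = gauss_branch w' y"
      using gauss_branch_surj[of x "length w"] by blast
    have "w' = w"
      using w' x gauss_branch_digit[of w' y] by (intro nth_equalityI) (auto simp: cylinder_def)
    then show "x \<in> gauss_branch w ` coded_points Gauss" using w' by blast
  qed
  show "gauss_branch w ` coded_points Gauss \<subseteq> cylinder Gauss w"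
  proof
    fix x assume "x \<in> gauss_branch w ` coded_points Gauss"
    then obtain y where y: "y \<in> {0<..<1}" "y \<notin> \<rat>" "x = gauss_branch w y" by auto
    then show "x \<in> cylinder Gauss w"
      using gauss_branch_range[OF w, of y] gauss_branch_digit[OF w y(1)]
      by (auto simp: cylinder_def)
  qed
qed

text \<open>The continuants: \<open>q\<close> and \<open>q'\<close> are the denominators of the last two convergents, and the product
  of the orbit is the reciprocal of the denominator of the Moebius map.\<close>

lemma gauss_branch_moebius:
  assumes "set w \<subseteq> {1..}"
  shows "\<exists>p p' q q' :: real. 1 \<le> q \<and> real (length w) \<le> q \<and> 0 \<le> q' \<and> q' \<le> q \<and> (w \<noteq> [] \<longrightarrow> 1 \<le> q') \<and>
    \<bar>p * q' - p' * q\<bar> = 1 \<and> (\<forall>y\<in>{0..1}. gauss_branch w y = (p + p' * y) / (q + q' * y)) \<and>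
    (\<forall>y\<in>{0<..<1}. (\<Prod>k<length w. (imap Gauss ^^ k) (gauss_branch w y)) = 1 / (q + q' * y))"
  using assms
proof (induction w rule: rev_induct)
  case Nil
  show ?case by (intro exI[of _ 0] exI[of _ 1] exI[of _ 1] exI[of _ 0]) auto
next
  case (snoc a w)
  then have w: "set w \<subseteq> {1..}" and a: "1 \<le> real_of_int a" by auto
  obtain p p' q q' :: real where q: "1 \<le> q" "real (length w) \<le> q" "0 \<le> q'" "q' \<le> q" "w \<noteq> [] \<Longrightarrow> 1 \<le> q'"
    and det: "\<bar>p * q' - p' * q\<bar> = 1"
    and br: "\<And>y. y \<in> {0..1} \<Longrightarrow> gauss_branch w y = (p + p' * y) / (q + q' * y)"
    and pr: "\<And>y. y \<in> {0<..<1} \<Longrightarrow> (\<Prod>k<length w. (imap Gauss ^^ k) (gauss_branch w y)) = 1 / (q + q' * y)"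
    using snoc.IH[OF w] by blast
  have qa: "q \<le> q * of_int a" using q a mult_left_mono[of 1 "of_int a" q] by simp
  show ?case
  proof (rule exI[of _ "p * of_int a + p'"], rule exI[of _ p], rule exI[of _ "q * of_int a + q'"],
      rule exI[of _ q], intro conjI ballI impI)
    show "1 \<le> q * of_int a + q'" using q(1,3) qa by linarith
    show "q \<le> q * of_int a + q'" using q(3) qa by linarith
    show "real (length (w @ [a])) \<le> q * of_int a + q'"
    proof (cases "w = []")
      case True
      then have "real (length (w @ [a])) = 1" by simp
      then show ?thesis using q(1,3) qa by linarith
    next
      case False
      then show ?thesis using q(2) q(5) qa by simp
    qed
    show "0 \<le> q" "1 \<le> q" using q(1) by auto
    have "(p * of_int a + p') * q - p * (q * of_int a + q') = - (p * q' - p' * q)" by (simp add: algebra_simps)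
    then show "\<bar>(p * of_int a + p') * q - p * (q * of_int a + q')\<bar> = 1" using det by simp
  next
    fix y :: real assume y: "y \<in> {0..1}"
    define z where "z = 1 / (of_int a + y)"
    have ay: "of_int a + y > 0" using a y by simp
    have z: "z \<in> {0..1}" using a y by (auto simp: z_def)
    have "gauss_branch (w @ [a]) y = (p + p' * z) / (q + q' * z)"
      using br[OF z] by (simp add: gauss_branch_append z_def)
    also have "\<dots> = ((p + p' * z) * (of_int a + y)) / ((q + q' * z) * (of_int a + y))" using ay by simp
    also have "(p + p' * z) * (of_int a + y) = p * of_int a + p' + p * y"
      using ay by (simp add: z_def field_simps)
    also have "(q + q' * z) * (of_int a + y) = q * of_int a + q' + q * y"
      using ay by (simp add: z_def field_simps)
    finally show "gauss_branch (w @ [a]) y = (p * of_int a + p' + p * y) / (q * of_int a + q' + q * y)" .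
  next
    fix y :: real assume y: "y \<in> {0<..<1}"
    define z where "z = 1 / (of_int a + y)"
    have ay: "of_int a + y > 0" using a y by simp
    have z: "z \<in> {0<..<1}" using a y by (auto simp: z_def)
    have eq: "gauss_branch (w @ [a]) y = gauss_branch w z" by (simp add: gauss_branch_append z_def)
    have "(imap Gauss ^^ length w) (gauss_branch w z) = z" using gauss_branch_orbit[OF w z, of "length w"] by simp
    then have "(\<Prod>k<length (w @ [a]). (imap Gauss ^^ k) (gauss_branch (w @ [a]) y)) = 1 / (q + q' * z) * z"
      unfolding eq using pr[OF z] by simp
    also have "\<dots> = 1 / ((q + q' * z) * (of_int a + y))" by (simp add: z_def)
    also have "(q + q' * z) * (of_int a + y) = q * of_int a + q' + q * y"
      using ay by (simp add: z_def field_simps)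
    finally show "(\<Prod>k<length (w @ [a]). (imap Gauss ^^ k) (gauss_branch (w @ [a]) y)) = 1 / (q * of_int a + q' + q * y)" .
  qed
qed

text \<open>For the Moebius form, the difference of two values is, up to sign, (x - y) / ((q + q' x)
  (q + q' y)), and 0 \<le> q' \<le> q keeps this denominator within a factor 2 of q (q + q') = 1 /
  \<open>blen\<close>. The squared product of the orbit is 1 / (q + q' y)^2, the modulus of the
  derivative of the branch, so it obeys the same comparison.\<close>

lemma gauss_branch_distortion:
  assumes w: "set w \<subseteq> {1..}"
  shows "gauss_branch w 0 \<noteq> gauss_branch w 1"
    and "x \<in> {0..1} \<Longrightarrow> y \<in> {0..1} \<Longrightarrow>
      blen (gauss_branch w) * \<bar>x - y\<bar> \<le> 2 * \<bar>gauss_branch w x - gauss_branch w y\<bar>"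
    and "x \<in> {0..1} \<Longrightarrow> y \<in> {0..1} \<Longrightarrow>
      \<bar>gauss_branch w x - gauss_branch w y\<bar> \<le> 2 * blen (gauss_branch w) * \<bar>x - y\<bar>"
    and "length w > 0 \<Longrightarrow> blen (gauss_branch w) \<le> 1 / real (length w)"
    and "y \<in> {0<..<1} \<Longrightarrow> blen (gauss_branch w) / 2 \<le> (\<Prod>k<length w. (imap Gauss ^^ k) (gauss_branch w y))\<^sup>2"
    and "y \<in> {0<..<1} \<Longrightarrow> (\<Prod>k<length w. (imap Gauss ^^ k) (gauss_branch w y))\<^sup>2 \<le> 2 * blen (gauss_branch w)"
proof -
  obtain p p' q q' :: real where q: "1 \<le> q" "real (length w) \<le> q" "0 \<le> q'" "q' \<le> q"
    and det: "\<bar>p * q' - p' * q\<bar> = 1"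
    and br: "\<And>y. y \<in> {0..1} \<Longrightarrow> gauss_branch w y = (p + p' * y) / (q + q' * y)"
    and pr: "\<And>y. y \<in> {0<..<1} \<Longrightarrow> (\<Prod>k<length w. (imap Gauss ^^ k) (gauss_branch w y)) = 1 / (q + q' * y)"
    using gauss_branch_moebius[OF w] by blast
  have pos: "q + q' * x > 0" if "x \<in> {0..1}" for x
    using q that by (intro add_pos_nonneg mult_nonneg_nonneg) auto
  have diff: "\<bar>gauss_branch w x - gauss_branch w y\<bar> = \<bar>x - y\<bar> / ((q + q' * x) * (q + q' * y))"
    if "x \<in> {0..1}" "y \<in> {0..1}" for x y
  proof -
    have "gauss_branch w x - gauss_branch w y = (- (p * q' - p' * q)) * (x - y) / ((q + q' * x) * (q + q' * y))"
      unfolding br[OF that(1)] br[OF that(2)] using pos[OF that(1)] pos[OF that(2)]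
      by (simp add: diff_frac_eq algebra_simps)
    moreover have "\<bar>- (p * q' - p' * q)\<bar> = 1" using det by (simp only: abs_minus_cancel)
    ultimately show ?thesis using pos[OF that(1)] pos[OF that(2)] by (simp only: abs_mult abs_divide)
  qed
  have len: "blen (gauss_branch w) = 1 / (q * (q + q'))"
    using diff[of 1 0] by (simp add: blen_def)
  then show "gauss_branch w 0 \<noteq> gauss_branch w 1" using q by (auto simp: blen_def)
  have den: "q * (q + q') \<le> 2 * ((q + q' * x) * (q + q' * y))"
    "(q + q' * x) * (q + q' * y) \<le> 2 * (q * (q + q'))" if "x \<in> {0..1}" "y \<in> {0..1}" for x y
  proof -
    have 1: "q \<le> q + q' * z" "q + q' * z \<le> q + q'" if "z \<in> {0..1}" for z
      using q that mult_left_mono[of z 1 q'] by auto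
    have "q * (q + q') \<le> q * (2 * q)" using q by (intro mult_left_mono) auto
    also have "\<dots> = 2 * (q * q)" by simp
    also have "q * q \<le> (q + q' * x) * (q + q' * y)" using 1[OF that(1)] 1[OF that(2)] q by (intro mult_mono) auto
    finally show "q * (q + q') \<le> 2 * ((q + q' * x) * (q + q' * y))" by simp
    have "(q + q' * x) * (q + q' * y) \<le> (q + q') * (q + q')"
      using 1[OF that(1)] 1[OF that(2)] q by (intro mult_mono) auto
    also have "\<dots> \<le> (2 * q) * (q + q')" using q by (intro mult_right_mono) auto
    finally show "(q + q' * x) * (q + q' * y) \<le> 2 * (q * (q + q'))" by simp
  qed
  have comp: "blen (gauss_branch w) \<le> 2 * (1 / ((q + q' * x) * (q + q' * y)))"
    "1 / ((q + q' * x) * (q + q' * y)) \<le> 2 * blen (gauss_branch w)" if "x \<in> {0..1}" "y \<in> {0..1}" for x y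
  proof -
    have P: "(q + q' * x) * (q + q' * y) > 0" "q * (q + q') > 0"
      using pos[OF that(1)] pos[OF that(2)] q by auto
    show "blen (gauss_branch w) \<le> 2 * (1 / ((q + q' * x) * (q + q' * y)))"
      "1 / ((q + q' * x) * (q + q' * y)) \<le> 2 * blen (gauss_branch w)"
      unfolding len using den[OF that] P by (simp_all add: divide_simps)
  qed
  show "blen (gauss_branch w) * \<bar>x - y\<bar> \<le> 2 * \<bar>gauss_branch w x - gauss_branch w y\<bar>"
    if "x \<in> {0..1}" "y \<in> {0..1}"
    using mult_right_mono[OF comp(1)[OF that], of "\<bar>x - y\<bar>"] by (simp add: diff[OF that])
  show "\<bar>gauss_branch w x - gauss_branch w y\<bar> \<le> 2 * blen (gauss_branch w) * \<bar>x - y\<bar>"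
    if "x \<in> {0..1}" "y \<in> {0..1}"
    using mult_right_mono[OF comp(2)[OF that], of "\<bar>x - y\<bar>"] by (simp add: diff[OF that])
  show "blen (gauss_branch w) \<le> 1 / real (length w)" if "length w > 0"
  proof -
    have "real (length w) * 1 \<le> q * (q + q')" using q by (intro mult_mono) auto
    then show ?thesis unfolding len using that q by (intro divide_left_mono mult_pos_pos) auto
  qed
  show "blen (gauss_branch w) / 2 \<le> (\<Prod>k<length w. (imap Gauss ^^ k) (gauss_branch w y))\<^sup>2"
    if "y \<in> {0<..<1}"
    unfolding pr[OF that] using comp(1)[of y y] that by (simp add: power2_eq_square)
  show "(\<Prod>k<length w. (imap Gauss ^^ k) (gauss_branch w y))\<^sup>2 \<le> 2 * blen (gauss_branch w)"
    if "y \<in> {0<..<1}"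
    unfolding pr[OF that] using comp(2)[of y y] that by (simp add: power2_eq_square)
qed

lemma gauss_branch_image:
  assumes w: "set w \<subseteq> {1..}"
  shows "gauss_branch w ` {0<..<1} = {blo (gauss_branch w)<..<bhi (gauss_branch w)}"
    and "0 < blen (gauss_branch w)"
proof -
  show b: "0 < blen (gauss_branch w)" using gauss_branch_distortion(1)[OF w] by (simp add: blen_def)
  show "gauss_branch w ` {0<..<1} = {blo (gauss_branch w)<..<bhi (gauss_branch w)}"
  proof (rule image_open_unit_interval)
    have "(2 * blen (gauss_branch w))-lipschitz_on {0..1} (gauss_branch w)"
      using gauss_branch_distortion(3)[OF w] b by (intro lipschitz_onI) (auto simp: dist_real_def)
    then show "continuous_on {0..1} (gauss_branch w)" by (rule lipschitz_on_continuous_on)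
    show "inj_on (gauss_branch w) {0..1}"
    proof (rule inj_onI, rule ccontr)
      fix x y assume *: "x \<in> {0..1}" "y \<in> {0..1}" "gauss_branch w x = gauss_branch w y" "x \<noteq> y"
      then have "0 < blen (gauss_branch w) * \<bar>x - y\<bar>" using b by simp
      then show False using gauss_branch_distortion(2)[OF w *(1,2)] * by simp
    qed
  qed
qed

lemma gauss_branch_disjoint:
  assumes "w \<in> words Gauss n" "w' \<in> words Gauss n" "w \<noteq> w'"
  shows "{blo (gauss_branch w)<..<bhi (gauss_branch w)} \<inter> {blo (gauss_branch w')<..<bhi (gauss_branch w')} = {}"
proof -
  have "set w \<subseteq> {1..}" "set w' \<subseteq> {1..}" using assms by auto
  then show ?thesis
    using gauss_branch_unique[of w w'] assms by (fastforce simp: gauss_branch_image(1)[symmetric])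
qed

lemma inj_on_gauss_branch: "inj_on gauss_branch (words Gauss n)"
proof (rule inj_onI, rule ccontr)
  fix w w' assume *: "w \<in> words Gauss n" "w' \<in> words Gauss n" "gauss_branch w = gauss_branch w'" "w \<noteq> w'"
  have "set w \<subseteq> {1..}" using *(1) by auto
  then have "blo (gauss_branch w) < bhi (gauss_branch w)" using gauss_branch_image(2) by (simp flip: bhi_minus_blo)
  then show False using gauss_branch_disjoint[OF *(1,2,4)] *(3) by simp
qed

text \<open>Every Gauss cylinder is full, so cylinders of a single large order serve directly; 1/4
  combines the margins and the passage to a finite family.\<close>

lemma gauss_branch_cover:
  assumes ab: "0 \<le> a" "a < c" "c \<le> 1" and \<epsilon>: "0 < \<epsilon>"
  shows "\<exists>U. finite U \<and> U \<subseteq> (\<Union>n. gauss_branches n) \<and> disjoint_family_on (\<lambda>\<psi>. {blo \<psi><..<bhi \<psi>}) U \<and>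
          (\<forall>\<psi>\<in>U. a \<le> blo \<psi> \<and> bhi \<psi> \<le> c \<and> blen \<psi> < \<epsilon>) \<and> 1 / 4 * (c - a) \<le> (\<Sum>\<psi>\<in>U. blen \<psi>)"
proof -
  define d where "d = (c - a) / 4"
  have d: "d > 0" using ab by (simp add: d_def)
  define e where "e = min \<epsilon> d"
  have e: "e > 0" using \<epsilon> d by (simp add: e_def)
  obtain k :: nat where k0: "1 / e < real k" using reals_Archimedean2 by blast
  have "0 < 1 / e" using e by simp
  then have kpos: "0 < real k" using k0 by linarith
  then have "1 / real k < e" using k0 e by (simp add: field_simps)
  then have k: "0 < k" "1 / real k < min \<epsilon> d" using kpos by (simp_all add: e_def)
  define S where "S = {w \<in> words Gauss k. \<exists>x\<in>{a + d..c - d}. x \<in> gauss_branch w ` {0<..<1}}"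
  have Sw: "w \<in> words Gauss k" "set w \<subseteq> {1..}" "length w = k" if "w \<in> S" for w using that by (auto simp: S_def)
  have small: "blen (gauss_branch w) < min \<epsilon> d" if "w \<in> S" for w
    using gauss_branch_distortion(4)[OF Sw(2)[OF that]] Sw(3)[OF that] k by simp
  have "\<exists>F. finite F \<and> F \<subseteq> S \<and> (c - d - (a + d)) / 2 \<le> (\<Sum>w\<in>F. blen (gauss_branch w))"
  proof (rule countable_cover_finite_sum[where Z="\<rat>" and X="\<lambda>w. gauss_branch w ` {0<..<1}"
        and c="\<lambda>w. blo (gauss_branch w)"])
    show "{a + d..c - d} - \<rat> \<subseteq> (\<Union>w\<in>S. gauss_branch w ` {0<..<1})"
    proof
      fix x assume x: "x \<in> {a + d..c - d} - \<rat>"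
      then have "x \<in> coded_points Gauss" using ab d by auto
      then obtain w where "w \<in> words Gauss k" "x \<in> gauss_branch w ` {0<..<1}"
        using gauss_branch_surj[of x k] by fastforce
      then show "x \<in> (\<Union>w\<in>S. gauss_branch w ` {0<..<1})" using x unfolding S_def by blast
    qed
    show "gauss_branch w ` {0<..<1} \<subseteq> {blo (gauss_branch w)..blo (gauss_branch w) + blen (gauss_branch w)}"
      if "w \<in> S" for w
      using bhi_minus_blo[of "gauss_branch w"] unfolding gauss_branch_image(1)[OF Sw(2)[OF that]] by auto
    show "0 \<le> blen (gauss_branch w)" for w by (simp add: blen_def)
  qed (use ab in \<open>auto simp: d_def field_simps countable_rat intro: countable_subset[of S UNIV]\<close>)
  then obtain F where F: "finite F" "F \<subseteq> S" "d \<le> (\<Sum>w\<in>F. blen (gauss_branch w))"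
    by (auto simp: d_def field_simps)
  have inj: "inj_on gauss_branch F"
    using F(2) by (intro inj_on_subset[OF inj_on_gauss_branch[of k]]) (auto simp: S_def)
  have inside: "a \<le> blo (gauss_branch w) \<and> bhi (gauss_branch w) \<le> c \<and> blen (gauss_branch w) < \<epsilon>" if w: "w \<in> F" for w
  proof -
    have wS: "w \<in> S" using w F by auto
    then obtain x where x: "x \<in> {a + d..c - d}" "x \<in> gauss_branch w ` {0<..<1}" by (auto simp: S_def)
    then show ?thesis using small[OF wS] bhi_minus_blo[of "gauss_branch w"]
      unfolding gauss_branch_image(1)[OF Sw(2)[OF wS]] by auto
  qed
  show ?thesis
  proof (intro exI[of _ "gauss_branch ` F"] conjI)
    show "finite (gauss_branch ` F)" using F by simp
    show "gauss_branch ` F \<subseteq> (\<Union>n. gauss_branches n)" using F(2) Sw(1) by blast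
    show "disjoint_family_on (\<lambda>\<psi>. {blo \<psi><..<bhi \<psi>}) (gauss_branch ` F)"
      unfolding disjoint_family_on_def using gauss_branch_disjoint[of _ k] F(2) Sw(1) by blast
    show "\<forall>\<psi>\<in>gauss_branch ` F. a \<le> blo \<psi> \<and> bhi \<psi> \<le> c \<and> blen \<psi> < \<epsilon>" using inside by blast
    show "1 / 4 * (c - a) \<le> (\<Sum>\<psi>\<in>gauss_branch ` F. blen \<psi>)"
      using F inj by (simp add: sum.reindex d_def)
  qed
qed

lemma gauss_full_branches:
  assumes "\<And>x. x \<in> {0<..<1} \<Longrightarrow> 0 < f x \<and> f x \<le> M"
    and "\<And>n. L-lipschitz_on {0..1} (h n)" "\<And>n. h n ` {0..1} \<subseteq> {0..1}"
  shows "full_branches (imap Gauss) f h L 2 (1 / 4) M gauss_branches"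
proof
  fix \<psi> n assume "\<psi> \<in> gauss_branches n"
  then obtain w where w: "set w \<subseteq> {1..}" "length w = n" "\<psi> = gauss_branch w" by auto
  note d = gauss_branch_distortion[OF w(1), folded w(3)] and r = gauss_branch_range[OF w(1), folded w(3)]
  show "\<psi> 0 \<noteq> \<psi> 1" by (rule d(1))
  show "blen \<psi> * \<bar>x - y\<bar> \<le> 2 * \<bar>\<psi> x - \<psi> y\<bar>" "\<bar>\<psi> x - \<psi> y\<bar> \<le> 2 * blen \<psi> * \<bar>x - y\<bar>"
    if "x \<in> {0..1}" "y \<in> {0..1}" for x y using that by (rule d(2), rule d(3))
  show "\<psi> y \<in> {0..1}" if "y \<in> {0..1}" for y using that by (rule r(1))
  show "\<psi> y \<in> {0<..<1}" if "y \<in> {0<..<1}" for y using that by (rule r(2))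
  show "(imap Gauss ^^ n) (\<psi> y) = y" if "y \<in> {0<..<1}" for y
    using gauss_branch_orbit[OF w(1) that, of n] w by simp
  show "\<psi> \<circ> \<phi> \<in> gauss_branches (n + m)" if \<phi>: "\<phi> \<in> gauss_branches m" for \<phi> m
  proof -
    obtain u where u: "set u \<subseteq> {1..}" "length u = m" "\<phi> = gauss_branch u" using \<phi> by auto
    have "\<psi> \<circ> \<phi> = gauss_branch (w @ u)" by (auto simp: w u gauss_branch_append)
    then show ?thesis using w u by (intro image_eqI[of _ _ "w @ u"]) auto
  qed
qed (use assms gauss_branch_cover in \<open>auto simp: frac_lt_1 imap.simps\<close>)

section \<open>Pressure of superadditive word weights\<close>

lemma nonneg_summable_on_bounded:
  fixes g :: "'a \<Rightarrow> real"
  assumes "\<And>x. x \<in> A \<Longrightarrow> 0 \<le> g x" "\<And>F. finite F \<Longrightarrow> F \<subseteq> A \<Longrightarrow> sum g F \<le> b"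
  shows "g summable_on A" "infsum g A \<le> b"
proof -
  show "g summable_on A"
    using assms by (intro nonneg_bdd_above_summable_on bdd_aboveI[of _ b]) auto
  then show "infsum g A \<le> b" using assms(2) by (rule infsum_le_finite_sums)
qed

text \<open>Fekete's lemma. The limit is the infimum of u n / n, finite by the lower bound, which is
  why l n never exceeds u n.\<close>

lemma subadditive_limit:
  fixes u :: "nat \<Rightarrow> real"
  assumes sub: "\<And>m n. u (m + n) \<le> u m + u n" and low: "\<And>n. - B * real n \<le> u n"
  shows "\<exists>l. (\<lambda>n. u n / real n) \<longlonglongrightarrow> l \<and> (\<forall>n\<ge>1. l * real n \<le> u n)"
proof -
  define S where "S = (\<lambda>n. u n / real n) ` {1..}"
  define l where "l = Inf S"
  have bdd: "bdd_below S"
  proof (rule bdd_belowI[of _ "- B"])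
    fix x assume "x \<in> S"
    then obtain n where "1 \<le> n" "x = u n / real n" by (auto simp: S_def)
    then show "- B \<le> x" using divide_right_mono[OF low[of n], of "real n"] by simp
  qed
  have ne: "S \<noteq> {}" by (auto simp: S_def)
  have le: "l \<le> u n / real n" if "1 \<le> n" for n
    unfolding l_def using bdd that by (intro cInf_lower) (auto simp: S_def)
  have "(\<lambda>n. u n / real n) \<longlonglongrightarrow> l"
  proof (rule LIMSEQ_I)
    fix \<epsilon> :: real assume \<epsilon>: "0 < \<epsilon>"
    have "Inf S < l + \<epsilon> / 2" using \<epsilon> by (simp add: l_def)
    then obtain x where "x \<in> S" "x < l + \<epsilon> / 2" using cInf_lessD[OF ne] by blast
    then obtain m where m: "1 \<le> m" "u m / real m < l + \<epsilon> / 2" by (auto simp: S_def)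
    have mult: "u (q * m + r) \<le> real q * u m + u r" for q r
    proof (induction q)
      case (Suc q)
      have "u (Suc q * m + r) = u (m + (q * m + r))" by (simp add: add_ac)
      also have "\<dots> \<le> u m + (real q * u m + u r)" using sub[of m "q * m + r"] Suc by linarith
      finally show ?case by (simp add: algebra_simps)
    qed simp
    define C where "C = Max ((\<lambda>r. \<bar>u r\<bar>) ` {..<m})"
    have C: "u r \<le> C" if "r < m" for r
    proof -
      have "\<bar>u r\<bar> \<le> C" unfolding C_def using that by (intro Max_ge) auto
      then show ?thesis by linarith
    qed
    define K where "K = \<bar>u m\<bar> + \<bar>C\<bar>"
    have bound: "u n / real n \<le> u m / real m + K / real n" if n: "1 \<le> n" for n
    proof -
      define q where "q = n div m" define r where "r = n mod m"
      have nqr: "n = q * m + r" and r: "r < m" using m by (auto simp: q_def r_def)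
      have "u n \<le> real q * u m + u r" using mult[of q r] nqr by simp
      also have "real q * u m = real n * (u m / real m) - (real r / real m) * u m"
        using m by (simp add: nqr field_simps)
      also have "- ((real r / real m) * u m) \<le> \<bar>u m\<bar>"
      proof -
        have "\<bar>(real r / real m) * u m\<bar> \<le> 1 * \<bar>u m\<bar>"
          unfolding abs_mult using r by (intro mult_right_mono) auto
        then show ?thesis by linarith
      qed
      then have "real n * (u m / real m) - (real r / real m) * u m + u r \<le> real n * (u m / real m) + K"
        using C[OF r] unfolding K_def by linarith
      finally have "u n \<le> real n * (u m / real m) + K" .
      then have "u n / real n \<le> (real n * (u m / real m) + K) / real n" by (rule divide_right_mono) simp
      then show ?thesis using n by (simp add: add_divide_distrib)
    qed
    have "(\<lambda>n. K / real n) \<longlonglongrightarrow> 0" by (rule lim_const_over_n)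
    then have "eventually (\<lambda>n. K / real n < \<epsilon> / 2) sequentially" using \<epsilon> by (intro order_tendstoD) auto
    then obtain N where N: "\<And>n. N \<le> n \<Longrightarrow> K / real n < \<epsilon> / 2" by (auto simp: eventually_sequentially)
    have "norm (u n / real n - l) < \<epsilon>" if "max N 1 \<le> n" for n
    proof -
      have n: "N \<le> n" "1 \<le> n" using that by auto
      have "u n / real n < l + \<epsilon>" using bound[OF n(2)] N[OF n(1)] m(2) by linarith
      then show ?thesis using le[OF n(2)] by simp
    qed
    then show "\<exists>no. \<forall>n\<ge>no. norm (u n / real n - l) < \<epsilon>" by blast
  qed
  then show ?thesis using le by (intro exI[of _ l]) (auto simp: field_simps)
qed

text \<open>\<open>G w\<close> stands for the infimum of S_n F over the cylinder of w.
  \<open>c0\<close> makes the pressure strictly decreasing, B keeps it above minus infinity, and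
  above \<sigma> the sums converge. \<open>full_rec\<close> reflects that a word has at most one
  non-full extension by a letter, and \<open>full_one\<close> that full cylinders of one order are
  disjoint subintervals of the unit interval.\<close>

locale word_weights =
  fixes W Full :: "nat \<Rightarrow> int list set" and G :: "int list \<Rightarrow> real" and c0 \<sigma> B :: real
  assumes len: "w \<in> W n \<Longrightarrow> length w = n"
    and split: "w \<in> W (n + m) \<Longrightarrow>
      take n w \<in> W n \<and> drop n w \<in> W m \<and> G (take n w) + G (drop n w) \<le> G w"
    and c0: "0 < c0" and G_ge: "w \<in> W n \<Longrightarrow> c0 * real n \<le> G w"
    and G_le: "\<exists>w\<in>W n. G w \<le> B * real n"
    and \<sigma>: "0 \<le> \<sigma>" "\<sigma> < 1"
    and summ1: "\<sigma> < s \<Longrightarrow> (\<lambda>w. exp (- s * G w)) summable_on W 1"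
    and full_sub: "Full n \<subseteq> W n"
    and full_rec: "\<sigma> < s \<Longrightarrow> finite F \<Longrightarrow> F \<subseteq> W (Suc n) - Full (Suc n) \<Longrightarrow>
      (\<Sum>w\<in>F. exp (- s * G w)) \<le> (\<Sum>\<^sub>\<infinity>w\<in>W n. exp (- s * G w))"
    and full_one: "finite F \<Longrightarrow> F \<subseteq> Full n \<Longrightarrow> (\<Sum>w\<in>F. exp (- G w)) \<le> 2"
begin

definition Z :: "nat \<Rightarrow> real \<Rightarrow> real" where "Z n s = (\<Sum>\<^sub>\<infinity>w\<in>W n. exp (- s * G w))"

lemma summable_product:
  assumes s: "0 \<le> s" and n: "(\<lambda>w. exp (- s * G w)) summable_on W n" and m: "(\<lambda>w. exp (- s * G w)) summable_on W m"
  shows "(\<lambda>w. exp (- s * G w)) summable_on W (n + m)" "Z (n + m) s \<le> Z n s * Z m s"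
proof -
  have fin: "(\<Sum>w\<in>F. exp (- s * G w)) \<le> Z n s * Z m s" if F: "finite F" "F \<subseteq> W (n + m)" for F
  proof -
    let ?e = "\<lambda>w. exp (- s * G w)"
    let ?g = "\<lambda>w. (take n w, drop n w)"
    have inj: "inj_on ?g F" by (intro inj_onI) (metis append_take_drop_id prod.inject)
    have "(\<Sum>w\<in>F. ?e w) \<le> (\<Sum>w\<in>F. ?e (take n w) * ?e (drop n w))"
    proof (rule sum_mono)
      fix w assume "w \<in> F"
      then have "G (take n w) + G (drop n w) \<le> G w" using split F by blast
      then have "s * (G (take n w) + G (drop n w)) \<le> s * G w" using s by (rule mult_left_mono)
      then show "?e w \<le> ?e (take n w) * ?e (drop n w)" by (simp add: exp_add[symmetric] algebra_simps)
    qed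
    also have "\<dots> = (\<Sum>(u, v)\<in>?g ` F. ?e u * ?e v)" using inj by (simp add: sum.reindex)
    also have "\<dots> \<le> (\<Sum>(u, v)\<in>take n ` F \<times> drop n ` F. ?e u * ?e v)"
      using F by (intro sum_mono2) auto
    also have "\<dots> = (\<Sum>u\<in>take n ` F. ?e u) * (\<Sum>v\<in>drop n ` F. ?e v)"
      by (simp add: sum_product sum.cartesian_product)
    also have "\<dots> \<le> Z n s * Z m s"
    proof (rule mult_mono)
      have "take n ` F \<subseteq> W n" "drop n ` F \<subseteq> W m" using split F by blast+
      then show "(\<Sum>u\<in>take n ` F. ?e u) \<le> Z n s" "(\<Sum>v\<in>drop n ` F. ?e v) \<le> Z m s"
        unfolding Z_def using F n m by (auto intro!: finite_sum_le_infsum)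
    qed (auto simp: Z_def intro!: sum_nonneg infsum_nonneg)
    finally show ?thesis .
  qed
  show "(\<lambda>w. exp (- s * G w)) summable_on W (n + m)" "Z (n + m) s \<le> Z n s * Z m s"
    unfolding Z_def using nonneg_summable_on_bounded[OF _ fin] by (auto simp: Z_def)
qed

lemma W0: "W 0 = {[]}"
proof -
  have "W 0 \<subseteq> {[]}" using len by fastforce
  moreover have "W 0 \<noteq> {}" using G_le[of 0] by blast
  ultimately show ?thesis by blast
qed

lemma summ: "\<sigma> < s \<Longrightarrow> (\<lambda>w. exp (- s * G w)) summable_on W n"
proof (induction n)
  case (Suc n)
  then show ?case using summable_product(1)[of s n 1] summ1 \<sigma> by simp
qed (simp add: W0)

lemma Z_submult: "\<sigma> < s \<Longrightarrow> Z (n + m) s \<le> Z n s * Z m s"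
  using summable_product(2) summ \<sigma> by simp

lemma Z_ge: "\<sigma> < s \<Longrightarrow> exp (- (s * B) * real n) \<le> Z n s"
proof -
  assume s: "\<sigma> < s"
  obtain w where w: "w \<in> W n" "G w \<le> B * real n" using G_le by blast
  have "s * G w \<le> s * (B * real n)" using w s \<sigma> by (intro mult_left_mono) auto
  then have "exp (- (s * B) * real n) \<le> (\<Sum>w\<in>{w}. exp (- s * G w))" by simp
  also have "\<dots> \<le> Z n s" unfolding Z_def using w summ[OF s] by (intro finite_sum_le_infsum) auto
  finally show ?thesis .
qed

lemma Z_pos: "\<sigma> < s \<Longrightarrow> 0 < Z n s"
  by (rule less_le_trans[OF exp_gt_zero Z_ge])

lemma Z_zero: "\<sigma> < s \<Longrightarrow> Z 0 s \<le> 1"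
  using G_ge[of "[]" 0] \<sigma> by (simp add: Z_def W0)

text \<open>Meant for s > \<sigma>, where Fekete's lemma provides such an l.\<close>

definition press :: "real \<Rightarrow> real" where
  "press s = (SOME l. (\<lambda>n. ln (Z n s) / real n) \<longlonglongrightarrow> l \<and> (\<forall>n\<ge>1. l * real n \<le> ln (Z n s)))"

lemma press:
  assumes s: "\<sigma> < s"
  shows "(\<lambda>n. ln (Z n s) / real n) \<longlonglongrightarrow> press s" "1 \<le> n \<Longrightarrow> press s * real n \<le> ln (Z n s)"
proof -
  have "\<exists>l. (\<lambda>n. ln (Z n s) / real n) \<longlonglongrightarrow> l \<and> (\<forall>n\<ge>1. l * real n \<le> ln (Z n s))"
  proof (rule subadditive_limit)
    fix m n
    have "ln (Z (m + n) s) \<le> ln (Z m s * Z n s)"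
      using Z_submult[OF s] Z_pos[OF s] by (subst ln_le_cancel_iff) (auto intro: mult_pos_pos)
    also have "\<dots> = ln (Z m s) + ln (Z n s)" using Z_pos[OF s] by (intro ln_mult_pos) auto
    finally show "ln (Z (m + n) s) \<le> ln (Z m s) + ln (Z n s)" .
  next
    fix n
    show "- (s * B) * real n \<le> ln (Z n s)" using Z_ge[OF s, of n] Z_pos[OF s, of n] by (simp add: ln_ge_iff)
  qed
  from someI_ex[OF this] show "(\<lambda>n. ln (Z n s) / real n) \<longlonglongrightarrow> press s"
    "1 \<le> n \<Longrightarrow> press s * real n \<le> ln (Z n s)" unfolding press_def by auto
qed

text \<open>The factor n + 1, which counts orders of full words in \<open>Z_le_full\<close>,
  disappears in the limit.\<close>

lemma press_le:
  assumes s: "\<sigma> < s" and K: "0 < K" and le: "\<And>n. Z n s \<le> K * (real n + 1) * exp (c * real n)"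
  shows "press s \<le> c"
proof -
  have "(\<lambda>n. ln (real n + 1) / real n) \<longlonglongrightarrow> 0"
  proof (rule tendsto_sandwich)
    show "eventually (\<lambda>n. 0 \<le> ln (real n + 1) / real n) sequentially" by simp
    show "eventually (\<lambda>n. ln (real n + 1) / real n \<le> ln 2 / real n + ln (real n) / real n) sequentially"
      using eventually_gt_at_top[of 0]
    proof eventually_elim
      case (elim n)
      then have "ln (real n + 1) \<le> ln (2 * real n)" by (subst ln_le_cancel_iff) auto
      also have "\<dots> = ln 2 + ln (real n)" using elim by (intro ln_mult_pos) auto
      finally show ?case by (simp add: add_divide_distrib[symmetric] divide_right_mono)
    qed
    have "(\<lambda>n. ln 2 / real n + ln (real n) / real n) \<longlonglongrightarrow> 0 + 0"
      by (intro tendsto_add lim_const_over_n lim_ln_over_n[unfolded comp_def])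
    then show "(\<lambda>n. ln 2 / real n + ln (real n) / real n) \<longlonglongrightarrow> 0" by simp
  qed simp
  then have "(\<lambda>n. ln K / real n + ln (real n + 1) / real n + c) \<longlonglongrightarrow> 0 + 0 + c"
    by (intro tendsto_add lim_const_over_n tendsto_const)
  moreover have "eventually (\<lambda>n. ln (Z n s) / real n \<le> ln K / real n + ln (real n + 1) / real n + c) sequentially"
    using eventually_gt_at_top[of 0]
  proof eventually_elim
    case (elim n)
    have "ln (Z n s) \<le> ln (K * (real n + 1) * exp (c * real n))"
      using le[of n] Z_pos[OF s, of n] K by (subst ln_le_cancel_iff) (auto intro!: mult_pos_pos)
    also have "\<dots> = ln K + ln (real n + 1) + c * real n"
      using K by (subst ln_mult_pos) (auto simp: ln_mult_pos)
    finally have "ln (Z n s) / real n \<le> (ln K + ln (real n + 1) + c * real n) / real n"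
      by (rule divide_right_mono) simp
    then show ?case using elim by (simp add: add_divide_distrib)
  qed
  ultimately show ?thesis using press(1)[OF s] tendsto_le[OF trivial_limit_sequentially] by fastforce
qed

lemma press_ge:
  assumes s: "\<sigma> < s" and K: "0 < K" and le: "\<And>n. K \<le> Z n s"
  shows "0 \<le> press s"
proof -
  have "(\<lambda>n. ln K / real n) \<longlonglongrightarrow> 0" by (rule lim_const_over_n)
  moreover have "ln K / real n \<le> ln (Z n s) / real n" for n
    using le[of n] K by (intro divide_right_mono) auto
  ultimately show ?thesis using press(1)[OF s] LIMSEQ_le by blast
qed

text \<open>Raising the exponent from s to s' multiplies every term of order n by at most exp (- (s'
  - s) c0 n).\<close>

lemma press_strict:
  assumes s: "\<sigma> < s" "s \<le> s'"
  shows "press s' \<le> press s - (s' - s) * c0"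
proof -
  have s': "\<sigma> < s'" using s by simp
  have le: "Z n s' \<le> exp (- (s' - s) * c0 * real n) * Z n s" for n
  proof -
    have "Z n s' \<le> (\<Sum>\<^sub>\<infinity>w\<in>W n. exp (- (s' - s) * c0 * real n) * exp (- s * G w))"
      unfolding Z_def
    proof (rule infsum_mono[OF summ[OF s'] summable_on_cmult_right[OF summ[OF s(1)]]])
      fix w assume w: "w \<in> W n"
      have "(s' - s) * (c0 * real n) \<le> (s' - s) * G w" using s G_ge[OF w] by (intro mult_left_mono) auto
      then show "exp (- s' * G w) \<le> exp (- (s' - s) * c0 * real n) * exp (- s * G w)"
        by (simp add: exp_add[symmetric] algebra_simps)
    qed
    then show ?thesis unfolding Z_def by (simp add: infsum_cmult_right')
  qed
  have "ln (Z n s') / real n \<le> ln (Z n s) / real n - (s' - s) * c0" if "1 \<le> n" for n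
  proof -
    have "ln (Z n s') \<le> ln (exp (- (s' - s) * c0 * real n) * Z n s)"
      using le[of n] Z_pos[OF s', of n] Z_pos[OF s(1), of n] by (subst ln_le_cancel_iff) auto
    also have "\<dots> = - (s' - s) * c0 * real n + ln (Z n s)"
      using Z_pos[OF s(1), of n] by (subst ln_mult_pos) auto
    finally have "ln (Z n s') / real n \<le> (- (s' - s) * c0 * real n + ln (Z n s)) / real n"
      by (rule divide_right_mono) simp
    moreover have "(- (s' - s) * c0 * real n + ln (Z n s)) / real n = ln (Z n s) / real n - (s' - s) * c0"
      using that by (simp add: field_simps)
    ultimately show ?thesis by simp
  qed
  then show ?thesis
    by (intro LIMSEQ_le[OF press(1)[OF s'] tendsto_diff[OF press(1)[OF s(1)] tendsto_const]]) blast
qed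

text \<open>Words of weight \<open>G w > K n\<close> contribute at most \<open>exp (- n)\<close>, and on the others the exponent can be
  changed at the cost of a factor \<open>exp ((s' - s) K n)\<close>.\<close>

lemma press_continuity:
  assumes s1: "\<sigma> < s1" and \<eta>: "0 < \<eta>"
  shows "\<exists>K\<ge>0. \<forall>s s'. s1 + \<eta> \<le> s \<longrightarrow> s \<le> s' \<longrightarrow> press s \<le> max (press s' + (s' - s) * K) (- 1)"
proof -
  define a where "a = max 1 (Z 1 s1)"
  \<comment> \<open>Then \<eta> K = 1 + ln a, so exp (- \<eta> K n) outweighs the growth a^n of
    \<open>Z n s1\<close> by exp (- n); this is the origin of the -1 in the conclusion.\<close>
  define K where "K = (1 + ln a) / \<eta>"
  have a: "1 \<le> a" by (simp add: a_def)
  have K: "0 \<le> K" using a \<eta> by (simp add: K_def)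
  have Za: "Z n s1 \<le> a ^ n" for n
  proof (induction n)
    case (Suc n)
    have "Z (1 + n) s1 \<le> Z 1 s1 * Z n s1" by (rule Z_submult[OF s1])
    also have "\<dots> \<le> a * a ^ n" using Suc Z_pos[OF s1, of n] Z_pos[OF s1, of 1] a by (intro mult_mono) (auto simp: a_def)
    finally show ?case by simp
  qed (simp add: Z_zero[OF s1])
  have tail: "exp (- \<eta> * K * real n) * Z n s1 \<le> exp (- real n)" for n
  proof -
    have "exp (- \<eta> * K * real n) * Z n s1 \<le> exp (- \<eta> * K * real n) * a ^ n"
      using Za by (intro mult_left_mono) auto
    also have "a ^ n = exp (real n * ln a)" using a by (simp add: exp_of_nat_mult)
    also have "exp (- \<eta> * K * real n) * exp (real n * ln a) = exp (- real n)"
    proof -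
      have "\<eta> * K = 1 + ln a" using \<eta> by (simp add: K_def)
      then have "- \<eta> * K * real n = - (1 + ln a) * real n" by (simp only: mult_minus_left)
      then show ?thesis by (simp add: exp_add[symmetric] algebra_simps)
    qed
    finally show ?thesis .
  qed
  have "press s \<le> max (press s' + (s' - s) * K) (- 1)" if s: "s1 + \<eta> \<le> s" "s \<le> s'" for s s'
  proof -
    have sg: "\<sigma> < s" "\<sigma> < s'" using s s1 \<eta> by auto
    have Zle: "Z n s \<le> exp ((s' - s) * K * real n) * Z n s' + exp (- real n)" for n
    proof -
      have "Z n s \<le> (\<Sum>\<^sub>\<infinity>w\<in>W n. exp ((s' - s) * K * real n) * exp (- s' * G w)
          + exp (- \<eta> * K * real n) * exp (- s1 * G w))"
        unfolding Z_def
      proof (rule infsum_mono[OF summ[OF sg(1)] summable_on_add[OF summable_on_cmult_right[OF summ[OF sg(2)]]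
            summable_on_cmult_right[OF summ[OF s1]]]])
        fix w assume w: "w \<in> W n"
        have G0: "0 \<le> G w" using G_ge[OF w] mult_nonneg_nonneg[of c0 "real n"] c0 by linarith
        show "exp (- s * G w) \<le> exp ((s' - s) * K * real n) * exp (- s' * G w)
            + exp (- \<eta> * K * real n) * exp (- s1 * G w)"
        proof (cases "G w \<le> K * real n")
          case True
          then have "(s' - s) * G w \<le> (s' - s) * (K * real n)" using s by (intro mult_left_mono) auto
          then have "exp (- s * G w) \<le> exp ((s' - s) * K * real n) * exp (- s' * G w)"
            by (simp add: exp_add[symmetric] algebra_simps)
          then show ?thesis by (rule add_increasing2[rotated]) simp
        next
          case False
          have "\<eta> * (K * real n) \<le> \<eta> * G w" using False \<eta> by (intro mult_left_mono) auto
          moreover have "(s1 + \<eta>) * G w \<le> s * G w" using s G0 by (intro mult_right_mono) auto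
          ultimately have "exp (- s * G w) \<le> exp (- \<eta> * K * real n) * exp (- s1 * G w)"
            by (simp add: exp_add[symmetric] algebra_simps)
          then show ?thesis by (rule add_increasing[rotated]) simp
        qed
      qed
      also have "\<dots> = exp ((s' - s) * K * real n) * Z n s' + exp (- \<eta> * K * real n) * Z n s1"
        unfolding Z_def using summ sg s1
        by (subst infsum_add) (auto simp: infsum_cmult_right' intro!: summable_on_cmult_right)
      finally show ?thesis using tail[of n] by linarith
    qed
    have "ln (Z n s) / real n \<le> ln 2 / real n + max (ln (Z n s') / real n + (s' - s) * K) (- 1)" if n: "1 \<le> n" for n
    proof -
      define X where "X = exp ((s' - s) * K * real n) * Z n s'"
      have X: "X > 0" using Z_pos[OF sg(2), of n] by (simp add: X_def)
      have "ln (Z n s) \<le> ln (2 * max X (exp (- real n)))"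
        using Zle[of n] Z_pos[OF sg(1), of n] X unfolding X_def[symmetric] by (subst ln_le_cancel_iff) (auto simp: max_def)
      also have "\<dots> = ln 2 + ln (max X (exp (- real n)))"
        using X by (intro ln_mult_pos) (auto simp: less_max_iff_disj)
      also have "ln (max X (exp (- real n))) = max (ln X) (- real n)"
        using X ln_le_cancel_iff[of X "exp (- real n)"] by (simp add: max_def)
      also have "ln X = (s' - s) * K * real n + ln (Z n s')"
        unfolding X_def using Z_pos[OF sg(2), of n] by (subst ln_mult_pos) auto
      finally have "ln (Z n s) / real n \<le> (ln 2 + max ((s' - s) * K * real n + ln (Z n s')) (- real n)) / real n"
        by (rule divide_right_mono) simp
      also have "\<dots> = ln 2 / real n + max (ln (Z n s') / real n + (s' - s) * K) (- 1)"
        using n by (simp add: add_divide_distrib max_divide_distrib_right add.commute)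
      finally show ?thesis .
    qed
    note ev = this
    have "(\<lambda>n. ln 2 / real n + max (ln (Z n s') / real n + (s' - s) * K) (- 1)) \<longlonglongrightarrow>
        0 + max (press s' + (s' - s) * K) (- 1)"
      by (intro tendsto_add tendsto_max tendsto_const press(1)[OF sg(2)] lim_const_over_n)
    from LIMSEQ_le[OF press(1)[OF sg(1)] this] ev show ?thesis by auto
  qed
  then show ?thesis using K by blast
qed

definition Zf :: "nat \<Rightarrow> real \<Rightarrow> real" where "Zf n s = (\<Sum>\<^sub>\<infinity>w\<in>Full n. exp (- s * G w))"

lemma summ_full: "\<sigma> < s \<Longrightarrow> (\<lambda>w. exp (- s * G w)) summable_on Full n"
  using summ full_sub by (rule summable_on_subset_banach)

lemma Z_Suc_le:
  assumes s: "\<sigma> < s"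
  shows "Z (Suc n) s \<le> Zf (Suc n) s + Z n s"
  unfolding Z_def[of "Suc n"]
proof (rule infsum_le_finite_sums[OF summ[OF s]])
  fix F assume F: "finite F" "F \<subseteq> W (Suc n)"
  have "(\<Sum>w\<in>F. exp (- s * G w)) = (\<Sum>w\<in>F \<inter> Full (Suc n). exp (- s * G w)) + (\<Sum>w\<in>F - Full (Suc n). exp (- s * G w))"
    using F by (simp add: sum.Int_Diff)
  also have "\<dots> \<le> Zf (Suc n) s + Z n s"
    unfolding Zf_def Z_def using F full_rec[OF s, of "F - Full (Suc n)" n]
    by (intro add_mono finite_sum_le_infsum[OF summ_full[OF s]]) auto
  finally show "(\<Sum>w\<in>F. exp (- s * G w)) \<le> Zf (Suc n) s + Z n s" .
qed

lemma Z_le_full: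
  assumes s: "\<sigma> < s" and full: "\<And>k. Zf k s \<le> C * exp (\<delta> * real k)" and C: "1 \<le> C" and \<delta>: "0 \<le> \<delta>"
  shows "Z n s \<le> C * (real n + 1) * exp (\<delta> * real n)"
proof (induction n)
  case 0
  show ?case using Z_zero[OF s] C by simp
next
  case (Suc n)
  have e: "exp (\<delta> * real n) \<le> exp (\<delta> * real (Suc n))" using \<delta> by (simp add: algebra_simps)
  have "Z (Suc n) s \<le> C * exp (\<delta> * real (Suc n)) + C * (real n + 1) * exp (\<delta> * real n)"
    using Z_Suc_le[OF s, of n] full[of "Suc n"] Suc by linarith
  also have "C * (real n + 1) * exp (\<delta> * real n) \<le> C * (real n + 1) * exp (\<delta> * real (Suc n))"
    using e C by (intro mult_left_mono) auto
  finally show ?case by (simp add: algebra_simps)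
qed

text \<open>At exponent 1 the full words of each order have total weight at most 2, so Z n grows at
  most linearly.\<close>

lemma press_one: "press 1 \<le> 0"
proof (rule press_le)
  have "Zf k 1 \<le> 2" for k
    unfolding Zf_def using full_one by (intro infsum_le_finite_sums summ_full) (auto simp: \<sigma>)
  then show "Z n 1 \<le> 2 * (real n + 1) * exp (0 * real n)" for n
    by (intro Z_le_full) (auto simp: \<sigma>)
qed (use \<sigma> in auto)

text \<open>The truncated pressure \<open>max (press s) (- 1)\<close> has the same zeros as the
  pressure and is Lipschitz on \<open>{s0..1}\<close> by \<open>press_continuity\<close>. It is
  nonnegative at s0 by hypothesis and nonpositive at 1 by \<open>press_one\<close>.\<close>

lemma press_root_exists:
  assumes s0: "\<sigma> < s0" "0 < \<kappa>" "\<And>n. \<kappa> \<le> Z n s0"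
  shows "\<exists>s>\<sigma>. s \<le> 1 \<and> press s = 0"
proof -
  have p0: "0 \<le> press s0" using press_ge[OF s0(1,2)] s0(3) by blast
  have s01: "s0 \<le> 1"
  proof (rule ccontr)
    assume "\<not> s0 \<le> 1"
    then have "press s0 \<le> press 1 - (s0 - 1) * c0" "0 < (s0 - 1) * c0"
      using press_strict[of 1 s0] \<sigma> c0 by auto
    then show False using press_one p0 by linarith
  qed
  \<comment> \<open>A midpoint, since \<open>press_continuity\<close> needs room between the base
    exponent s1 and s0.\<close>
  define s1 where "s1 = (\<sigma> + s0) / 2"
  have s1: "\<sigma> < s1" "0 < s0 - s1" using s0 by (auto simp: s1_def)
  obtain K where K: "0 \<le> K" "\<And>s s'. s0 \<le> s \<Longrightarrow> s \<le> s' \<Longrightarrow> press s \<le> max (press s' + (s' - s) * K) (- 1)"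
    using press_continuity[OF s1] by auto
  define q where "q s = max (press s) (- 1)" for s
  have q1: "q s' \<le> q s \<and> q s \<le> q s' + K * (s' - s)" if "s0 \<le> s" "s \<le> s'" for s s'
  proof
    have "press s' \<le> press s" using press_strict[of s s'] that s0 c0 by (smt (verit) mult_nonneg_nonneg)
    then show "q s' \<le> q s" by (auto simp: q_def)
    have "0 \<le> K * (s' - s)" using that K by simp
    then show "q s \<le> q s' + K * (s' - s)"
      using K(2)[OF that] unfolding q_def by (auto simp: max_def mult.commute split: if_splits)
  qed
  have "K-lipschitz_on {s0..1} q"
  proof (rule lipschitz_onI)
    fix s s' assume "s \<in> {s0..1}" "s' \<in> {s0..1}"
    then show "dist (q s) (q s') \<le> K * dist s s'"
      using q1[of s s'] q1[of s' s] by (cases "s \<le> s'") (auto simp: dist_real_def)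
  qed (rule K(1))
  then have "continuous_on {s0..1} q" by (rule lipschitz_on_continuous_on)
  moreover have "0 \<le> q s0" "q 1 \<le> 0" using p0 press_one by (auto simp: q_def)
  ultimately have "\<exists>s\<ge>s0. s \<le> 1 \<and> q s = 0" using s01 by (intro IVT2') auto
  then obtain s where "s0 \<le> s" "s \<le> 1" "q s = 0" by blast
  then show ?thesis using s0 by (intro exI[of _ s]) (auto simp: q_def max_def split: if_splits)
qed

text \<open>With p the pressure at t, full sums bounded by C exp (p k / 2) for all k would bound all
  sums at that rate and give p \<le> p / 2. The order found is positive because the sum of order 0
  is at most 1 \<le> C.\<close>

lemma full_large:
  assumes t: "\<sigma> < t" and p: "0 < press t" and C: "1 \<le> C"
  shows "\<exists>k F. 0 < k \<and> finite F \<and> F \<subseteq> Full k \<and> C * exp (press t / 2 * real k) < (\<Sum>w\<in>F. exp (- t * G w))"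
proof -
  have "\<exists>k. C * exp (press t / 2 * real k) < Zf k t"
  proof (rule ccontr)
    assume "\<not> ?thesis"
    then have "Zf k t \<le> C * exp (press t / 2 * real k)" for k by (simp add: not_less)
    then have "press t \<le> press t / 2"
      using C p by (intro press_le[OF t, of C] Z_le_full[OF t]) auto
    then show False using p by simp
  qed
  then obtain k where k: "C * exp (press t / 2 * real k) < Zf k t" by blast
  have "\<exists>F. finite F \<and> F \<subseteq> Full k \<and> C * exp (press t / 2 * real k) < (\<Sum>w\<in>F. exp (- t * G w))"
  proof (rule ccontr)
    assume "\<not> ?thesis"
    then have "Zf k t \<le> C * exp (press t / 2 * real k)"
      unfolding Zf_def by (intro infsum_le_finite_sums summ_full[OF t]) (auto simp: not_less)
    then show False using k by simp
  qed
  moreover have "k \<noteq> 0"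
  proof
    assume "k = 0"
    moreover have "Zf 0 t \<le> Z 0 t" unfolding Zf_def Z_def
      using full_sub[of 0] summ[OF t] summ_full[OF t] by (intro infsum_mono2) auto
    ultimately show False using k Z_zero[OF t] C by simp
  qed
  ultimately show ?thesis by blast
qed

end

section \<open>Cylinders and Birkhoff sums\<close>

text \<open>The first digit is constant near an irrational point, so the map is 1 / y minus a
  constant there.\<close>

lemma log_deriv_Gauss:
  assumes "x \<in> coded_points Gauss"
  shows "log_deriv Gauss x = - 2 * ln x"
proof -
  have x: "0 < x" "x < 1" "x \<notin> \<rat>" using assms by auto
  define a where "a = \<lfloor>1 / x\<rfloor>"
  have "1 / x \<noteq> of_int a"
  proof
    assume "1 / x = of_int a"
    moreover have "x = 1 / (1 / x)" by simp
    ultimately have "x = 1 / of_int a" by simp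
    moreover have "1 / of_int a \<in> (\<rat> :: real set)" by (intro Rats_divide) auto
    ultimately show False using x(3) by simp
  qed
  moreover have "of_int a \<le> 1 / x" "1 / x < of_int a + 1" unfolding a_def by linarith+
  ultimately have a: "of_int a < 1 / x" "1 / x < of_int a + 1" by auto
  define S :: "real set" where "S = {y. 0 < y \<and> of_int a * y < 1 \<and> 1 < (of_int a + 1) * y}"
  have S: "open S" unfolding S_def by (intro open_Collect_conj open_Collect_less continuous_intros)
  have xS: "x \<in> S" using a x by (auto simp: S_def field_simps)
  have eq: "1 / y - of_int a = imap Gauss y" if "y \<in> S" for y
  proof -
    have "of_int a < 1 / y" "1 / y < of_int a + 1" using that by (auto simp: S_def field_simps)
    then have "\<lfloor>1 / y\<rfloor> = a" by linarith
    then show ?thesis using that by (simp add: imap.simps S_def frac_def)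
  qed
  have "((\<lambda>y. 1 / y - of_int a) has_field_derivative - (1 / x\<^sup>2)) (at x)"
    using x by (auto intro!: derivative_eq_intros simp: power2_eq_square)
  then have "(imap Gauss has_field_derivative - (1 / x\<^sup>2)) (at x)"
    using S xS eq by (rule has_field_derivative_transform_within_open)
  then have "deriv (imap Gauss) x = - (1 / x\<^sup>2)" by (rule DERIV_imp_deriv)
  then have "log_deriv Gauss x = ln (1 / x\<^sup>2)" by simp
  also have "\<dots> = - 2 * ln x" using x by (simp add: ln_div ln_realpow)
  finally show ?thesis .
qed

declare log_deriv.simps(2) [simp del]

lemma cylinder_append:
  assumes "x \<in> cylinder T (u @ v)" "(imap T ^^ length u) x \<in> coded_points T"
  shows "x \<in> cylinder T u" "(imap T ^^ length u) x \<in> cylinder T v"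
proof -
  have *: "digit T ((imap T ^^ k) x) = (u @ v) ! k" if "k < length u + length v" for k
    using assms(1) that by (auto simp: cylinder_def)
  show "x \<in> cylinder T u" using assms(1) * by (auto simp: cylinder_def nth_append)
  have "(imap T ^^ k) ((imap T ^^ length u) x) = (imap T ^^ (length u + k)) x" for k
    by (simp add: add.commute[of "length u"] funpow_add)
  then show "(imap T ^^ length u) x \<in> cylinder T v"
    using assms(2) * by (auto simp: cylinder_def nth_append)
qed

lemma birkhoff_add: "birkhoff T \<phi> (n + m) x = birkhoff T \<phi> n x + birkhoff T \<phi> m ((imap T ^^ n) x)"
proof -
  have "birkhoff T \<phi> (n + m) x = birkhoff T \<phi> n x + (\<Sum>k<m. \<phi> ((imap T ^^ (n + k)) x))"
    unfolding birkhoff_def by (induction m) (auto simp: add_ac)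
  also have "(\<Sum>k<m. \<phi> ((imap T ^^ (n + k)) x)) = birkhoff T \<phi> m ((imap T ^^ n) x)"
    unfolding birkhoff_def by (simp add: add.commute[of n] funpow_add)
  finally show ?thesis .
qed

lemma irrational_unit_exists: "\<exists>y\<in>{0<..<1::real}. y \<notin> \<rat>"
proof (rule ccontr)
  assume "\<not> ?thesis"
  then have "{0<..<1::real} \<subseteq> \<rat>" by blast
  then have "countable {0<..<1::real}" using countable_rat countable_subset by blast
  then show False using uncountable_open_interval[of 0 "1::real"] by simp
qed

lemma coded_orbit:
  assumes "admissible_map T" "x \<in> coded_points T"
  shows "(imap T ^^ k) x \<in> coded_points T"
proof (cases T)
  case (Beta b)
  then show ?thesis using assms beta_orbit_range[of b x k] by simp
next
  case Gauss
  have step: "imap Gauss x \<in> coded_points Gauss" if "x \<in> coded_points Gauss" for x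
  proof -
    have "frac (1 / x) \<notin> \<rat>"
    proof
      assume "frac (1 / x) \<in> \<rat>"
      then have "1 / (frac (1 / x) + of_int \<lfloor>1 / x\<rfloor>) \<in> \<rat>" by (intro Rats_divide Rats_add) auto
      then have "x \<in> \<rat>" by (simp add: frac_def)
      then show False using that by simp
    qed
    moreover from this have "frac (1 / x) \<noteq> 0" by (metis Rats_0)
    ultimately show ?thesis using that frac_ge_0[of "1 / x"] frac_lt_1[of "1 / x"]
      by (auto simp: imap.simps less_le)
  qed
  have "(imap Gauss ^^ k) x \<in> coded_points Gauss"
    using assms(2) step unfolding Gauss by (induction k) auto
  then show ?thesis using Gauss by simp
qed

lemma coded_points_unit: "x \<in> coded_points T \<Longrightarrow> 0 \<le> x \<and> x < 1"
  by (cases T) auto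

lemma words_Beta_append:
  assumes b: "b > 1" and w: "u @ v \<in> words (Beta b) n"
  shows "u \<in> words (Beta b) (length u)" "v \<in> words (Beta b) (length v)"
proof -
  obtain x where x: "x \<in> cylinder (Beta b) (u @ v)" using w by auto
  then have "(imap (Beta b) ^^ length u) x \<in> coded_points (Beta b)"
    using b by (intro coded_orbit) (auto simp: cylinder_def)
  from cylinder_append[OF x this] show "u \<in> words (Beta b) (length u)" "v \<in> words (Beta b) (length v)" by auto
qed

lemma words_split:
  assumes "admissible_map T" "w \<in> words T (n + m)"
  shows "take n w \<in> words T n" "drop n w \<in> words T m"
proof -
  have len: "length w = n + m" using assms by (cases T) auto
  have "take n w \<in> words T n \<and> drop n w \<in> words T m"
  proof (cases T)
    case (Beta b)
    then show ?thesis using words_Beta_append[of b "take n w" "drop n w" "n + m"] assms len by auto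
  next
    case Gauss
    then show ?thesis using assms len set_take_subset[of n w] set_drop_subset[of n w] by auto
  qed
  then show "take n w \<in> words T n" "drop n w \<in> words T m" by auto
qed

lemma words_length: "w \<in> words T n \<Longrightarrow> length w = n"
  by (cases T) auto

lemma words_cylinder: "w \<in> words T n \<Longrightarrow> cylinder T w \<noteq> {}"
proof (cases T)
  case Gauss
  assume "w \<in> words T n"
  then show ?thesis using Gauss cylinder_Gauss[of w] irrational_unit_exists by auto
qed auto

lemma finite_words_Beta:
  assumes b: "b > 1" shows "finite (words (Beta b) n)"
proof (rule finite_subset)
  show "words (Beta b) n \<subseteq> {w. set w \<subseteq> {0..\<lceil>b\<rceil>} \<and> length w = n}"
  proof
    fix w assume w: "w \<in> words (Beta b) n"
    then obtain x where x: "x \<in> cylinder (Beta b) w" by auto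
    have "w ! k \<in> {0..\<lceil>b\<rceil>}" if k: "k < length w" for k
    proof -
      define z where "z = (imap (Beta b) ^^ k) x"
      have "x \<in> {0..<1}" using x by (simp add: cylinder_def)
      then have "z \<in> {0..<1}" unfolding z_def using b by (intro beta_orbit_range)
      then have "0 \<le> b * z" "b * z \<le> b * 1" using b by (auto intro: mult_left_mono simp del: mult_1_right)
      moreover have "\<lfloor>b * z\<rfloor> = w ! k" using x k by (simp add: cylinder_def z_def digit.simps)
      ultimately show ?thesis by simp linarith
    qed
    then show "w \<in> {w. set w \<subseteq> {0..\<lceil>b\<rceil>} \<and> length w = n}" using w by (auto simp: set_conv_nth)
  qed
  show "finite {w. set w \<subseteq> {0..\<lceil>b\<rceil>} \<and> length w = n}" by (rule finite_lists_length_eq) simp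
qed

fun map_branches :: "interval_map \<Rightarrow> nat \<Rightarrow> (real \<Rightarrow> real) set" where
  "map_branches (Beta b) n = beta_branches b n"
| "map_branches Gauss n = gauss_branches n"

text \<open>For a beta word that is not full, this is the affine branch its cylinder would have if
  it were full; the length b^-n still measures the derivative of the iterate.\<close>

fun word_branch :: "interval_map \<Rightarrow> int list \<Rightarrow> real \<Rightarrow> real" where
  "word_branch (Beta b) w y = beta_base b w + y / b ^ length w"
| "word_branch Gauss w y = gauss_branch w y"

text \<open>For the Gauss map the rational points are put back into the cylinder.\<close>

fun filled_cylinder :: "interval_map \<Rightarrow> int list \<Rightarrow> real set" where
  "filled_cylinder (Beta b) w = cylinder (Beta b) w"
| "filled_cylinder Gauss w = gauss_branch w ` {0<..<1}"

text \<open>Bounds the diameter of cylinders of positive order and tends to 0. The value 1 / n in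
  the Gauss case comes from the continuant being at least the length of the word.\<close>

fun diam_bound :: "interval_map \<Rightarrow> nat \<Rightarrow> real" where
  "diam_bound (Beta b) n = (1 / b) ^ n"
| "diam_bound Gauss n = 1 / real n"

lemma word_branch_Gauss: "word_branch Gauss w = gauss_branch w"
  by (rule ext) simp

lemma word_branch_Beta: "word_branch (Beta b) w = (\<lambda>y. beta_base b w + y / b ^ length w)"
  by (rule ext) simp

declare word_branch.simps [simp del]

lemma cylinder_subset_filled: "w \<in> words T n \<Longrightarrow> cylinder T w \<subseteq> filled_cylinder T w"
  using cylinder_Gauss[of w] by (cases T) auto

lemma filled_cylinder_disjoint:
  assumes "w \<in> words T n" "w' \<in> words T n" "w \<noteq> w'"
  shows "filled_cylinder T w \<inter> filled_cylinder T w' = {}"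
proof (cases T)
  case (Beta b)
  then show ?thesis using assms cylinder_disjoint[of w w'] by auto
next
  case Gauss
  then have w: "set w \<subseteq> {1..}" "set w' \<subseteq> {1..}" "length w = length w'" using assms by auto
  have "gauss_branch w y \<noteq> gauss_branch w' y'" if "y \<in> {0<..<1}" "y' \<in> {0<..<1}" for y y'
    using gauss_branch_unique[OF w that] assms(3) by blast
  then show ?thesis using Gauss by auto
qed

lemma full_words_subset: "full_words T n \<subseteq> words T n"
  by (cases T) auto

lemma full_word_branch:
  assumes "admissible_map T" "w \<in> full_words T n"
  shows "word_branch T w \<in> map_branches T n" "word_branch T w ` {0<..<1} \<subseteq> filled_cylinder T w"
    "{blo (word_branch T w)<..<bhi (word_branch T w)} \<subseteq> word_branch T w ` {0<..<1}"
    "0 \<le> blo (word_branch T w)" "bhi (word_branch T w) \<le> 1" "0 < blen (word_branch T w)"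
proof -
  have "word_branch T w \<in> map_branches T n \<and> word_branch T w ` {0<..<1} \<subseteq> filled_cylinder T w \<and>
    {blo (word_branch T w)<..<bhi (word_branch T w)} \<subseteq> word_branch T w ` {0<..<1} \<and>
    0 \<le> blo (word_branch T w) \<and> bhi (word_branch T w) \<le> 1 \<and> 0 < blen (word_branch T w)"
  proof (cases T)
    case (Beta b)
    then have b: "b > 1" using assms by simp
    have len: "length w = n" using assms Beta by simp
    obtain x0 where x0: "\<And>y. y \<in> {0..<1} \<Longrightarrow> x0 + y / b ^ n \<in> cylinder (Beta b) w"
      "\<And>y. y \<in> {0..<1} \<Longrightarrow> (imap (Beta b) ^^ n) (x0 + y / b ^ n) = y"
      using assms(2) unfolding Beta full_words.simps by blast
    \<comment> \<open>The iterate sends x0 to 0, which identifies the witness of fullness with the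
      left end point of the cylinder.\<close>
    have "b ^ n * (x0 - beta_base b w) = 0"
      using beta_orbit[OF b x0(1)[of 0]] x0(2)[of 0] len by simp
    then have base: "beta_base b w = x0" using b by simp
    have \<psi>: "word_branch (Beta b) w = (\<lambda>y. x0 + y / b ^ n)" by (simp add: word_branch_Beta base len)
    have lt1: "x0 + y / b ^ n < 1" if "y \<in> {0..<1}" for y using x0(1)[OF that] by (simp add: cylinder_def)
    have x00: "0 \<le> x0" using x0(1)[of 0] by (simp add: cylinder_def)
    have le1: "x0 + 1 / b ^ n \<le> 1"
    proof (rule ccontr)
      assume neg: "\<not> ?thesis"
      \<comment> \<open>For this y the branch would take the value 1, which lies in no
        cylinder.\<close>
      define y where "y = (1 - x0) * b ^ n"
      have "y < 1" using neg b by (simp add: y_def field_simps)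
      moreover have "0 \<le> y" using lt1[of 0] b by (simp add: y_def)
      ultimately have "x0 + y / b ^ n < 1" by (intro lt1) simp
      then show False using b by (simp add: y_def)
    qed
    have mem: "word_branch (Beta b) w \<in> beta_branches b n"
      unfolding beta_branches_def \<psi> using x00 le1 x0(2) by auto
    have l: "blen (word_branch (Beta b) w) = 1 / b ^ n" "blo (word_branch (Beta b) w) = x0"
      "bhi (word_branch (Beta b) w) = x0 + 1 / b ^ n"
      unfolding beta_branch_blen[OF b mem] unfolding \<psi> by simp_all
    have "{blo (word_branch (Beta b) w)<..<bhi (word_branch (Beta b) w)} \<subseteq> word_branch (Beta b) w ` {0<..<1}"
    proof
      fix z assume z: "z \<in> {blo (word_branch (Beta b) w)<..<bhi (word_branch (Beta b) w)}"
      then have "x0 < z" "z < x0 + 1 / b ^ n" unfolding l by auto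
      then show "z \<in> word_branch (Beta b) w ` {0<..<1}"
        unfolding \<psi> using b by (intro image_eqI[of _ _ "(z - x0) * b ^ n"]) (auto simp: field_simps)
    qed
    moreover have "word_branch (Beta b) w ` {0<..<1} \<subseteq> cylinder (Beta b) w" unfolding \<psi> using x0(1) by auto
    ultimately show ?thesis unfolding Beta l using mem b x00 le1 by simp
  next
    case Gauss
    then have w: "set w \<subseteq> {1..}" "length w = n" using assms by auto
    have "gauss_branch w 0 \<in> {0..1}" "gauss_branch w 1 \<in> {0..1}"
      using w by (auto intro!: gauss_branch_range simp del: atLeastAtMost_iff simp: atLeastAtMost_iff[of 0] atLeastAtMost_iff[of 1])
    then show ?thesis unfolding Gauss word_branch_Gauss
      using w gauss_branch_image[OF w(1)] by (auto simp: blo_def bhi_def)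
  qed
  then show "word_branch T w \<in> map_branches T n" "word_branch T w ` {0<..<1} \<subseteq> filled_cylinder T w"
    "{blo (word_branch T w)<..<bhi (word_branch T w)} \<subseteq> word_branch T w ` {0<..<1}"
    "0 \<le> blo (word_branch T w)" "bhi (word_branch T w) \<le> 1" "0 < blen (word_branch T w)" by auto
qed

lemma full_words_disjoint:
  assumes "admissible_map T"
  shows "disjoint_family_on (\<lambda>w. {blo (word_branch T w)<..<bhi (word_branch T w)}) (full_words T n)"
  unfolding disjoint_family_on_def
proof (intro ballI impI)
  fix w w' assume w: "w \<in> full_words T n" "w' \<in> full_words T n" "w \<noteq> w'"
  have "filled_cylinder T w \<inter> filled_cylinder T w' = {}"
    using filled_cylinder_disjoint[OF subsetD[OF full_words_subset w(1)] subsetD[OF full_words_subset w(2)] w(3)] .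
  then show "{blo (word_branch T w)<..<bhi (word_branch T w)} \<inter> {blo (word_branch T w')<..<bhi (word_branch T w')} = {}"
    using order_trans[OF full_word_branch(3)[OF assms w(1)] full_word_branch(2)[OF assms w(1)]]
      order_trans[OF full_word_branch(3)[OF assms w(2)] full_word_branch(2)[OF assms w(2)]] by blast
qed

text \<open>By the chain rule the Birkhoff sum is the logarithm of the derivative of the iterate. It
  is n ln b for the beta map; for the Gauss map it is minus the logarithm of the squared product of
  the orbit, which is within a factor 2 of the branch length.\<close>

lemma birkhoff_log_deriv:
  assumes "admissible_map T" "w \<in> words T n" "x \<in> cylinder T w"
  shows "\<bar>birkhoff T (log_deriv T) n x + ln (blen (word_branch T w))\<bar> \<le> ln 2"
proof (cases T)
  case (Beta b)
  then have "blen (word_branch T w) = 1 / b ^ n" "b > 1" using assms by (auto simp: blen_def word_branch_Beta)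
  then show ?thesis unfolding Beta by (simp add: birkhoff_def ln_div ln_realpow)
next
  case Gauss
  then have w: "set w \<subseteq> {1..}" "length w = n" using assms by auto
  obtain y where y: "y \<in> coded_points Gauss" "x = gauss_branch w y"
    using assms(3) cylinder_Gauss[OF w(1)] unfolding Gauss by blast
  have x: "x \<in> coded_points Gauss" using assms(3) by (simp add: Gauss cylinder_def)
  define P where "P = (\<Prod>k<n. (imap Gauss ^^ k) x)"
  have c: "(imap Gauss ^^ k) x \<in> coded_points Gauss" for k by (rule coded_orbit[OF _ x]) simp
  have pos: "0 < (imap Gauss ^^ k) x" for k using c[of k] by simp
  have P: "P > 0" unfolding P_def using pos by (intro prod_pos) auto
  have "birkhoff Gauss (log_deriv Gauss) n x = (\<Sum>k<n. - 2 * ln ((imap Gauss ^^ k) x))"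
    unfolding birkhoff_def by (simp only: log_deriv_Gauss[OF c])
  also have "\<dots> = - 2 * (\<Sum>k<n. ln ((imap Gauss ^^ k) x))" by (simp add: sum_distrib_left)
  also have "(\<Sum>k<n. ln ((imap Gauss ^^ k) x)) = ln P"
    unfolding P_def using pos by (intro ln_prod[symmetric]) (auto simp: less_imp_neq[symmetric])
  finally have S: "birkhoff Gauss (log_deriv Gauss) n x = - ln (P\<^sup>2)" using P by (simp add: ln_realpow)
  have y01: "y \<in> {0<..<1}" using y by simp
  have b: "0 < blen (gauss_branch w)" by (rule gauss_branch_image(2)[OF w(1)])
  have D: "blen (gauss_branch w) / 2 \<le> P\<^sup>2" "P\<^sup>2 \<le> 2 * blen (gauss_branch w)"
    using gauss_branch_distortion(5,6)[OF w(1) y01] unfolding w(2) y(2)[symmetric] P_def[symmetric] by auto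
  have "ln (blen (gauss_branch w) / 2) \<le> ln (P\<^sup>2)"
    using D(1) b P by (subst ln_le_cancel_iff) auto
  moreover have "ln (P\<^sup>2) \<le> ln (2 * blen (gauss_branch w))"
    using D(2) b P by (subst ln_le_cancel_iff) auto
  ultimately show ?thesis unfolding Gauss word_branch_Gauss S using b by (simp add: ln_div ln_mult_pos)
qed

lemma log_deriv_nonneg: "admissible_map T \<Longrightarrow> x \<in> coded_points T \<Longrightarrow> 0 \<le> log_deriv T x"
  by (cases T) (use log_deriv_Gauss in \<open>auto simp: ln_le_zero_iff\<close>)

lemma diam_bound_tendsto: "admissible_map T \<Longrightarrow> diam_bound T \<longlonglongrightarrow> 0"
proof (cases T)
  case (Beta b)
  assume "admissible_map T"
  then have "(\<lambda>n. (1 / b) ^ n) \<longlonglongrightarrow> 0" using Beta by (intro LIMSEQ_realpow_zero) auto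
  moreover have "diam_bound (Beta b) = (\<lambda>n. (1 / b) ^ n)" by (rule ext) simp
  ultimately show ?thesis unfolding Beta by simp
next
  case Gauss
  have "diam_bound Gauss = (\<lambda>n. 1 / real n)" by (rule ext) simp
  then show ?thesis unfolding Gauss using lim_const_over_n[of "1::real"] by simp
qed

text \<open>The k-th iterate carries a cylinder of order n into one of order n - k, which is
  positive as k < n.\<close>

lemma filled_cylinder_orbit:
  assumes "admissible_map T" "w \<in> words T n" "x \<in> filled_cylinder T w" "y \<in> filled_cylinder T w" "k < n"
  shows "(imap T ^^ k) x \<in> {0..1}" "\<bar>(imap T ^^ k) x - (imap T ^^ k) y\<bar> \<le> diam_bound T (n - k)"
proof -
  have len: "length w = n" using assms words_length by blast
  have "(imap T ^^ k) x \<in> {0..1} \<and> \<bar>(imap T ^^ k) x - (imap T ^^ k) y\<bar> \<le> diam_bound T (n - k)"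
  proof (cases T)
    case (Beta b)
    then have b: "b > 1" using assms by simp
    have xy: "x \<in> cylinder (Beta b) (take k w @ drop k w)" "y \<in> cylinder (Beta b) (take k w @ drop k w)"
      using assms Beta by auto
    have c: "(imap (Beta b) ^^ j) z \<in> {0..<1}" if "z \<in> cylinder (Beta b) (take k w @ drop k w)" for z j
      using that b by (intro beta_orbit_range) (auto simp: cylinder_def)
    have d: "(imap (Beta b) ^^ k) z \<in> cylinder (Beta b) (drop k w)"
      if "z \<in> cylinder (Beta b) (take k w @ drop k w)" for z
      using cylinder_append(2)[OF that] c[OF that, of k] len assms(5) by simp
    define u v where "u = (imap (Beta b) ^^ k) x" and "v = (imap (Beta b) ^^ k) y"
    have uv: "u \<in> cylinder (Beta b) (drop k w)" "v \<in> cylinder (Beta b) (drop k w)"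
      unfolding u_def v_def using d xy by auto
    have uvr: "(imap (Beta b) ^^ (n - k)) u \<in> {0..<1}" "(imap (Beta b) ^^ (n - k)) v \<in> {0..<1}"
      using uv b by (auto intro!: beta_orbit_range simp: cylinder_def simp del: atLeastLessThan_iff)
    have "(imap (Beta b) ^^ (n - k)) u - (imap (Beta b) ^^ (n - k)) v = b ^ (n - k) * (u - v)"
      using beta_orbit[OF b uv(1)] beta_orbit[OF b uv(2)] len by (simp add: algebra_simps)
    then have "\<bar>b ^ (n - k) * (u - v)\<bar> \<le> 1" using uvr by auto
    then have "b ^ (n - k) * \<bar>u - v\<bar> \<le> 1" using b by (simp add: abs_mult)
    then have "\<bar>u - v\<bar> \<le> (1 / b) ^ (n - k)" using b by (simp add: power_divide field_simps)
    then show ?thesis unfolding Beta using c[OF xy(1), of k] by (auto simp: u_def v_def)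
  next
    case Gauss
    then have w: "set w \<subseteq> {1..}" using assms by auto
    have dw: "set (drop k w) \<subseteq> {1..}" using w set_drop_subset[of k w] by blast
    obtain x' y' where xy: "x' \<in> {0<..<1}" "x = gauss_branch w x'" "y' \<in> {0<..<1}" "y = gauss_branch w y'"
      using assms Gauss by auto
    have eq: "(imap Gauss ^^ k) x = gauss_branch (drop k w) x'" "(imap Gauss ^^ k) y = gauss_branch (drop k w) y'"
      using gauss_branch_orbit[OF w] xy assms(5) len by auto
    have "gauss_branch (drop k w) x' \<in> {blo (gauss_branch (drop k w))<..<bhi (gauss_branch (drop k w))}"
      "gauss_branch (drop k w) y' \<in> {blo (gauss_branch (drop k w))<..<bhi (gauss_branch (drop k w))}"
      using xy gauss_branch_image(1)[OF dw] by blast+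
    then have "\<bar>(imap Gauss ^^ k) x - (imap Gauss ^^ k) y\<bar> \<le> blen (gauss_branch (drop k w))"
      unfolding eq bhi_minus_blo[symmetric] by auto
    also have "\<dots> \<le> 1 / real (n - k)" using gauss_branch_distortion(4)[OF dw] assms(5) len by simp
    finally show ?thesis using Gauss gauss_branch_range(2)[OF dw xy(1)] eq(1) by auto
  qed
  then show "(imap T ^^ k) x \<in> {0..1}" "\<bar>(imap T ^^ k) x - (imap T ^^ k) y\<bar> \<le> diam_bound T (n - k)" by auto
qed

text \<open>For the Gauss map the one-letter sum behaves like the series of k^(-2 s). For the beta
  map all sums are finite, and 0 marks the exponents up to which the pressure is certainly
  positive.\<close>

fun critical_exponent :: "interval_map \<Rightarrow> real" where
  "critical_exponent (Beta b) = 0"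
| "critical_exponent Gauss = 1/2"

text \<open>Bounds log |T'| along one convenient orbit: the fixed point 0 of the beta map, or a
  Gauss orbit with digits 1, ..., 1, where 1 / x \<le> 2.\<close>

fun log_bound :: "interval_map \<Rightarrow> real" where
  "log_bound (Beta b) = ln b"
| "log_bound Gauss = 2 * ln 2"

lemma beta_point_word:
  assumes "b > 1" "x \<in> {0..<1}"
  shows "\<exists>w\<in>words (Beta b) n. x \<in> cylinder (Beta b) w"
proof -
  let ?w = "map (\<lambda>i. digit (Beta b) ((imap (Beta b) ^^ i) x)) [0..<n]"
  have "x \<in> cylinder (Beta b) ?w" using assms by (auto simp: cylinder_def)
  then show ?thesis by (intro bexI[of _ ?w]) auto
qed

text \<open>Cylinders of order n have length at most b^-n and cover [0,1); the 1/2 is the one in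
  \<open>countable_cover_finite_sum\<close>.\<close>

lemma beta_words_many:
  assumes b: "b > 1"
  shows "b ^ n / 2 \<le> real (card (words (Beta b) n))"
proof -
  have fin: "finite (words (Beta b) n)" by (rule finite_words_Beta[OF b])
  have "\<exists>F. finite F \<and> F \<subseteq> words (Beta b) n \<and> (1 - 0) / 2 \<le> (\<Sum>w\<in>F. 1 / b ^ n)"
  proof (rule countable_cover_finite_sum[where Z="{1}" and X="cylinder (Beta b)" and c="beta_base b"])
    show "{0..1} - {1} \<subseteq> (\<Union>w\<in>words (Beta b) n. cylinder (Beta b) w)"
      using beta_point_word[OF b, of _ n] by force
    show "cylinder (Beta b) w \<subseteq> {beta_base b w..beta_base b w + 1 / b ^ n}" if "w \<in> words (Beta b) n" for w
    proof
      fix x assume x: "x \<in> cylinder (Beta b) w"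
      have len: "length w = n" using that by simp
      have "x \<in> {0..<1}" using x by (simp add: cylinder_def)
      then have "(imap (Beta b) ^^ n) x \<in> {0..<1}" by (rule beta_orbit_range[OF b])
      then have "0 \<le> b ^ n * (x - beta_base b w)" "b ^ n * (x - beta_base b w) \<le> 1"
        using beta_orbit[OF b x] len by auto
      then show "x \<in> {beta_base b w..beta_base b w + 1 / b ^ n}"
        using b by (auto simp: zero_le_mult_iff field_simps)
    qed
  qed (use b fin in \<open>auto intro: countable_finite\<close>)
  then obtain F where F: "finite F" "F \<subseteq> words (Beta b) n" "1 / 2 \<le> (\<Sum>w\<in>F. 1 / b ^ n)" by auto
  have "1 / 2 \<le> real (card F) / b ^ n" using F(3) by simp
  then have "b ^ n / 2 \<le> real (card F)" using b by (simp add: field_simps)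
  also have "\<dots> \<le> real (card (words (Beta b) n))" using F fin by (simp add: card_mono)
  finally show ?thesis .
qed

text \<open>A point of the right sibling shows that the image of the parent cylinder reaches (i + 1)
  / b. Being closed downwards, the image contains all of [i / b, (i + 1) / b).\<close>

lemma beta_sibling_full:
  assumes b: "b > 1" and w: "u @ [i] \<in> words (Beta b) (Suc n)" "u @ [j] \<in> words (Beta b) (Suc n)" and ij: "i < j"
  shows "u @ [i] \<in> full_words (Beta b) (Suc n)"
proof -
  have len: "length u = n" using w by simp
  obtain x x' where "x \<in> cylinder (Beta b) (u @ [j])" "x' \<in> cylinder (Beta b) (u @ [i])" using w by auto
  then have x: "x \<in> cylinder (Beta b) u" "digit (Beta b) ((imap (Beta b) ^^ n) x) = j"
    and x': "x' \<in> cylinder (Beta b) u" "digit (Beta b) ((imap (Beta b) ^^ n) x') = i"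
    unfolding cylinder_snoc len by auto
  define z where "z = (imap (Beta b) ^^ n) x"
  have "(imap (Beta b) ^^ n) x' \<in> {0..<1}"
    using x' b by (intro beta_orbit_range) (auto simp: cylinder_def)
  then have "0 \<le> b * (imap (Beta b) ^^ n) x'" using b by simp
  then have i: "0 \<le> i" using x'(2) by (simp add: digit.simps) linarith
  have "\<lfloor>b * z\<rfloor> = j" using x(2) by (simp add: z_def digit.simps)
  then have bz: "of_int i + 1 \<le> b * z" using ij by linarith
  have "beta_base b (u @ [i]) + y / b ^ Suc n \<in> cylinder (Beta b) (u @ [i]) \<and>
      (imap (Beta b) ^^ Suc n) (beta_base b (u @ [i]) + y / b ^ Suc n) = y" if y: "y \<in> {0..<1}" for y
  proof -
    define z' where "z' = (of_int i + y) / b"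
    have "0 \<le> z'" "z' \<le> z" using bz y b i by (auto simp: z'_def field_simps)
    then have c: "beta_base b u + z' / b ^ n \<in> cylinder (Beta b) u"
      "(imap (Beta b) ^^ n) (beta_base b u + z' / b ^ n) = z'"
      using beta_cylinder_below[OF b x(1), of z'] by (auto simp: len z_def)
    have eq: "beta_base b (u @ [i]) + y / b ^ Suc n = beta_base b u + z' / b ^ n"
      using b by (simp add: beta_base_snoc[OF b] len z'_def add_divide_distrib)
    have bz': "b * z' = of_int i + y" using b by (simp add: z'_def)
    have fl: "\<lfloor>b * z'\<rfloor> = i" unfolding bz' using y by (simp add: floor_eq_iff)
    show ?thesis unfolding eq using c fl bz' by (simp add: cylinder_snoc len digit.simps imap.simps(1)[of b z'] frac_def)
  qed
  then show ?thesis using w(1) unfolding full_words.simps by blast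
qed

section \<open>Cylinder weights of a positive continuous function\<close>

locale gibbs_map =
  fixes T :: interval_map and f :: "real \<Rightarrow> real" and m M :: real
  assumes adm: "admissible_map T" and cont: "continuous_on {0..1} f" and m: "0 < m"
    and f_ge: "x \<in> {0..1} \<Longrightarrow> m \<le> f x" and f_le: "x \<in> {0..1} \<Longrightarrow> f x \<le> M"
begin

definition S :: "nat \<Rightarrow> real \<Rightarrow> real" where "S = birkhoff T (\<lambda>x. f x + log_deriv T x)"

text \<open>For s > 0, \<open>exp (- s * G w)\<close> is the supremum of exp (- s S_n F) on the
  cylinder. With the infimum of S_n F, in place of a sample value, the inequality for concatenations
  holds without error term.\<close>

definition G :: "int list \<Rightarrow> real" where "G w = Inf (S (length w) ` cylinder T w)"

lemma S_eq: "S n x = birkhoff T f n x + birkhoff T (log_deriv T) n x"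
  by (simp add: S_def birkhoff_def sum.distrib)

lemma S_add: "S (n + k) x = S n x + S k ((imap T ^^ n) x)"
  unfolding S_def by (rule birkhoff_add)

lemma orbit_unit: "x \<in> coded_points T \<Longrightarrow> (imap T ^^ k) x \<in> {0..1}"
  using coded_points_unit[OF coded_orbit[OF adm, of x k]] by auto

lemma birkhoff_f_ge: "x \<in> coded_points T \<Longrightarrow> m * real n \<le> birkhoff T f n x"
  using sum_mono[of "{..<n}" "\<lambda>_. m" "\<lambda>k. f ((imap T ^^ k) x)"] f_ge orbit_unit
  by (simp add: birkhoff_def mult.commute)

lemma birkhoff_f_le: "x \<in> coded_points T \<Longrightarrow> birkhoff T f n x \<le> M * real n"
  using sum_mono[of "{..<n}" "\<lambda>k. f ((imap T ^^ k) x)" "\<lambda>_. M"] f_le orbit_unit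
  by (simp add: birkhoff_def mult.commute)

lemma S_ge: "x \<in> coded_points T \<Longrightarrow> m * real n \<le> S n x"
proof -
  assume x: "x \<in> coded_points T"
  have "0 \<le> birkhoff T (log_deriv T) n x"
    unfolding birkhoff_def using coded_orbit[OF adm x] log_deriv_nonneg[OF adm] by (intro sum_nonneg) auto
  then show ?thesis using birkhoff_f_ge[OF x, of n] by (simp add: S_eq)
qed

lemma cylinder_coded: "x \<in> cylinder T w \<Longrightarrow> x \<in> coded_points T"
  by (simp add: cylinder_def)

lemma G_le: "x \<in> cylinder T w \<Longrightarrow> G w \<le> S (length w) x"
  unfolding G_def using S_ge[OF cylinder_coded]
  by (intro cInf_lower bdd_belowI[of _ "m * real (length w)"]) auto

lemma G_ge:
  assumes "w \<in> words T n" "\<And>x. x \<in> cylinder T w \<Longrightarrow> c \<le> S n x"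
  shows "c \<le> G w"
  unfolding G_def using words_cylinder[OF assms(1)] assms(2) words_length[OF assms(1)]
  by (intro cInf_greatest) auto

lemma G_append:
  assumes w: "w \<in> words T (n + k)"
  shows "G (take n w) + G (drop n w) \<le> G w"
proof (rule G_ge[OF w])
  fix x assume x: "x \<in> cylinder T w"
  have len: "length (take n w) = n" "length (drop n w) = k" using words_length[OF w] by auto
  have "x \<in> cylinder T (take n w)" "(imap T ^^ n) x \<in> cylinder T (drop n w)"
    using cylinder_append[of x T "take n w" "drop n w"] x len(1) coded_orbit[OF adm cylinder_coded[OF x]] by auto
  from G_le[OF this(1)] G_le[OF this(2)] show "G (take n w) + G (drop n w) \<le> S (n + k) x"
    by (simp only: len S_add)
qed

text \<open>At time k the two orbits lie in a common cylinder of order n - k. When n - k \<ge> K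
  this is short enough for uniform continuity to give \<epsilon>; each of the fewer than K remaining
  times costs at most M, as f is positive.\<close>

lemma birkhoff_variation:
  assumes \<epsilon>: "0 < \<epsilon>"
  shows "\<exists>C\<ge>0. \<forall>n w x y. w \<in> words T n \<longrightarrow> x \<in> filled_cylinder T w \<longrightarrow> y \<in> filled_cylinder T w \<longrightarrow>
    birkhoff T f n x \<le> birkhoff T f n y + \<epsilon> * real n + C"
proof -
  have "uniformly_continuous_on {0..1} f" using cont by (intro compact_uniformly_continuous) auto
  then obtain \<delta> where \<delta>: "\<delta> > 0" "\<And>u v. u \<in> {0..1} \<Longrightarrow> v \<in> {0..1} \<Longrightarrow> dist v u < \<delta> \<Longrightarrow> dist (f v) (f u) < \<epsilon>"
    using \<epsilon> by (rule uniformly_continuous_onE) blast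
  have "eventually (\<lambda>j. diam_bound T j < \<delta>) sequentially"
    using diam_bound_tendsto[OF adm] \<delta>(1) by (rule order_tendstoD)
  then obtain K where K: "\<And>j. K \<le> j \<Longrightarrow> diam_bound T j < \<delta>" by (auto simp: eventually_sequentially)
  have M0: "0 \<le> M" using f_ge[of 0] f_le[of 0] m by simp
  have "birkhoff T f n x \<le> birkhoff T f n y + \<epsilon> * real n + real K * M"
    if w: "w \<in> words T n" and x: "x \<in> filled_cylinder T w" and y: "y \<in> filled_cylinder T w" for n w x y
  proof -
    have "birkhoff T f n x - birkhoff T f n y = (\<Sum>k<n. f ((imap T ^^ k) x) - f ((imap T ^^ k) y))"
      by (simp add: birkhoff_def sum_subtractf)
    also have "\<dots> \<le> (\<Sum>k<n. \<epsilon> + (if n - k < K then M else 0))"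
    proof (rule sum_mono)
      fix k assume "k \<in> {..<n}"
      then have k: "k < n" by simp
      note ox = filled_cylinder_orbit[OF adm w x y k] and oy = filled_cylinder_orbit(1)[OF adm w y x k]
      show "f ((imap T ^^ k) x) - f ((imap T ^^ k) y) \<le> \<epsilon> + (if n - k < K then M else 0)"
      proof (cases "n - k < K")
        case True
        then show ?thesis using f_le[OF ox(1)] f_ge[OF oy] m \<epsilon> by simp
      next
        case False
        then have "dist ((imap T ^^ k) x) ((imap T ^^ k) y) < \<delta>"
          using ox(2) K[of "n - k"] by (simp add: dist_real_def)
        then have "dist (f ((imap T ^^ k) x)) (f ((imap T ^^ k) y)) < \<epsilon>" by (rule \<delta>(2)[OF oy ox(1)])
        then show ?thesis using False by (simp add: dist_real_def)
      qed
    qed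
    also have "\<dots> = \<epsilon> * real n + real (card {k \<in> {..<n}. n - k < K}) * M"
      by (simp add: sum.distrib sum.inter_filter[symmetric] mult.commute)
    also have "\<dots> \<le> \<epsilon> * real n + real K * M"
    proof -
      have "card {k \<in> {..<n}. n - k < K} \<le> card {..<K}"
        by (rule card_inj_on_le[of "\<lambda>k. n - k"]) (auto simp: inj_on_def)
      then have "real (card {k \<in> {..<n}. n - k < K}) \<le> real K" by simp
      then show ?thesis using M0 by (simp add: mult_right_mono)
    qed
    finally show ?thesis by simp
  qed
  then show ?thesis using M0 by (intro exI[of _ "real K * M"]) auto
qed

text \<open>The derivative part contributes 2 ln 2, once ln 2 for each of the two points
  compared.\<close>

lemma S_le_G:
  assumes \<epsilon>: "0 < \<epsilon>"
  shows "\<exists>C\<ge>0. \<forall>n w x. w \<in> words T n \<longrightarrow> x \<in> cylinder T w \<longrightarrow> S n x \<le> G w + \<epsilon> * real n + C"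
proof -
  obtain C where C: "C \<ge> 0" "\<And>n w x y. w \<in> words T n \<Longrightarrow> x \<in> filled_cylinder T w \<Longrightarrow> y \<in> filled_cylinder T w \<Longrightarrow>
    birkhoff T f n x \<le> birkhoff T f n y + \<epsilon> * real n + C" using birkhoff_variation[OF \<epsilon>] by blast
  have "S n x \<le> G w + \<epsilon> * real n + (C + 2 * ln 2)" if w: "w \<in> words T n" and x: "x \<in> cylinder T w" for n w x
  proof -
    have "S n x - \<epsilon> * real n - (C + 2 * ln 2) \<le> G w"
    proof (rule G_ge[OF w])
      fix y assume y: "y \<in> cylinder T w"
      have "birkhoff T f n x \<le> birkhoff T f n y + \<epsilon> * real n + C"
        using C(2)[OF w] x y cylinder_subset_filled[OF w] by blast
      then show "S n x - \<epsilon> * real n - (C + 2 * ln 2) \<le> S n y"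
        using birkhoff_log_deriv[OF adm w x] birkhoff_log_deriv[OF adm w y] unfolding S_eq abs_le_iff by linarith
    qed
    then show ?thesis by simp
  qed
  then show ?thesis using C(1) by (intro exI[of _ "C + 2 * ln 2"]) auto
qed

text \<open>Serves to turn \<open>exp (- t * G w)\<close> into \<open>blen powr t\<close> times a
  lower bound for exp (- t S_n f) on the whole branch: S_n F is S_n f minus the logarithm of the
  length, up to ln 2. Filled cylinders take care of rational points of the branch.\<close>

lemma full_branch_variation:
  assumes \<epsilon>: "0 < \<epsilon>"
  shows "\<exists>C. \<forall>n w y. w \<in> full_words T n \<longrightarrow> y \<in> {0<..<1} \<longrightarrow>
    birkhoff T f n (word_branch T w y) \<le> G w + ln (blen (word_branch T w)) + \<epsilon> * real n + C"
proof -
  obtain C where C: "C \<ge> 0" "\<And>n w x y. w \<in> words T n \<Longrightarrow> x \<in> filled_cylinder T w \<Longrightarrow> y \<in> filled_cylinder T w \<Longrightarrow>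
    birkhoff T f n x \<le> birkhoff T f n y + \<epsilon> * real n + C" using birkhoff_variation[OF \<epsilon>] by blast
  have "birkhoff T f n (word_branch T w y) \<le> G w + ln (blen (word_branch T w)) + \<epsilon> * real n + (C + ln 2)"
    if w: "w \<in> full_words T n" and y: "y \<in> {0<..<1}" for n w y
  proof -
    have ww: "w \<in> words T n" using w full_words_subset by blast
    have "birkhoff T f n (word_branch T w y) - ln (blen (word_branch T w)) - \<epsilon> * real n - (C + ln 2) \<le> G w"
    proof (rule G_ge[OF ww])
      fix x assume x: "x \<in> cylinder T w"
      have "word_branch T w y \<in> filled_cylinder T w" using full_word_branch(2)[OF adm w] y by blast
      then have "birkhoff T f n (word_branch T w y) \<le> birkhoff T f n x + \<epsilon> * real n + C"
        using C(2)[OF ww] x cylinder_subset_filled[OF ww] by blast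
      then show "birkhoff T f n (word_branch T w y) - ln (blen (word_branch T w)) - \<epsilon> * real n - (C + ln 2) \<le> S n x"
        using birkhoff_log_deriv[OF adm ww x] unfolding S_eq abs_le_iff by linarith
    qed
    then show ?thesis by simp
  qed
  then show ?thesis by blast
qed

text \<open>Positivity of f gives exp (- G w) \<le> 2 \<open>blen\<close>, and the intervals of full
  words of one order are disjoint.\<close>

lemma full_words_mass:
  assumes F: "finite F" "F \<subseteq> full_words T n"
  shows "(\<Sum>w\<in>F. exp (- G w)) \<le> 2"
proof -
  have "(\<Sum>w\<in>F. exp (- G w)) \<le> (\<Sum>w\<in>F. 2 * blen (word_branch T w))"
  proof (rule sum_mono)
    fix w assume "w \<in> F"
    then have wf: "w \<in> full_words T n" and w: "w \<in> words T n" using F full_words_subset by blast+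
    have b: "0 < blen (word_branch T w)" by (rule full_word_branch(6)[OF adm wf])
    have "- ln (blen (word_branch T w)) - ln 2 \<le> G w"
    proof (rule G_ge[OF w])
      fix x assume x: "x \<in> cylinder T w"
      have "0 \<le> m * real n" using m by simp
      then show "- ln (blen (word_branch T w)) - ln 2 \<le> S n x"
        using birkhoff_log_deriv[OF adm w x] birkhoff_f_ge[OF cylinder_coded[OF x], of n]
        unfolding S_eq abs_le_iff by linarith
    qed
    then have "exp (- G w) \<le> exp (ln 2 + ln (blen (word_branch T w)))" by simp
    also have "\<dots> = 2 * blen (word_branch T w)" using b by (simp add: exp_add)
    finally show "exp (- G w) \<le> 2 * blen (word_branch T w)" .
  qed
  also have "\<dots> = 2 * (\<Sum>w\<in>F. bhi (word_branch T w) - blo (word_branch T w))"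
    by (simp add: sum_distrib_left bhi_minus_blo)
  also have "(\<Sum>w\<in>F. bhi (word_branch T w) - blo (word_branch T w)) \<le> 1 - 0"
  proof (rule sum_disjoint_intervals[OF F(1)])
    show "disjoint_family_on (\<lambda>w. {blo (word_branch T w)<..<bhi (word_branch T w)}) F"
      using full_words_disjoint[OF adm] F(2) by (rule disjoint_family_on_mono[rotated])
    show "0 \<le> blo (word_branch T w) \<and> bhi (word_branch T w) \<le> 1" if "w \<in> F" for w
      using full_word_branch(4,5)[OF adm] that F by blast
    show "blo (word_branch T w) \<le> bhi (word_branch T w)" for w by (simp add: blo_def bhi_def)
  qed simp
  finally show ?thesis by simp
qed

lemma G_pos: "w \<in> words T n \<Longrightarrow> m * real n \<le> G w"
  by (erule G_ge) (rule S_ge[OF cylinder_coded])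

text \<open>By \<open>beta_sibling_full\<close> no two non-full words share a parent, so truncation
  is injective on them, and it does not lower the weight \<open>exp (- s * G w)\<close>. For the
  Gauss map every word is full.\<close>

lemma full_words_rec:
  assumes s: "critical_exponent T < s" and F: "finite F" "F \<subseteq> words T (Suc n) - full_words T (Suc n)"
  shows "(\<Sum>w\<in>F. exp (- s * G w)) \<le> (\<Sum>\<^sub>\<infinity>w\<in>words T n. exp (- s * G w))"
proof (cases T)
  case Gauss
  then have "F = {}" using F by auto
  then show ?thesis by (simp add: infsum_nonneg)
next
  case (Beta b)
  then have b: "b > 1" and s0: "0 < s" using adm s by auto
  have Fw: "w \<in> words T (n + 1)" if "w \<in> F" for w using F that by auto
  have inj: "inj_on (take n) F"
  proof (rule inj_onI)
    fix w w' assume w: "w \<in> F" "w' \<in> F" "take n w = take n w'"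
    define u where "u = take n w"
    have lw: "length w = Suc n" "length w' = Suc n" using w F words_length by blast+
    have e: "w = u @ [w ! n]" "w' = u @ [w' ! n]"
      using take_Suc_conv_app_nth[of n w] take_Suc_conv_app_nth[of n w'] lw w(3) by (auto simp: u_def)
    have words: "u @ [w ! n] \<in> words (Beta b) (Suc n)" "u @ [w' ! n] \<in> words (Beta b) (Suc n)"
      using e w F Beta by (metis Diff_iff subsetD)+
    have "\<not> w ! n < w' ! n" "\<not> w' ! n < w ! n"
      using beta_sibling_full[OF b words] beta_sibling_full[OF b words(2,1)] e w F Beta
      by (metis Diff_iff subsetD)+
    then show "w = w'" using e by (metis linorder_less_linear)
  qed
  have sub: "take n ` F \<subseteq> words T n" using words_split(1)[OF adm] Fw by blast
  have "(\<Sum>w\<in>F. exp (- s * G w)) \<le> (\<Sum>w\<in>F. exp (- s * G (take n w)))"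
  proof (rule sum_mono)
    fix w assume w: "w \<in> F"
    have "0 \<le> G (drop n w)"
      using G_pos[OF words_split(2)[OF adm Fw[OF w]]] m by simp
    then have "G (take n w) \<le> G w" using G_append[OF Fw[OF w]] by simp
    then show "exp (- s * G w) \<le> exp (- s * G (take n w))" using s0 by simp
  qed
  also have "\<dots> = (\<Sum>w\<in>take n ` F. exp (- s * G w))" using inj by (simp add: sum.reindex)
  also have "\<dots> \<le> (\<Sum>w\<in>words T n. exp (- s * G w))"
    using sub finite_words_Beta[OF b] Beta by (intro sum_mono2) auto
  also have "\<dots> = (\<Sum>\<^sub>\<infinity>w\<in>words T n. exp (- s * G w))"
    using finite_words_Beta[OF b] Beta by (simp add: infsum_finite)
  finally show ?thesis .
qed

end

section \<open>The pressure equation\<close>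

lemma infsum_ennreal_eq:
  fixes g :: "'a \<Rightarrow> real"
  assumes "g summable_on A" "\<And>x. x \<in> A \<Longrightarrow> 0 \<le> g x"
  shows "(\<Sum>\<^sub>\<infinity>x\<in>A. ennreal (g x)) = ennreal (infsum g A)"
proof -
  have "(\<Sum>\<^sub>\<infinity>x\<in>A. ennreal (g x)) = (SUP F\<in>{F. finite F \<and> F \<subseteq> A}. \<Sum>x\<in>F. ennreal (g x))"
    by (rule nonneg_infsum_complete) simp
  also have "\<dots> = (SUP F\<in>{F. finite F \<and> F \<subseteq> A}. ennreal (sum g F))"
    using assms(2) by (intro SUP_cong refl sum_ennreal) auto
  also have "\<dots> = ennreal (infsum g A)" using infsum_nonneg_is_SUPREMUM_ennreal[OF assms] by simp
  finally show ?thesis .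
qed

lemma ext_ln_ennreal: "0 < x \<Longrightarrow> ext_ln (ennreal x) = ereal (ln x)"
  by (simp add: ext_ln_def)

lemma finite_harmonic_ge: "\<exists>F. finite F \<and> F \<subseteq> {1::int..} \<and> r \<le> (\<Sum>k\<in>F. 1 / (of_int k + 1 :: real))"
proof -
  have "\<not> summable (\<lambda>n. inverse (real n))" by (rule not_summable_harmonic)
  then have "\<not> summable (\<lambda>n. inverse (real (Suc n)))"
    by (subst summable_Suc_iff[of "\<lambda>n. inverse (real n)"])
  then have "\<not> summable (\<lambda>n. inverse (real (Suc (Suc n))))"
    using summable_Suc_iff[of "\<lambda>n. inverse (real (Suc n))"] by simp
  then have "\<not> (\<forall>N. (\<Sum>n<N. inverse (real (Suc (Suc n)))) \<le> r)"
    using summableI_nonneg_bounded[of "\<lambda>n. inverse (real (Suc (Suc n)))" r] by fastforce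
  then obtain N where N: "r \<le> (\<Sum>n<N. inverse (real (Suc (Suc n))))" by (auto simp: not_le intro: less_imp_le)
  let ?F = "(\<lambda>n. int n + 1) ` {..<N}"
  have "(\<Sum>k\<in>?F. 1 / (of_int k + 1 :: real)) = (\<Sum>n<N. inverse (real (Suc (Suc n))))"
    by (subst sum.reindex) (auto simp: inj_on_def inverse_eq_divide add_ac)
  then show ?thesis using N by (intro exI[of _ ?F]) auto
qed

context gibbs_map
begin

lemma S_one: "S 1 x = f x + log_deriv T x"
  by (simp add: S_def birkhoff_def)

lemma gauss_first_digit:
  assumes "T = Gauss" "x \<in> cylinder Gauss (k # w)"
  shows "2 * ln (of_int k) \<le> S 1 x" "S 1 x \<le> M + 2 * ln (of_int k + 1)" "1 \<le> k"
proof -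
  have x: "x \<in> coded_points Gauss" "\<lfloor>1 / x\<rfloor> = k" using assms(2) by (auto simp: cylinder_def digit.simps)
  have x01: "0 < x" "x < 1" using x(1) by auto
  have "1 < 1 / x" using x01 by simp
  then show k: "1 \<le> k" using x(2) by linarith
  have ld: "log_deriv T x = - 2 * ln x" using log_deriv_Gauss[OF x(1)] assms(1) by simp
  have S: "S 1 x = f x + 2 * ln (1 / x)" unfolding S_one ld using x01 by (simp add: ln_div)
  have fx: "0 \<le> f x" "f x \<le> M" using f_ge[of x] f_le[of x] m x01 by auto
  have "of_int k \<le> 1 / x" "1 / x \<le> of_int k + 1" using x(2) by linarith+
  then have "ln (of_int k) \<le> ln (1 / x)" "ln (1 / x) \<le> ln (of_int k + 1)"
    using k x01 by (subst ln_le_cancel_iff; simp)+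
  then show "2 * ln (of_int k) \<le> S 1 x" "S 1 x \<le> M + 2 * ln (of_int k + 1)" unfolding S using fx by linarith+
qed

lemma weights_summable_one:
  assumes s: "critical_exponent T < s"
  shows "(\<lambda>w. exp (- s * G w)) summable_on words T 1"
proof (cases T)
  case (Beta b)
  then show ?thesis using finite_words_Beta[of b 1] adm by (intro summable_on_finite) auto
next
  case Gauss
  then have s: "1/2 < s" using s by simp
  let ?g = "\<lambda>n. real n powr (- 2 * s)"
  have sm: "summable ?g" using s by (simp add: summable_real_powr_iff)
  show ?thesis
  proof (rule nonneg_summable_on_bounded(1))
    fix F assume F: "finite F" "F \<subseteq> words T 1"
    have F1: "\<exists>k\<ge>1. w = [k]" if "w \<in> F" for w
    proof -
      have "length w = 1" "set w \<subseteq> {1..}" using that F Gauss by auto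
      then show ?thesis by (cases w) auto
    qed
    have inj: "inj_on (\<lambda>w. nat (hd w)) F"
    proof (rule inj_onI)
      fix w w' assume "w \<in> F" "w' \<in> F" "nat (hd w) = nat (hd w')"
      then show "w = w'" using F1[of w] F1[of w'] by auto
    qed
    have "(\<Sum>w\<in>F. exp (- s * G w)) \<le> (\<Sum>w\<in>F. ?g (nat (hd w)))"
    proof (rule sum_mono)
      fix w assume w: "w \<in> F"
      then obtain k where k: "1 \<le> k" "w = [k]" using F1 by blast
      have "2 * ln (of_int k) \<le> G w"
        using F w by (intro G_ge[of w 1]) (auto simp: k(2) Gauss intro!: gauss_first_digit(1)[of _ k "[]", simplified])
      then have "s * (2 * ln (of_int k)) \<le> s * G w" using s by (intro mult_left_mono) auto
      then have "exp (- s * G w) \<le> exp (- 2 * s * ln (of_int k))" by simp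
      also have "\<dots> = ?g (nat (hd w))" using k by (simp add: powr_def)
      finally show "exp (- s * G w) \<le> ?g (nat (hd w))" .
    qed
    also have "\<dots> = (\<Sum>n\<in>(\<lambda>w. nat (hd w)) ` F. ?g n)" using inj by (simp add: sum.reindex)
    also have "\<dots> \<le> suminf ?g" using F sm by (intro sum_le_suminf) auto
    finally show "(\<Sum>w\<in>F. exp (- s * G w)) \<le> suminf ?g" .
  qed simp
qed

lemma G_le_linear: "\<exists>w\<in>words T n. G w \<le> (M + log_bound T) * real n"
proof (cases T)
  case (Beta b)
  then obtain w where w: "w \<in> words T n" "0 \<in> cylinder T w"
    using beta_point_word[of b 0 n] adm by auto
  have "G w \<le> S n 0" using G_le[OF w(2)] words_length[OF w(1)] by simp
  also have "\<dots> \<le> M * real n + ln b * real n"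
    using birkhoff_f_le[OF cylinder_coded[OF w(2)], of n] unfolding S_eq by (simp add: Beta birkhoff_def mult.commute)
  finally show ?thesis using w(1) Beta by (intro bexI[of _ w]) (auto simp: algebra_simps)
next
  case Gauss
  let ?w = "replicate n (1::int)"
  have w: "?w \<in> words T n" using Gauss by auto
  then obtain x where x: "x \<in> cylinder T ?w" using words_cylinder by blast
  note c = cylinder_coded[OF x]
  have "birkhoff T (log_deriv T) n x \<le> (\<Sum>k<n. 2 * ln 2)"
    unfolding birkhoff_def
  proof (rule sum_mono)
    fix k assume k: "k \<in> {..<n}"
    define z where "z = (imap Gauss ^^ k) x"
    have z: "z \<in> coded_points Gauss" using coded_orbit[OF adm c, of k] by (simp add: z_def Gauss)
    then have z01: "0 < z" "z < 1" by auto
    have "\<lfloor>1 / z\<rfloor> = 1" using x k by (auto simp: cylinder_def Gauss z_def digit.simps)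
    then have "1 / z \<le> 2" by linarith
    then have "ln (1 / z) \<le> ln 2" using z01 by (subst ln_le_cancel_iff) auto
    then show "log_deriv T ((imap T ^^ k) x) \<le> 2 * ln 2"
      using log_deriv_Gauss[OF z] z01 by (simp add: Gauss z_def[symmetric] ln_div)
  qed
  moreover have "log_bound T = 2 * ln 2" using Gauss by simp
  ultimately have "S n x \<le> (M + log_bound T) * real n"
    using birkhoff_f_le[OF c, of n] unfolding S_eq by (simp add: algebra_simps)
  then show ?thesis using G_le[OF x] w by (intro bexI[of _ ?w]) auto
qed

sublocale W: word_weights "words T" "full_words T" G m "critical_exponent T" "M + log_bound T"
proof
  show "0 \<le> critical_exponent T" "critical_exponent T < 1" by (cases T; simp)+
  show "take n w \<in> words T n \<and> drop n w \<in> words T k \<and> G (take n w) + G (drop n w) \<le> G w"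
    if "w \<in> words T (n + k)" for w n k using words_split[OF adm that] G_append[OF that] by blast
qed (fact words_length m G_pos G_le_linear weights_summable_one full_words_subset full_words_rec full_words_mass)+

text \<open>A one-letter converse of \<open>G_append\<close>, available because every digit may
  precede every Gauss word: a point x of the cylinder of w is prolonged to 1 / (a + x).\<close>

lemma gauss_weight_Cons:
  assumes T: "T = Gauss" and a: "1 \<le> a" and w: "w \<in> words T n"
  shows "G (a # w) \<le> M + 2 * ln (of_int a + 1) + G w"
proof -
  have "G (a # w) - (M + 2 * ln (of_int a + 1)) \<le> G w"
  proof (rule G_ge[OF w])
    fix x assume x: "x \<in> cylinder T w"
    have sw: "set w \<subseteq> {1..}" "set (a # w) \<subseteq> {1..}" and len: "length w = n" using w a T by auto
    obtain y where y: "y \<in> coded_points Gauss" "x = gauss_branch w y"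
      using x cylinder_Gauss[OF sw(1)] T by auto
    define z where "z = gauss_branch (a # w) y"
    have z: "z \<in> cylinder T (a # w)" unfolding T cylinder_Gauss[OF sw(2)] z_def using y by blast
    have "x \<in> coded_points Gauss" using x T by (simp add: cylinder_def)
    then have "imap T z = x" using imap_Gauss_inverse(1)[OF a, of x] by (simp add: z_def y(2) T)
    then have "S (Suc n) z = S 1 z + S n x" using S_add[of 1 n z] by simp
    moreover have "S 1 z \<le> M + 2 * ln (of_int a + 1)" using gauss_first_digit(2)[OF T] z T by blast
    moreover have "G (a # w) \<le> S (Suc n) z" using G_le[OF z] len by simp
    ultimately show "G (a # w) - (M + 2 * ln (of_int a + 1)) \<le> S n x" by linarith
  qed
  then show ?thesis by simp
qed

text \<open>Provides the left end for the root search. For the beta map, many words of weight at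
  least b^-n suffice. For the Gauss map, divergence of the harmonic series gives finitely many
  digits whose one-letter sum c is at least 2 at exponent 1/2; by continuity c s > 1 slightly to the
  right, and then Z does not decrease with the order.\<close>

lemma weights_bounded_below: "\<exists>s>critical_exponent T. \<exists>\<kappa>>0. \<forall>n. \<kappa> \<le> W.Z n s"
proof (cases T)
  case (Beta b)
  then have b: "b > 1" using adm by simp
  have M0: "0 < M" using f_ge[of 0] f_le[of 0] m by simp
  have lb: "0 < ln b" using b by simp
  \<comment> \<open>The exponent at which the bound (M + ln b) n for G makes every weight at least
    b^-n.\<close>
  define s where "s = ln b / (M + ln b)"
  have s0: "0 < s" using M0 lb by (simp add: s_def)
  have sM: "s * (M + ln b) = ln b" using M0 lb by (simp add: s_def)
  have "1/2 \<le> W.Z n s" for n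
  proof -
    have fin: "finite (words T n)" using finite_words_Beta[OF b] Beta by simp
    have "1/2 \<le> real (card (words T n)) * (1 / b ^ n)"
      using beta_words_many[OF b, of n] b by (simp add: Beta field_simps)
    also have "\<dots> = (\<Sum>w\<in>words T n. 1 / b ^ n)" by simp
    also have "\<dots> \<le> (\<Sum>w\<in>words T n. exp (- s * G w))"
    proof (rule sum_mono)
      fix w assume w: "w \<in> words T n"
      then obtain x where x: "x \<in> cylinder T w" using words_cylinder by blast
      have "G w \<le> S n x" using G_le[OF x] words_length[OF w] by simp
      also have "\<dots> \<le> (M + ln b) * real n"
        using birkhoff_f_le[OF cylinder_coded[OF x], of n] unfolding S_eq
        by (simp add: Beta birkhoff_def algebra_simps)
      finally have "s * G w \<le> s * ((M + ln b) * real n)" using s0 by (intro mult_left_mono) auto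
      also have "\<dots> = ln (b ^ n)" using sM b by (simp add: ln_realpow mult.assoc[symmetric] mult.commute)
      finally have "exp (- ln (b ^ n)) \<le> exp (- s * G w)" by simp
      then show "1 / b ^ n \<le> exp (- s * G w)" using b by (simp add: exp_minus inverse_eq_divide)
    qed
    also have "\<dots> = W.Z n s" unfolding W.Z_def using fin by (simp add: infsum_finite)
    finally show ?thesis .
  qed
  then show ?thesis using s0 Beta by (intro exI[of _ s] conjI exI[of _ "1/2"]) auto
next
  case Gauss
  obtain A where A: "finite A" "A \<subseteq> {1..}" "2 * exp (M / 2) \<le> (\<Sum>k\<in>A. 1 / (of_int k + 1 :: real))"
    using finite_harmonic_ge by blast
  define c where "c s = (\<Sum>k\<in>A. exp (- s * (M + 2 * ln (of_int k + 1))))" for s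
  have "c (1/2) = exp (- (M / 2)) * (\<Sum>k\<in>A. 1 / (of_int k + 1 :: real))"
    unfolding c_def sum_distrib_left
  proof (rule sum.cong[OF refl])
    fix k assume "k \<in> A"
    then have k: "1 \<le> k" using A by auto
    have "exp (- (1 / 2) * (M + 2 * ln (real_of_int k + 1))) = exp (- (M / 2)) * exp (- ln (real_of_int k + 1))"
      by (simp add: exp_add[symmetric] algebra_simps)
    then show "exp (- (1 / 2) * (M + 2 * ln (real_of_int k + 1))) = exp (- (M / 2)) * (1 / (real_of_int k + 1))"
      using k by (simp add: exp_minus inverse_eq_divide)
  qed
  also have "\<dots> \<ge> exp (- (M / 2)) * (2 * exp (M / 2))" using A(3) by (intro mult_left_mono) auto
  also have "exp (- (M / 2)) * (2 * exp (M / 2)) = 2" by (simp add: exp_minus)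
  finally have "1 < c (1/2)" by simp
  moreover have "isCont c (1/2)" unfolding c_def by (intro continuous_intros)
  ultimately have "eventually (\<lambda>s. 1 < c s) (at (1/2))"
    by (intro order_tendstoD) (auto simp: isCont_def)
  then have "eventually (\<lambda>s. 1 < c s) (at_right (1/2))" by (simp add: eventually_at_split)
  then obtain d where d: "d > 1/2" "\<And>s. 1/2 < s \<Longrightarrow> s < d \<Longrightarrow> 1 < c s"
    unfolding eventually_at_right_field by auto
  define s where "s = (1/2 + d) / 2"
  have s: "1/2 < s" "1 < c s" using d by (auto simp: s_def intro!: d(2))
  have sg: "critical_exponent T < s" using s Gauss by simp
  have "1 \<le> W.Z n s" for n
  proof (induction n)
    case 0
    have "G [] \<le> 0" using G_le_linear[of 0] W.W0 by simp
    then have "0 \<le> - s * G []" using s by (simp add: mult_nonneg_nonpos)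
    then show ?case by (simp add: W.Z_def W.W0)
  next
    case (Suc n)
    have bd: "(\<Sum>w\<in>F. exp (- s * G w)) \<le> W.Z (Suc n) s / c s" if F: "finite F" "F \<subseteq> words T n" for F
    proof -
      let ?h = "\<lambda>(a, w). a # w"
      have inj: "inj_on ?h (A \<times> F)" by (auto simp: inj_on_def)
      have sub: "?h ` (A \<times> F) \<subseteq> words T (Suc n)" using A F Gauss by fastforce
      have "c s * (\<Sum>w\<in>F. exp (- s * G w)) = (\<Sum>(a, w)\<in>A \<times> F. exp (- s * (M + 2 * ln (of_int a + 1))) * exp (- s * G w))"
        by (simp add: c_def sum_product sum.cartesian_product)
      also have "\<dots> \<le> (\<Sum>x\<in>A \<times> F. exp (- s * G (?h x)))"
      proof (rule sum_mono)
        fix x assume "x \<in> A \<times> F"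
        then obtain a w where x: "x = (a, w)" and aw: "a \<in> A" "w \<in> F" by blast
        have "G (a # w) \<le> M + 2 * ln (of_int a + 1) + G w"
          using aw A F by (intro gauss_weight_Cons[OF Gauss, of a w n]) auto
        then have "s * G (a # w) \<le> s * (M + 2 * ln (of_int a + 1) + G w)" using s by (intro mult_left_mono) auto
        then show "(case x of (a, w) \<Rightarrow> exp (- s * (M + 2 * ln (of_int a + 1))) * exp (- s * G w)) \<le> exp (- s * G (?h x))"
          unfolding x by (simp add: exp_add[symmetric] algebra_simps)
      qed
      also have "\<dots> = (\<Sum>w\<in>?h ` (A \<times> F). exp (- s * G w))" using inj by (simp add: sum.reindex)
      also have "\<dots> \<le> W.Z (Suc n) s"
        unfolding W.Z_def using A F sub W.summ[OF sg] by (intro finite_sum_le_infsum) auto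
      finally show ?thesis using s by (simp add: field_simps)
    qed
    have "W.Z n s \<le> W.Z (Suc n) s / c s"
      unfolding W.Z_def[of n] by (rule infsum_le_finite_sums[OF W.summ[OF sg] bd])
    then have "W.Z n s * c s \<le> W.Z (Suc n) s" using s by (simp add: field_simps)
    moreover have "1 * 1 \<le> W.Z n s * c s" using Suc s by (intro mult_mono) auto
    ultimately show ?case by simp
  qed
  then show ?thesis using sg by (intro exI[of _ s] conjI exI[of _ 1]) auto
qed

lemma birkhoff_potential: "birkhoff T (\<lambda>x. - s * (f x + log_deriv T x)) n x = - s * S n x"
  by (simp add: birkhoff_def S_def sum_distrib_left)

text \<open>The sums Q over sample points lie between exp (- s (\<epsilon> n + C)) Z and Z for every
  \<epsilon> > 0, so they have the growth rate of Z whatever the sample points.\<close>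

lemma has_pressure_press:
  assumes s: "critical_exponent T < s"
  shows "has_pressure T (\<lambda>x. - s * (f x + log_deriv T x)) (ereal (W.press s))"
  unfolding has_pressure_def birkhoff_potential
proof (intro allI impI)
  fix y assume y: "\<forall>n. \<forall>w\<in>words T n. y w \<in> cylinder T w"
  have s0: "0 < s" using s W.\<sigma>(1) by simp
  let ?e = "\<lambda>n w. exp (- s * S n (y w))"
  have e_le: "?e n w \<le> exp (- s * G w)" if "w \<in> words T n" for n w
    using G_le[of "y w" w] y words_length[OF that] that s0 by simp
  have e_sum: "?e n summable_on words T n" for n
    by (rule summable_on_comparison_test[OF W.summ[OF s] e_le]) auto
  define Q where "Q n = infsum (?e n) (words T n)" for n
  have QZ: "Q n \<le> W.Z n s" for n
    unfolding Q_def W.Z_def using e_sum W.summ[OF s] e_le by (rule infsum_mono)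
  have ZQ: "\<exists>C\<ge>0. \<forall>n. exp (- s * (\<epsilon> * real n + C)) * W.Z n s \<le> Q n" if \<epsilon>: "0 < \<epsilon>" for \<epsilon>
  proof -
    obtain C where C: "C \<ge> 0" "\<And>n w x. w \<in> words T n \<Longrightarrow> x \<in> cylinder T w \<Longrightarrow> S n x \<le> G w + \<epsilon> * real n + C"
      using S_le_G[OF \<epsilon>] by blast
    have "exp (- s * (\<epsilon> * real n + C)) * W.Z n s \<le> Q n" for n
      unfolding Q_def W.Z_def infsum_cmult_right'[symmetric]
    proof (rule infsum_mono[OF summable_on_cmult_right[OF W.summ[OF s]] e_sum])
      fix w assume w: "w \<in> words T n"
      have "s * S n (y w) \<le> s * (G w + \<epsilon> * real n + C)" using C(2)[OF w] y w s0 by (intro mult_left_mono) auto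
      then show "exp (- s * (\<epsilon> * real n + C)) * exp (- s * G w) \<le> ?e n w"
        by (simp add: exp_add[symmetric] algebra_simps)
    qed
    then show ?thesis using C(1) by blast
  qed
  have Qpos: "0 < Q n" for n
  proof -
    obtain C where "exp (- s * (1 * real n + C)) * W.Z n s \<le> Q n" using ZQ[of 1] by auto
    moreover have "0 < exp (- s * (1 * real n + C)) * W.Z n s" using W.Z_pos[OF s, of n] by simp
    ultimately show ?thesis by linarith
  qed
  have lim: "(\<lambda>n. ln (Q n) / real n) \<longlonglongrightarrow> W.press s"
  proof (rule order_tendstoI)
    fix a assume a: "W.press s < a"
    have "eventually (\<lambda>n. ln (W.Z n s) / real n < a) sequentially"
      using W.press(1)[OF s] a by (rule order_tendstoD)
    then show "eventually (\<lambda>n. ln (Q n) / real n < a) sequentially"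
    proof eventually_elim
      case (elim n)
      have "ln (Q n) / real n \<le> ln (W.Z n s) / real n"
        using QZ[of n] Qpos[of n] by (intro divide_right_mono) auto
      then show ?case using elim by simp
    qed
  next
    fix a assume a: "a < W.press s"
    define \<epsilon> where "\<epsilon> = (W.press s - a) / (2 * s)"
    have \<epsilon>: "\<epsilon> > 0" "s * \<epsilon> = (W.press s - a) / 2" using a s0 by (auto simp: \<epsilon>_def)
    obtain C where C: "\<And>n. exp (- s * (\<epsilon> * real n + C)) * W.Z n s \<le> Q n" using ZQ[OF \<epsilon>(1)] by blast
    have "(\<lambda>n. ln (W.Z n s) / real n - (s * C) / real n) \<longlonglongrightarrow> W.press s - 0"
      by (intro tendsto_diff W.press(1)[OF s] lim_const_over_n)
    moreover have "a + s * \<epsilon> < W.press s - 0" using a \<epsilon> by simp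
    ultimately have "eventually (\<lambda>n. a + s * \<epsilon> < ln (W.Z n s) / real n - (s * C) / real n) sequentially"
      by (rule order_tendstoD)
    then show "eventually (\<lambda>n. a < ln (Q n) / real n) sequentially"
      using eventually_gt_at_top[of 0]
    proof eventually_elim
      case (elim n)
      have Zp: "0 < W.Z n s" by (rule W.Z_pos[OF s])
      have "ln (exp (- s * (\<epsilon> * real n + C)) * W.Z n s) \<le> ln (Q n)"
        using C[of n] Qpos[of n] Zp by (subst ln_le_cancel_iff) auto
      then have "- s * (\<epsilon> * real n + C) + ln (W.Z n s) \<le> ln (Q n)" using Zp by (simp add: ln_mult_pos)
      then have "(- s * (\<epsilon> * real n + C) + ln (W.Z n s)) / real n \<le> ln (Q n) / real n"
        by (rule divide_right_mono) simp
      moreover have "(- s * (\<epsilon> * real n + C) + ln (W.Z n s)) / real n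
          = ln (W.Z n s) / real n - (s * C) / real n - s * \<epsilon>" using elim(2) by (simp add: field_simps)
      ultimately show ?case using elim(1) by linarith
    qed
  qed
  have "eventually (\<lambda>n. ext_ln (\<Sum>\<^sub>\<infinity>w\<in>words T n. ennreal (?e n w)) / ereal (real n) = ereal (ln (Q n) / real n)) sequentially"
    using eventually_gt_at_top[of 0]
  proof eventually_elim
    case (elim n)
    then show ?case using infsum_ennreal_eq[OF e_sum[of n]] ext_ln_ennreal[OF Qpos[of n]] by (simp add: Q_def)
  qed
  then show "(\<lambda>n. ext_ln (\<Sum>\<^sub>\<infinity>w\<in>words T n. ennreal (?e n w)) / ereal (real n)) \<longlonglongrightarrow> ereal (W.press s)"
    using lim by (simp add: tendsto_cong)
qed

lemma sample_points: obtains y where "\<forall>n. \<forall>w\<in>words T n. y w \<in> cylinder T w"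
proof
  show "\<forall>n. \<forall>w\<in>words T n. (SOME x. x \<in> cylinder T w) \<in> cylinder T w"
    using words_cylinder by (auto intro: some_in_eq[THEN iffD2])
qed

text \<open>For s \<le> 0 every word has weight at least 1, and there are at least b^n / 2 words, so
  the pressure would be at least ln b.\<close>

lemma no_pressure_zero_Beta:
  assumes T: "T = Beta b" and s: "s \<le> 0"
  shows "\<not> has_pressure T (\<lambda>x. - s * (f x + log_deriv T x)) 0"
proof
  assume P: "has_pressure T (\<lambda>x. - s * (f x + log_deriv T x)) 0"
  have b: "b > 1" using adm T by simp
  obtain y where y: "\<forall>n. \<forall>w\<in>words T n. y w \<in> cylinder T w" by (rule sample_points) blast
  define R where "R n = (\<Sum>w\<in>words T n. exp (- s * S n (y w)))" for n
  have fin: "finite (words T n)" for n using finite_words_Beta[OF b] T by simp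
  have R: "b ^ n / 2 \<le> R n" for n
  proof -
    have "b ^ n / 2 \<le> (\<Sum>w\<in>words T n. 1)" using beta_words_many[OF b, of n] T by simp
    also have "\<dots> \<le> R n" unfolding R_def
    proof (rule sum_mono)
      fix w assume "w \<in> words T n"
      then have "m * real n \<le> S n (y w)" using y by (intro S_ge cylinder_coded) blast
      then have "0 \<le> S n (y w)" using m by (smt (verit) mult_nonneg_nonneg of_nat_0_le_iff)
      then show "1 \<le> exp (- s * S n (y w))" using s by (simp add: mult_nonpos_nonneg)
    qed
    finally show ?thesis .
  qed
  have Rpos: "0 < R n" for n using R[of n] b by (smt (verit) zero_less_power divide_pos_pos)
  have eq: "(\<Sum>\<^sub>\<infinity>w\<in>words T n. ennreal (exp (- s * S n (y w)))) = ennreal (R n)" for n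
    unfolding R_def using fin[of n] by (simp add: infsum_finite sum_ennreal)
  have l1: "(\<lambda>n. ereal (ln b - ln 2 / real n)) \<longlonglongrightarrow> ereal (ln b - 0)"
    by (intro tendsto_intros lim_const_over_n)
  have l2: "(\<lambda>n. ext_ln (ennreal (R n)) / ereal (real n)) \<longlonglongrightarrow> 0"
    using P[unfolded has_pressure_def birkhoff_potential, THEN spec, THEN mp, OF y] by (simp only: eq)
  have "ereal (ln b - ln 2 / real n) \<le> ext_ln (ennreal (R n)) / ereal (real n)" if "1 \<le> n" for n
  proof -
    have "ln (b ^ n / 2) \<le> ln (R n)" using R[of n] Rpos[of n] b by (subst ln_le_cancel_iff) auto
    then have "real n * ln b - ln 2 \<le> ln (R n)" using b by (simp add: ln_div ln_realpow)
    then have "(real n * ln b - ln 2) / real n \<le> ln (R n) / real n" by (rule divide_right_mono) simp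
    then show ?thesis using that ext_ln_ennreal[OF Rpos[of n]] by (simp add: diff_divide_distrib)
  qed
  then have "ereal (ln b - 0) \<le> 0" by (intro LIMSEQ_le[OF l1 l2]) blast
  then show False using b by simp
qed

text \<open>Words k, 1, ..., 1 with free first digit k have weight at least a constant times 1 / (k
  + 1). Hence every sum of positive order is infinite.\<close>

lemma no_pressure_zero_Gauss:
  assumes T: "T = Gauss" and s: "s \<le> 1/2"
  shows "\<not> has_pressure T (\<lambda>x. - s * (f x + log_deriv T x)) 0"
proof
  assume P: "has_pressure T (\<lambda>x. - s * (f x + log_deriv T x)) 0"
  obtain y where y: "\<forall>n. \<forall>w\<in>words T n. y w \<in> cylinder T w" by (rule sample_points) blast
  have inf: "(\<Sum>\<^sub>\<infinity>w\<in>words T (Suc n). ennreal (exp (- s * S (Suc n) (y w)))) = \<infinity>" (is "?I = _") for n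
  proof -
    let ?u = "replicate n (1::int)"
    have u: "?u \<in> words T n" using T by auto
    obtain C where C: "\<And>x. x \<in> cylinder T ?u \<Longrightarrow> S n x \<le> C" using S_le_G[of 1] u by force
    \<comment> \<open>For negative s the comparison is made with exponent 0, as S is
      nonnegative.\<close>
    define t where "t = max s 0"
    have t: "0 \<le> t" "t \<le> 1/2" "s \<le> t" using s by (auto simp: t_def)
    define c where "c = exp (- t * (M + C))"
    have low: "c * (1 / (of_int k + 1)) \<le> exp (- s * S (Suc n) (y (k # ?u)))" if k: "1 \<le> k" for k
    proof -
      have "k # ?u \<in> words T (Suc n)" using k T by auto
      then have x: "y (k # ?u) \<in> cylinder T (k # ?u)" using y by blast
      have "imap T (y (k # ?u)) \<in> cylinder T ?u"
        using cylinder_append(2)[of "y (k # ?u)" T "[k]" ?u] x coded_orbit[OF adm cylinder_coded[OF x], of 1] by simp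
      moreover have "S 1 (y (k # ?u)) \<le> M + 2 * ln (of_int k + 1)" using gauss_first_digit(2)[OF T] x T by blast
      ultimately have Sle: "S (Suc n) (y (k # ?u)) \<le> M + C + 2 * ln (of_int k + 1)"
        using S_add[of 1 n "y (k # ?u)"] C by fastforce
      have S0: "0 \<le> S (Suc n) (y (k # ?u))"
        using S_ge[OF cylinder_coded[OF x], of "Suc n"] m by (smt (verit) mult_nonneg_nonneg of_nat_0_le_iff)
      have lk: "0 \<le> ln (real_of_int k + 1)" using k by simp
      have "s * S (Suc n) (y (k # ?u)) \<le> t * S (Suc n) (y (k # ?u))" using t S0 by (intro mult_right_mono) auto
      also have "\<dots> \<le> t * (M + C + 2 * ln (of_int k + 1))" using t Sle by (intro mult_left_mono) auto
      also have "\<dots> = t * (M + C) + (2 * t) * ln (of_int k + 1)" by (simp add: algebra_simps)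
      also have "\<dots> \<le> t * (M + C) + 1 * ln (of_int k + 1)" using t lk by (intro add_left_mono mult_right_mono) auto
      finally have "exp (- t * (M + C) - ln (of_int k + 1)) \<le> exp (- s * S (Suc n) (y (k # ?u)))" by simp
      then show ?thesis using k by (simp add: c_def exp_diff)
    qed
    have "ennreal r \<le> ?I" for r
    proof -
      obtain A where A: "finite A" "A \<subseteq> {1..}" "r / c \<le> (\<Sum>k\<in>A. 1 / (of_int k + 1 :: real))"
        using finite_harmonic_ge by blast
      let ?F = "(\<lambda>k. k # ?u) ` A"
      have F: "finite ?F" "?F \<subseteq> words T (Suc n)" using A T by auto
      have "r \<le> c * (\<Sum>k\<in>A. 1 / (of_int k + 1 :: real))" using A(3) by (simp add: c_def field_simps)
      also have "\<dots> \<le> (\<Sum>k\<in>A. exp (- s * S (Suc n) (y (k # ?u))))"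
        unfolding sum_distrib_left using low A by (intro sum_mono) auto
      also have "\<dots> = (\<Sum>w\<in>?F. exp (- s * S (Suc n) (y w)))" by (subst sum.reindex) (auto simp: inj_on_def)
      finally have "ennreal r \<le> (\<Sum>w\<in>?F. ennreal (exp (- s * S (Suc n) (y w))))"
        by (subst sum_ennreal) (auto intro: ennreal_leI)
      also have "\<dots> \<le> ?I"
        by (subst nonneg_infsum_complete) (use F in \<open>auto intro!: SUP_upper\<close>)
      finally show ?thesis .
    qed
    note ge = this
    show ?thesis
    proof (rule ccontr)
      assume "?I \<noteq> \<infinity>"
      then obtain r where r: "?I = ennreal r" "0 \<le> r" by (cases ?I) auto
      then show False using ge[of "r + 1"] by (simp del: ennreal_plus)
    qed
  qed
  have "(\<lambda>n. ext_ln (\<Sum>\<^sub>\<infinity>w\<in>words T n. ennreal (exp (- s * S n (y w)))) / ereal (real n)) \<longlonglongrightarrow> 0"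
    by (rule P[unfolded has_pressure_def birkhoff_potential, THEN spec, THEN mp, OF y])
  \<comment> \<open>Order 0 has one word and a finite sum, hence the shift.\<close>
  then have "(\<lambda>n. ext_ln (\<Sum>\<^sub>\<infinity>w\<in>words T (Suc n). ennreal (exp (- s * S (Suc n) (y w)))) / ereal (real (Suc n))) \<longlonglongrightarrow> 0"
    by (rule LIMSEQ_Suc)
  then have "(\<lambda>n. \<infinity> :: ereal) \<longlonglongrightarrow> 0" unfolding inf by (simp add: ext_ln_def)
  then have "(\<infinity> :: ereal) = 0" by (rule LIMSEQ_unique[OF tendsto_const])
  then show False by simp
qed

lemma has_pressure_zero_iff:
  "has_pressure T (\<lambda>x. - s * (f x + log_deriv T x)) 0 \<longleftrightarrow> critical_exponent T < s \<and> W.press s = 0"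
proof
  assume P: "has_pressure T (\<lambda>x. - s * (f x + log_deriv T x)) 0"
  have s: "critical_exponent T < s"
  proof (rule ccontr)
    assume "\<not> ?thesis"
    then show False using P no_pressure_zero_Beta no_pressure_zero_Gauss by (cases T) auto
  qed
  obtain y where y: "\<forall>n. \<forall>w\<in>words T n. y w \<in> cylinder T w" by (rule sample_points) blast
  have "ereal (W.press s) = 0"
    using P has_pressure_press[OF s] y unfolding has_pressure_def by (blast intro: LIMSEQ_unique)
  then show "critical_exponent T < s \<and> W.press s = 0" using s by simp
next
  assume "critical_exponent T < s \<and> W.press s = 0"
  then show "has_pressure T (\<lambda>x. - s * (f x + log_deriv T x)) 0"
    using has_pressure_press[of s] by (simp add: zero_ereal_def)
qed

lemma pressure_root_unique: "\<exists>!s. has_pressure T (\<lambda>x. - s * (f x + log_deriv T x)) 0"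
proof -
  obtain s0 \<kappa> where "critical_exponent T < s0" "\<kappa> > 0" "\<And>n. \<kappa> \<le> W.Z n s0"
    using weights_bounded_below by blast
  from W.press_root_exists[OF this] obtain s where s: "critical_exponent T < s" "W.press s = 0" by blast
  have "s' = s''" if "critical_exponent T < s'" "W.press s' = 0" "critical_exponent T < s''" "W.press s'' = 0" for s' s''
  proof (rule ccontr)
    assume "s' \<noteq> s''"
    then consider "0 < s'' - s'" | "0 < s' - s''" by linarith
    then show False
    proof cases
      case 1
      then show False using W.press_strict[of s' s''] mult_pos_pos[OF 1 m] that by simp
    next
      case 2
      then show False using W.press_strict[of s'' s'] mult_pos_pos[OF 2 m] that by simp
    qed
  qed
  then show ?thesis unfolding has_pressure_zero_iff using s by blast
qed

end

section \<open>The limsup set\<close>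

text \<open>On (0,1) both maps are \<open>frac\<close> of a continuous function; \<open>frac\<close>
  is discontinuous only at integers, where it takes the value 0.\<close>

lemma imap_continuous_nonzero:
  assumes "admissible_map T"
  shows "open {z \<in> {0<..<1}. imap T z \<noteq> 0}" "continuous_on {z \<in> {0<..<1}. imap T z \<noteq> 0} (imap T)"
proof -
  have "\<exists>g. continuous_on {0<..<1} g \<and> (\<forall>z\<in>{0<..<1}. imap T z = frac (g z))"
  proof (cases T)
    case (Beta b)
    then show ?thesis by (intro exI[of _ "\<lambda>z. b * z"]) (auto intro!: continuous_intros simp: imap.simps)
  next
    case Gauss
    then show ?thesis by (intro exI[of _ "\<lambda>z. 1 / z"]) (auto intro!: continuous_intros simp: imap.simps)
  qed
  then obtain g where g: "continuous_on {0<..<1} g" "\<And>z. z \<in> {0<..<1} \<Longrightarrow> imap T z = frac (g z)" by blast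
  have eq: "{z \<in> {0<..<1}. imap T z \<noteq> 0} = g -` (- \<int>) \<inter> {0<..<1}"
    using g(2) by (auto simp: frac_eq_0_iff)
  show "open {z \<in> {0<..<1}. imap T z \<noteq> 0}"
    unfolding eq using continuous_on_open_vimage[OF open_greaterThanLessThan, THEN iffD1, OF g(1)]
      open_Compl[OF closed_Ints] by blast
  have "continuous_on (- \<int>) (frac :: real \<Rightarrow> real)"
    by (intro continuous_at_imp_continuous_on ballI continuous_frac) auto
  then have "continuous_on {z \<in> {0<..<1}. imap T z \<noteq> 0} (\<lambda>z. frac (g z))"
  proof (rule continuous_on_compose2)
    show "continuous_on {z \<in> {0<..<1}. imap T z \<noteq> 0} g" by (rule continuous_on_subset[OF g(1)]) auto
    show "g ` {z \<in> {0<..<1}. imap T z \<noteq> 0} \<subseteq> - \<int>" unfolding eq by blast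
  qed
  then show "continuous_on {z \<in> {0<..<1}. imap T z \<noteq> 0} (imap T)"
    using g(2) by (subst continuous_on_cong[OF refl]) auto
qed

lemma imap_unit:
  assumes "admissible_map T" "x \<in> {0..<1}"
  shows "(imap T ^^ k) x \<in> {0..<1}"
proof (induction k)
  case (Suc k)
  then show ?case by (cases T) (auto simp: imap.simps frac_lt_1)
qed (use assms in simp)

lemma iterates_continuous:
  assumes "admissible_map T"
  shows "open {x \<in> {0<..<1}. \<forall>k\<le>n. (imap T ^^ k) x \<noteq> 0} \<and>
    (\<forall>k\<le>n. continuous_on {x \<in> {0<..<1}. \<forall>k\<le>n. (imap T ^^ k) x \<noteq> 0} (imap T ^^ k))"
proof (induction n)
  case 0
  have "{x \<in> {0<..<1::real}. \<forall>k\<le>0. (imap T ^^ k) x \<noteq> 0} = {0<..<1}" by auto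
  then show ?case by (auto simp: id_def intro: continuous_on_id)
next
  case (Suc n)
  let ?V = "\<lambda>n. {x \<in> {0<..<1}. \<forall>k\<le>n. (imap T ^^ k) x \<noteq> 0}"
  let ?D = "{z \<in> {0<..<1}. imap T z \<noteq> 0}"
  have V: "?V (Suc n) = (imap T ^^ n) -` ?D \<inter> ?V n"
  proof (intro set_eqI iffI)
    fix x assume x: "x \<in> ?V (Suc n)"
    then have "(imap T ^^ n) x \<in> {0..<1}" by (intro imap_unit[OF assms]) auto
    moreover have "(imap T ^^ n) x \<noteq> 0" "(imap T ^^ Suc n) x \<noteq> 0" using x le_SucI by blast+
    ultimately have "(imap T ^^ n) x \<in> ?D" by auto
    moreover have "x \<in> ?V n" using x le_SucI by blast
    ultimately show "x \<in> (imap T ^^ n) -` ?D \<inter> ?V n" by blast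
  qed (auto simp: le_Suc_eq)
  have o: "open (?V n)" and c: "continuous_on (?V n) (imap T ^^ n)" using Suc by auto
  have "open (?V (Suc n))"
    unfolding V using c imap_continuous_nonzero(1)[OF assms] continuous_on_open_vimage[OF o] by blast
  moreover have "continuous_on (?V (Suc n)) (imap T ^^ k)" if k: "k \<le> Suc n" for k
  proof (cases "k \<le> n")
    case True
    then have "continuous_on (?V n) (imap T ^^ k)" using Suc by blast
    then show ?thesis by (rule continuous_on_subset) (auto simp: le_Suc_eq)
  next
    case False
    then have "imap T ^^ k = (\<lambda>x. imap T ((imap T ^^ n) x))" using k by (simp add: le_Suc_eq comp_def)
    moreover have "continuous_on (?V (Suc n)) (\<lambda>x. imap T ((imap T ^^ n) x))"
    proof (rule continuous_on_compose2[OF imap_continuous_nonzero(2)[OF assms]])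
      show "continuous_on (?V (Suc n)) (imap T ^^ n)" using c by (rule continuous_on_subset) (auto simp: le_Suc_eq)
      show "(imap T ^^ n) ` ?V (Suc n) \<subseteq> ?D" unfolding V by blast
    qed
    ultimately show ?thesis by simp
  qed
  ultimately show ?case by blast
qed

lemma open_target_set:
  assumes T: "admissible_map T" and f: "continuous_on {0..1} f" and h: "continuous_on {0..1} (h n)"
  shows "open (target_set (imap T) f h n)"
proof -
  let ?V = "{x \<in> {0<..<1}. \<forall>k\<le>n. (imap T ^^ k) x \<noteq> 0}"
  have o: "open ?V" and c: "\<And>k. k \<le> n \<Longrightarrow> continuous_on ?V (imap T ^^ k)"
    using iterates_continuous[OF T, of n] by auto
  have unit: "(imap T ^^ k) x \<in> {0..1}" if "x \<in> ?V" for k x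
    using imap_unit[OF T, of x k] that by auto
  let ?g = "\<lambda>x. exp (- (\<Sum>k<n. f ((imap T ^^ k) x))) - \<bar>(imap T ^^ n) x - h n x\<bar>"
  have "continuous_on ?V (\<lambda>x. f ((imap T ^^ k) x))" if "k < n" for k
    by (rule continuous_on_compose2[OF f c]) (use that unit in auto)
  moreover have "continuous_on ?V (h n)" by (rule continuous_on_subset[OF h]) auto
  ultimately have "continuous_on ?V ?g" using c[of n] by (intro continuous_intros) auto
  then have "open (?g -` {0<..} \<inter> ?V)" using continuous_on_open_vimage[OF o] open_greaterThan by blast
  also have "?g -` {0<..} \<inter> ?V = target_set (imap T) f h n" by (auto simp: target_set_def)
  finally show ?thesis .
qed

text \<open>A point in infinitely many target sets has no iterate equal to 0, because the target set
  of order n excludes this for all iterates up to n. The right-hand side makes the G-delta property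
  visible.\<close>

lemma W_set_minus_zero_orbits:
  assumes "admissible_map T"
  shows "W_set T f h - zero_orbits T = (\<Inter>N. \<Union>n\<in>{N..}. target_set (imap T) f h n)"
proof (intro set_eqI iffI)
  fix x assume x: "x \<in> W_set T f h - zero_orbits T"
  then have nz: "(imap T ^^ k) x \<noteq> 0" for k by (auto simp: zero_orbits_def)
  have "x \<in> {0..<1}" using x by (simp add: W_set_def)
  then have "x \<in> {0<..<1}" using nz[of 0] by auto
  moreover have "\<exists>n\<ge>N. \<bar>(imap T ^^ n) x - h n x\<bar> < exp (- birkhoff T f n x)" for N
    using x unfolding W_set_def infinite_nat_iff_unbounded_le by blast
  ultimately show "x \<in> (\<Inter>N. \<Union>n\<in>{N..}. target_set (imap T) f h n)"
    using nz unfolding target_set_def birkhoff_def by auto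
next
  fix x assume "x \<in> (\<Inter>N. \<Union>n\<in>{N..}. target_set (imap T) f h n)"
  then have E: "\<exists>n\<ge>N. x \<in> target_set (imap T) f h n" for N by auto
  have "(imap T ^^ N) x \<noteq> 0" for N using E[of N] by (auto simp: target_set_def)
  then have "x \<notin> zero_orbits T" by (simp add: zero_orbits_def)
  moreover have "x \<in> {0..<1}" using E[of 0] by (auto simp: target_set_def)
  moreover have "infinite {n. \<bar>(imap T ^^ n) x - h n x\<bar> < exp (- birkhoff T f n x)}"
    unfolding infinite_nat_iff_unbounded_le using E by (fastforce simp: target_set_def birkhoff_def)
  ultimately show "x \<in> W_set T f h - zero_orbits T" by (simp add: W_set_def)
qed

lemma gdelta_W_set:
  assumes "admissible_map T" "continuous_on {0..1} f" "\<And>n. continuous_on {0..1} (h n)"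
  shows "gdelta (W_set T f h - zero_orbits T)"
  unfolding W_set_minus_zero_orbits[OF assms(1)]
  using open_target_set[OF assms] by (intro gdelta.intros open_UN) auto

section \<open>Content bounds for the limsup set from positive pressure\<close>

context gibbs_map
begin

lemma map_full_branches:
  assumes "\<And>n. L-lipschitz_on {0..1} (h n)" "\<And>n. h n ` {0..1} \<subseteq> {0..1}"
  shows "\<exists>\<alpha>. full_branches (imap T) f h L 2 \<alpha> M (map_branches T)"
proof -
  have f: "0 < f x \<and> f x \<le> M" if "x \<in> {0<..<1}" for x
    using f_ge[of x] f_le[of x] m that by auto
  show ?thesis
  proof (cases T)
    case (Beta b)
    then have "map_branches T = beta_branches b" by (intro ext) simp
    then show ?thesis using beta_full_branches[of b f M L h] f assms adm Beta by auto
  next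
    case Gauss
    then have "map_branches T = (\<lambda>n. gauss_branches n)" by (intro ext) simp
    then show ?thesis using gauss_full_branches[of f M L h] f assms Gauss by auto
  qed
qed

text \<open>With p the pressure at t, \<open>full_large\<close> provides full words of weight above
  A exp (p k / 2). The choice \<epsilon> = p / (2 t) lets this exponential cancel the error t
  \<epsilon> k from the variation of f, and A covers the constant error t C and leaves 12 = 6 D with
  D = 2.\<close>

lemma W_set_content_bound:
  assumes h: "\<And>n. L-lipschitz_on {0..1} (h n)" "\<And>n. h n ` {0..1} \<subseteq> {0..1}"
    and t: "critical_exponent T < t" "t \<le> 1" and p: "0 < W.press t"
  shows "\<exists>\<kappa>>0. content_bound t \<kappa> (W_set T f h - zero_orbits T)"
proof -
  obtain \<alpha> where "full_branches (imap T) f h L 2 \<alpha> M (map_branches T)"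
    using map_full_branches[of L h] h by blast
  then interpret fb: full_branches "imap T" f h L 2 \<alpha> M "map_branches T" .
  have t0: "0 < t" using t W.\<sigma>(1) by simp
  define \<epsilon> where "\<epsilon> = W.press t / 2 / t"
  have \<epsilon>: "0 < \<epsilon>" "t * \<epsilon> = W.press t / 2" using p t0 by (auto simp: \<epsilon>_def)
  obtain C where C: "\<And>n w y. w \<in> full_words T n \<Longrightarrow> y \<in> {0<..<1} \<Longrightarrow>
    birkhoff T f n (word_branch T w y) \<le> G w + ln (blen (word_branch T w)) + \<epsilon> * real n + C"
    using full_branch_variation[OF \<epsilon>(1)] by blast
  define A where "A = max 1 (12 * exp (t * C))"
  obtain k F where F: "0 < k" "finite F" "F \<subseteq> full_words T k"
    "A * exp (W.press t / 2 * real k) < (\<Sum>w\<in>F. exp (- t * G w))"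
    using W.full_large[OF t(1) p, of A] by (auto simp: A_def)
  let ?b = "word_branch T"
  have Ff: "w \<in> full_words T k" if "w \<in> F" for w using F that by blast
  note fw = full_word_branch[OF adm Ff]
  have dis: "{blo (?b w)<..<bhi (?b w)} \<inter> {blo (?b w')<..<bhi (?b w')} = {}" if "w \<in> F" "w' \<in> F" "w \<noteq> w'" for w w'
    using full_words_disjoint[OF adm, of k] Ff that by (simp add: disjoint_family_on_def)
  have inj: "inj_on ?b F"
  proof (rule inj_onI, rule ccontr)
    fix w w' assume *: "w \<in> F" "w' \<in> F" "?b w = ?b w'" "w \<noteq> w'"
    have "blo (?b w) < bhi (?b w)" using fw(6)[OF *(1)] by (simp flip: bhi_minus_blo)
    then show False using dis[OF *(1,2,4)] *(3) by simp
  qed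
  \<comment> \<open>\<open>expanding\<close> indexes weights by branches, so the word is recovered
    with \<open>inv_into\<close>; the power of \<open>blen\<close> cancels the length in the
    expanding sum.\<close>
  define \<theta> where "\<theta> \<psi> = exp (- t * (G (inv_into F ?b \<psi>) + \<epsilon> * real k + C)) * blen \<psi> powr (- t)" for \<psi>
  have \<theta>: "\<theta> (?b w) = exp (- t * (G w + \<epsilon> * real k + C)) * blen (?b w) powr (- t)" if "w \<in> F" for w
    using inj that by (simp add: \<theta>_def)
  have "6 * 2 \<le> (\<Sum>\<psi>\<in>?b ` F. blen \<psi> powr t * \<theta> \<psi>)"
  proof -
    have "12 = exp (- t * C) * (12 * exp (t * C))" by (simp add: exp_minus)
    also have "\<dots> \<le> exp (- t * C) * A" by (intro mult_left_mono) (auto simp: A_def)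
    also have "\<dots> = exp (- t * (\<epsilon> * real k + C)) * (A * exp (W.press t / 2 * real k))"
      unfolding \<epsilon>(2)[symmetric] by (simp add: exp_add[symmetric] algebra_simps)
    also have "\<dots> \<le> exp (- t * (\<epsilon> * real k + C)) * (\<Sum>w\<in>F. exp (- t * G w))"
      using F(4) by (intro mult_left_mono) auto
    also have "\<dots> = (\<Sum>w\<in>F. blen (?b w) powr t * \<theta> (?b w))"
      unfolding sum_distrib_left
    proof (rule sum.cong[OF refl])
      fix w assume w: "w \<in> F"
      have "blen (?b w) powr t * \<theta> (?b w) = exp (- t * (G w + \<epsilon> * real k + C)) * (blen (?b w) powr t * blen (?b w) powr (- t))"
        using \<theta>[OF w] by simp
      also have "blen (?b w) powr t * blen (?b w) powr (- t) = 1"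
        using fw(6)[OF w] by (simp add: powr_minus)
      finally show "exp (- t * (\<epsilon> * real k + C)) * exp (- t * G w) = blen (?b w) powr t * \<theta> (?b w)"
        by (simp add: exp_add[symmetric] algebra_simps)
    qed
    also have "\<dots> = (\<Sum>\<psi>\<in>?b ` F. blen \<psi> powr t * \<theta> \<psi>)" using inj by (simp add: sum.reindex)
    finally show ?thesis by simp
  qed
  moreover have "0 < \<theta> \<psi> \<and> (\<forall>y\<in>{0<..<1}. \<theta> \<psi> \<le> exp (- t * fb.birk k (\<psi> y)))" if "\<psi> \<in> ?b ` F" for \<psi>
  proof -
    obtain w where w: "w \<in> F" "\<psi> = ?b w" using \<open>\<psi> \<in> ?b ` F\<close> by blast
    have l: "0 < blen (?b w)" by (rule fw(6)[OF w(1)])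
    have "\<theta> \<psi> \<le> exp (- t * fb.birk k (\<psi> y))" if y: "y \<in> {0<..<1}" for y
    proof -
      have "t * fb.birk k (\<psi> y) \<le> t * (G w + ln (blen (?b w)) + \<epsilon> * real k + C)"
        using C[OF Ff[OF w(1)] y] t0 by (intro mult_left_mono) (auto simp: fb.birk_def birkhoff_def w(2))
      moreover have "\<theta> \<psi> = exp (- t * (G w + ln (blen (?b w)) + \<epsilon> * real k + C))"
        unfolding w(2) \<theta>[OF w(1)] using l by (simp add: powr_def exp_add[symmetric] algebra_simps)
      ultimately show ?thesis by simp
    qed
    moreover have "0 < \<theta> \<psi>" unfolding w(2) \<theta>[OF w(1)] using l by simp
    ultimately show ?thesis by blast
  qed
  moreover have "?b ` F \<subseteq> map_branches T k" using fw(1) by blast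
  moreover have "disjoint_family_on (\<lambda>\<psi>. {blo \<psi><..<bhi \<psi>}) (?b ` F)"
    unfolding disjoint_family_on_def using dis by blast
  ultimately have "fb.expanding t"
    unfolding fb.expanding_def using F(1,2) by (intro exI[of _ k] exI[of _ "?b ` F"] exI[of _ \<theta>]) auto
  then show ?thesis
    using t0 t(2) by (rule_tac fb.limsup_content_bound) (auto simp: W_set_minus_zero_orbits[OF adm])
qed

text \<open>Between t and s there is an exponent of positive pressure, where some constant \<kappa>
  holds; \<open>content_bound_one\<close> turns it into 1 at t.\<close>

lemma W_set_large_intersection:
  assumes h: "\<And>n. L-lipschitz_on {0..1} (h n)" "\<And>n. h n ` {0..1} \<subseteq> {0..1}"
    and P: "has_pressure T (\<lambda>x. - s * (f x + log_deriv T x)) 0"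
  shows "0 < s" "s \<le> 1" "W_set T f h - zero_orbits T \<in> large_intersection_class s"
proof -
  have s: "critical_exponent T < s" "W.press s = 0" using P has_pressure_zero_iff by blast+
  then show "0 < s" using W.\<sigma>(1) by simp
  show s1: "s \<le> 1"
  proof (rule ccontr)
    assume "\<not> s \<le> 1"
    then have "0 < (s - 1) * m" "W.press s \<le> W.press 1 - (s - 1) * m"
      using m W.press_strict[of 1 s] W.\<sigma>(2) by auto
    then show False using W.press_one s(2) by linarith
  qed
  have "content_bound t 1 (W_set T f h - zero_orbits T)" if t: "0 < t" "t < s" for t
  proof -
    \<comment> \<open>t' has to exceed the critical exponent as well, below which t may lie.\<close>
    define t' where "t' = (max t (critical_exponent T) + s) / 2"
    have t': "t < t'" "critical_exponent T < t'" "t' < s" using t s by (auto simp: t'_def max_def)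
    have "0 < (s - t') * m" using t' m by simp
    then have "0 < W.press t'" using W.press_strict[of t' s] t' s(2) by simp
    then obtain \<kappa> where "\<kappa> > 0" "content_bound t' \<kappa> (W_set T f h - zero_orbits T)"
      using W_set_content_bound[OF h t'(2)] t' s1 by fastforce
    then show ?thesis using content_bound_one[of t t' \<kappa>] t t' s1 by simp
  qed
  moreover have "W_set T f h - zero_orbits T \<subseteq> {0..1}" by (auto simp: W_set_def)
  moreover have "gdelta (W_set T f h - zero_orbits T)"
    using gdelta_W_set[OF adm cont] h(1) lipschitz_on_continuous_on by blast
  ultimately show "W_set T f h - zero_orbits T \<in> large_intersection_class s"
    using s1 by (intro large_intersection_classI) auto
qed

end

theorem theorem1p7:
  fixes T :: interval_map and f :: "real \<Rightarrow> real" and h :: "nat \<Rightarrow> real \<Rightarrow> real" and L :: real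
  assumes "admissible_map T"
    and "continuous_on {0..1} f" and "\<forall>x\<in>{0..1}. f x > 0"
    and "\<forall>n. L-lipschitz_on {0..1} (h n)"
    and "\<forall>n. h n ` {0..1} \<subseteq> {0..1}"
  shows "(\<exists>!s :: real. has_pressure T (\<lambda>x. - s * (f x + log_deriv T x)) 0) \<and>
    (\<forall>s :: real. has_pressure T (\<lambda>x. - s * (f x + log_deriv T x)) 0 \<longrightarrow>
       0 < s \<and> s \<le> 1 \<and> W_set T f h - zero_orbits T \<in> large_intersection_class s)"
proof -
  have ne: "{0..1::real} \<noteq> {}" by simp
  obtain a where a: "a \<in> {0..1}" "\<And>x. x \<in> {0..1} \<Longrightarrow> f a \<le> f x"
    using continuous_attains_inf[OF compact_Icc ne assms(2)] by blast
  obtain c where c: "\<And>x. x \<in> {0..1} \<Longrightarrow> f x \<le> f c"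
    using continuous_attains_sup[OF compact_Icc ne assms(2)] by blast
  interpret gibbs_map T f "f a" "f c"
    using assms(1,2,3) a c by unfold_locales auto
  show ?thesis using pressure_root_unique W_set_large_intersection assms(4,5) by blast
qed

end
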